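(* The following decision problem is NP-hard (under polynomial-time many-one, i.e. Karp, reductions): given $n\in\mathbb{N}$ and a symmetric $n\times n$ rational matrix $\Gamma$, decide whether $\Gamma\in\mathcal{C}(n)$. Moreover, NP-hardness holds already for the restriction of this problem to matrices $\Gamma$ whose last row and last column are both identical to the diagonal of $\Gamma$ and whose last entry is $\Gamma_{nn}=1$ (i.e. $\Gamma_{in}=\Gamma_{ni}=\Gamma_{ii}$ for all $i\le n$ and $\Gamma_{nn}=1$).
   Context: For an integer $n\ge 1$ let $P_n=2^n-1$, and for $0\le k\le P_n$ let $x_k\in\{0,1\}^n$ be the vector giving the base-2 representation of $k$ (so $x_0,\dots,x_{P_n}$ enumerate $\{0,1\}^n$, with $x_0=0$), and $X^k=x_kx_k^{\top}$. The correlation cone of order $n$ is $\mathcal{C}(n)=\{\sum_{0\le k\le P_n}p_kX^k : p\in\mathbb{R}^{2^n},\ p\ge 0\}$, the conic hull of the matrices $X^k$. *)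

theory Defs
  imports "Jordan_Normal_Form.Matrix" "HOL-Computational_Algebra.Polynomial"
begin

section \<open>Deterministic multi-tape Turing machines\<close>

text \<open>
  Tapes are infinite in both directions. Symbol 0 is the blank, symbols 1 and 2 stand for the
  bits 0 and 1, and a machine may use further symbols. The states are the numbers below
  \<open>num_states\<close>; the start state is 0 and the number \<open>num_states\<close> itself is the halting state.
\<close>

datatype move = Left | Stay | Right

type_synonym tape = "(int \<Rightarrow> nat) \<times> int"

type_synonym config = "nat \<times> tape list"

record turing_machine =
  num_tapes :: nat
  num_symbols :: nat
  num_states :: nat
  trans :: "nat \<Rightarrow> nat list \<Rightarrow> nat \<times> (nat \<times> move) list"

text \<open>
  Only the values of \<open>trans\<close> on states below \<open>num_states\<close> and on lists of \<open>num_tapes\<close> symbols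
  below \<open>num_symbols\<close> matter, so a machine is given by a finite table.
\<close>

definition wf_tm :: "turing_machine \<Rightarrow> bool" where
  "wf_tm M \<longleftrightarrow> num_symbols M \<ge> 3 \<and>
    (\<forall>q < num_states M. \<forall>ss. length ss = num_tapes M \<and> (\<forall>s\<in>set ss. s < num_symbols M) \<longrightarrow>
      (case trans M q ss of (q', as) \<Rightarrow>
        q' \<le> num_states M \<and> length as = num_tapes M \<and> (\<forall>(s, d)\<in>set as. s < num_symbols M)))"

fun read_tape :: "tape \<Rightarrow> nat" where
  "read_tape (c, h) = c h"

fun displacement :: "move \<Rightarrow> int" where
  "displacement Left = -1"
| "displacement Stay = 0"
| "displacement Right = 1"

fun act :: "nat \<times> move \<Rightarrow> tape \<Rightarrow> tape" where
  "act (s, d) (c, h) = (c(h := s), h + displacement d)"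

fun step :: "turing_machine \<Rightarrow> config \<Rightarrow> config" where
  "step M (q, ts) =
    (if q < num_states M
     then (case trans M q (map read_tape ts) of (q', as) \<Rightarrow> (q', map2 act as ts))
     else (q, ts))"

definition string_contents :: "bool list \<Rightarrow> int \<Rightarrow> nat" where
  "string_contents x i =
    (if 0 \<le> i \<and> i < int (length x) then (if x ! nat i then 2 else 1) else 0)"

definition init_config :: "turing_machine \<Rightarrow> bool list list \<Rightarrow> config" where
  "init_config M xs =
    (0, map (\<lambda>j. (string_contents (if j < length xs then xs ! j else []), 0)) [0..<num_tapes M])"

text \<open>
  The input strings are on the first \<open>length xs\<close> tapes and the output is on the next one.
  Halting configurations are fixed points of \<open>step\<close>, so this says: halts within \<open>t\<close> steps.
\<close>

definition outputs_within :: "turing_machine \<Rightarrow> bool list list \<Rightarrow> bool list \<Rightarrow> nat \<Rightarrow> bool" where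
  "outputs_within M xs y t \<longleftrightarrow>
    (case (step M ^^ t) (init_config M xs) of (q, ts) \<Rightarrow>
      q = num_states M \<and> fst (ts ! length xs) = string_contents y)"


section \<open>Polynomial time, NP and NP-hardness\<close>

definition polytime_fun :: "(bool list \<Rightarrow> bool list) \<Rightarrow> bool" where
  "polytime_fun f \<longleftrightarrow>
    (\<exists>M (p :: nat poly). wf_tm M \<and> num_tapes M \<ge> 2 \<and>
      (\<forall>x. outputs_within M [x] (f x) (poly p (length x))))"

definition polytime_rel :: "(bool list \<Rightarrow> bool list \<Rightarrow> bool) \<Rightarrow> bool" where
  "polytime_rel R \<longleftrightarrow>
    (\<exists>M (p :: nat poly). wf_tm M \<and> num_tapes M \<ge> 3 \<and>
      (\<forall>x w. outputs_within M [x, w] [R x w] (poly p (length x + length w))))"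

definition class_NP :: "bool list set set" where
  "class_NP = {L. \<exists>R (p :: nat poly). polytime_rel R \<and>
    L = {x. \<exists>w. length w \<le> poly p (length x) \<and> R x w}}"

text \<open>
  A decision problem consists of a set \<open>I\<close> of instances, a question \<open>Q\<close> about them and an
  encoding \<open>enc\<close> of the instances as bit strings, intended to be injective on \<open>I\<close>. A Karp reduction has to map
  every string to the encoding of an instance, so hardness of a restriction of a problem to
  fewer instances implies hardness of the problem.
\<close>

definition NP_hard :: "('a \<Rightarrow> bool list) \<Rightarrow> 'a set \<Rightarrow> ('a \<Rightarrow> bool) \<Rightarrow> bool" where
  "NP_hard enc I Q \<longleftrightarrow>
    (\<forall>L\<in>class_NP. \<exists>f. polytime_fun f \<and> (\<forall>x. \<exists>a\<in>I. f x = enc a \<and> (x \<in> L \<longleftrightarrow> Q a)))"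


section \<open>Binary encoding of rational matrices\<close>

text \<open>Least significant bit first, without leading zeros.\<close>

fun nat_bits :: "nat \<Rightarrow> bool list" where
  "nat_bits n = (if n = 0 then [] else odd n # nat_bits (n div 2))"

declare nat_bits.simps [simp del]

text \<open>Self-delimiting: each bit is preceded by True, and a single False marks the end.\<close>

definition enc_nat :: "nat \<Rightarrow> bool list" where
  "enc_nat n = concat (map (\<lambda>b. [True, b]) (nat_bits n)) @ [False]"

definition enc_int :: "int \<Rightarrow> bool list" where
  "enc_int z = (z < 0) # enc_nat (nat \<bar>z\<bar>)"

text \<open>Numerator and denominator in lowest terms, with positive denominator.\<close>

definition enc_rat :: "rat \<Rightarrow> bool list" where
  "enc_rat r = (case quotient_of r of (a, b) \<Rightarrow> enc_int a @ enc_nat (nat b))"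

text \<open>For square matrices: the order, followed by the entries row by row.\<close>

definition enc_mat :: "rat mat \<Rightarrow> bool list" where
  "enc_mat A = enc_nat (dim_row A) @ concat (map enc_rat (concat (mat_to_list A)))"


definition sym_rat_mats :: "rat mat set" where
  "sym_rat_mats = {\<Gamma>. \<exists>n\<ge>1. \<Gamma> \<in> carrier_mat n n \<and> transpose_mat \<Gamma> = \<Gamma>}"

text \<open>Indices start at 0, so the last row and column have index \<open>n - 1\<close>.\<close>

definition normalized_sym_rat_mats :: "rat mat set" where
  "normalized_sym_rat_mats =
    {\<Gamma>. \<exists>n\<ge>1. \<Gamma> \<in> carrier_mat n n \<and> transpose_mat \<Gamma> = \<Gamma> \<and>
      (\<forall>i<n. \<Gamma> $$ (i, n - 1) = \<Gamma> $$ (i, i) \<and> \<Gamma> $$ (n - 1, i) = \<Gamma> $$ (i, i)) \<and>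
      \<Gamma> $$ (n - 1, n - 1) = 1}"

text \<open>The encoding is injective on the instances.\<close>

lemma nat_bits_inject: "nat_bits m = nat_bits n \<Longrightarrow> m = n"
proof (induction m arbitrary: n rule: less_induct)
  case (less m)
  show ?case
  proof (cases "m = 0 \<or> n = 0")
    case True
    then show ?thesis using less.prems
      by (auto simp: nat_bits.simps[of m] nat_bits.simps[of n] split: if_splits)
  next
    case False
    then have "odd m = odd n" "nat_bits (m div 2) = nat_bits (n div 2)"
      using less.prems by (simp_all add: nat_bits.simps[of m] nat_bits.simps[of n])
    then have "m mod 2 = n mod 2" "m div 2 = n div 2"
      using less.IH[of "m div 2" "n div 2"] False by (simp_all add: parity_cases mod2_eq_if)
    then show ?thesis by (metis div_mult_mod_eq)
  qed
qed

lemma delimited_inject: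
  "concat (map (\<lambda>b. [True, b]) u) @ [False] @ xs = concat (map (\<lambda>b. [True, b]) v) @ [False] @ ys
    \<Longrightarrow> u = v \<and> xs = ys"
proof (induction u arbitrary: v)
  case Nil
  then show ?case by (cases v) auto
next
  case (Cons b u)
  then show ?case by (cases v) auto
qed

lemma enc_nat_inject: "enc_nat m @ xs = enc_nat n @ ys \<Longrightarrow> m = n \<and> xs = ys"
  using delimited_inject[of "nat_bits m" xs "nat_bits n" ys] nat_bits_inject[of m n]
  by (simp add: enc_nat_def)

lemma enc_int_inject: "enc_int a @ xs = enc_int b @ ys \<Longrightarrow> a = b \<and> xs = ys"
  using enc_nat_inject[of "nat \<bar>a\<bar>" xs "nat \<bar>b\<bar>" ys]
  by (auto simp: enc_int_def)

lemma enc_rat_inject: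
  assumes "enc_rat r @ xs = enc_rat s @ ys"
  shows "r = s \<and> xs = ys"
proof -
  obtain a b where r: "quotient_of r = (a, b)" by (cases "quotient_of r")
  obtain c d where s: "quotient_of s = (c, d)" by (cases "quotient_of s")
  have *: "enc_int a @ enc_nat (nat b) @ xs = enc_int c @ enc_nat (nat d) @ ys"
    using assms by (simp add: enc_rat_def r s)
  then have "a = c" "enc_nat (nat b) @ xs = enc_nat (nat d) @ ys"
    using enc_int_inject[OF *] by simp_all
  then have "a = c" "nat b = nat d" "xs = ys" using enc_nat_inject by blast+
  moreover have "b > 0" "d > 0" using quotient_of_denom_pos[OF r] quotient_of_denom_pos[OF s] .
  ultimately show ?thesis using r s by (metis nat_eq_iff2 quotient_of_inject less_le_not_le)
qed

lemma enc_rats_inject: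
  "concat (map enc_rat u) = concat (map enc_rat v) \<Longrightarrow> length u = length v \<Longrightarrow> u = v"
proof (induction u arbitrary: v)
  case (Cons r u)
  then show ?case by (cases v) (auto dest: enc_rat_inject)
qed simp

lemma enc_mat_inj: "inj_on enc_mat sym_rat_mats"
proof (rule inj_onI)
  fix A B assume "A \<in> sym_rat_mats" "B \<in> sym_rat_mats" and eq: "enc_mat A = enc_mat B"
  then obtain m n where A: "A \<in> carrier_mat m m" and B: "B \<in> carrier_mat n n"
    by (auto simp: sym_rat_mats_def)
  have enc: "enc_mat C = enc_nat k @ concat (map enc_rat (concat (mat_to_list C)))"
    if "C \<in> carrier_mat k k" for C k
    using that by (simp add: enc_mat_def)
  have "m = n" "concat (map enc_rat (concat (mat_to_list A))) = concat (map enc_rat (concat (mat_to_list B)))"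
    using eq enc_nat_inject unfolding enc[OF A] enc[OF B] by blast+
  moreover have len: "length (concat (mat_to_list C)) = k * k" if "C \<in> carrier_mat k k" for C :: "rat mat" and k
    using that by (simp add: mat_to_list_def length_concat comp_def sum_list_triv)
  ultimately have *: "concat (mat_to_list A) = concat (mat_to_list B)"
    using enc_rats_inject len[OF A] len[OF B] by metis
  have "mat_to_list A = mat_to_list B"
    by (rule concat_injective[OF *]) (use A B \<open>m = n\<close> in \<open>auto simp: mat_to_list_def set_zip\<close>)
  then have "\<forall>i<n. \<forall>j<n. A $$ (i, j) = B $$ (i, j)"
    using A B \<open>m = n\<close> by (auto simp: mat_to_list_def)
  then show "A = B" using A B \<open>m = n\<close> by (intro eq_matI) auto
qed


section \<open>The correlation cone\<close>

definition binary_vec :: "nat \<Rightarrow> nat \<Rightarrow> real vec" where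
  "binary_vec n k = vec n (\<lambda>i. of_bool (bit k (n - 1 - i)))"

definition corr_mat :: "nat \<Rightarrow> nat \<Rightarrow> real mat" where
  "corr_mat n k = mat n n (\<lambda>(i, j). binary_vec n k $ i * binary_vec n k $ j)"

text \<open>The sum of matrices is written out entrywise.\<close>

definition correlation_cone :: "nat \<Rightarrow> real mat set" where
  "correlation_cone n =
    {mat n n (\<lambda>(i, j). \<Sum>k\<le>2 ^ n - 1. p k * corr_mat n k $$ (i, j)) | p :: nat \<Rightarrow> real.
      \<forall>k\<le>2 ^ n - 1. p k \<ge> 0}"

definition in_correlation_cone :: "rat mat \<Rightarrow> bool" where
  "in_correlation_cone \<Gamma> \<longleftrightarrow> map_mat of_rat \<Gamma> \<in> correlation_cone (dim_row \<Gamma>)"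

end

(*
Every L in NP is reduced directly to membership in the correlation cone.

Tableau: an accepting computation of a verifier for L is a solution of a binary constraint problem
with polynomially many variables and values, that is, a clique with one node in each of m groups of
g nodes of a compatibility graph.

Clique gadget: besides the nodes v there are coordinates q_b, p_b for every group b, two coordinates
z, z', and a coordinate that is 1 in every vector. The matrix forces every vector x x^T in a
decomposition to satisfy p_b + q_b + sum of the nodes in b = 1, to contain no incompatible pair
of nodes, and to have no q_b together with z' and no p_b together with z. As the entry (z, z') is
positive, some vector has z = z' = 1, so it uses no p_b or q_b and is a full clique.
Conversely, all other entries can be corrected without knowing the clique: vectors with at most two
nodes and the remaining groups filled by p or by q, never with z = z' = 1, contribute what a
given clique s does not. The weights that achieve this are: 2 for s; 1 - s_v s_w for each ordered
compatible pair v, w (filled by p, z = z' = 0); and for each single node v: 2 (m - 1) s_v (filled by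
p) and 2 s_v (filled by q) with z = z' = 0, and 2 (1 - s_v) each with z = 1 (filled by q) and with
z' = 1 (filled by p). All resulting entries are independent of s.

Polynomial time: the entries of the matrix are values of expressions built from variables,
input bits, sums, differences and bounded summation. Such expressions are polynomially bounded and
are evaluated in unary by counter programs, which Turing machines simulate step by step.
*)

theory Submission
  imports Defs
begin

section \<open>Counter programs and their Turing machines\<close>

text \<open>The matrix has to be printed without knowing a clique, so no entry may depend on which
  clique is hidden in it, and yet every decomposition must contain a full clique. This tension
  explains the two fillers. The entries (v, z) must not show whether v lies in the clique, so the
  nodes outside it need vectors with z = 1, and these leave groups without a node. They are filled
  by q, which z tolerates; for z' the same is done with p. Only a vector with z = z' = 1 tolerates
  neither filler. The factor 2 in the weights comes from the node pairs, since the two orders of a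
  pair contribute to the same entry. As p_b is an affine function of the other coordinates, its
  entries follow from theirs and need no count of their own. All numbers that are computed are
  polynomial in the input length, so unary counters are fast enough. Powers of two, which binary
  output requires, are recognised by their divisors instead of being computed.\<close>

datatype op = Inc nat | Dec nat | InRight | InLeft | Emit bool

datatype tst = Pos nat | NonBlank | IsTwo

datatype com = Do op | Seq com com (infixr ";;" 60) | If tst com | While tst com

type_synonym state = "(nat \<Rightarrow> nat) \<times> int \<times> bool list"

fun exec :: "op \<Rightarrow> state \<Rightarrow> state" where
  "exec (Inc r) (R, h, out) = (R(r := R r + 1), h, out)"
| "exec (Dec r) (R, h, out) = (R(r := R r - 1), h, out)"
| "exec InRight (R, h, out) = (R, h + 1, out)"
| "exec InLeft (R, h, out) = (R, h - 1, out)"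
| "exec (Emit b) (R, h, out) = (R, h, out @ [b])"

fun holds :: "bool list \<Rightarrow> tst \<Rightarrow> state \<Rightarrow> bool" where
  "holds x (Pos r) (R, h, out) \<longleftrightarrow> R r > 0"
| "holds x NonBlank (R, h, out) \<longleftrightarrow> string_contents x h \<noteq> 0"
| "holds x IsTwo (R, h, out) \<longleftrightarrow> string_contents x h = 2"

text \<open>The time index is the exact number of instructions that the compiled code executes: an
  entered \<open>If\<close> costs one extra branch, and every round of a loop costs a branch and a
  jump.\<close>

inductive runs :: "bool list \<Rightarrow> com \<Rightarrow> state \<Rightarrow> nat \<Rightarrow> state \<Rightarrow> bool" for x where
  runs_Do: "runs x (Do p) s 1 (exec p s)"
| runs_Seq: "runs x c s t s' \<Longrightarrow> runs x d s' t' s'' \<Longrightarrow> runs x (c ;; d) s (t + t') s''"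
| runs_If_True: "holds x b s \<Longrightarrow> runs x c s t s' \<Longrightarrow> runs x (If b c) s (Suc t) s'"
| runs_If_False: "\<not> holds x b s \<Longrightarrow> runs x (If b c) s 1 s"
| runs_While_False: "\<not> holds x b s \<Longrightarrow> runs x (While b c) s 1 s"
| runs_While_True: "holds x b s \<Longrightarrow> runs x c s t s' \<Longrightarrow> runs x (While b c) s' t' s'' \<Longrightarrow>
    runs x (While b c) s (t + t' + 2) s''"

datatype instr = Start | Act op | Branch tst nat | Jump nat

fun com_size :: "com \<Rightarrow> nat" where
  "com_size (Do p) = 1"
| "com_size (c ;; d) = com_size c + com_size d"
| "com_size (If b c) = com_size c + 1"
| "com_size (While b c) = com_size c + 2"

text \<open>The second argument is the address of the first instruction. It is needed because jump
  targets are absolute, being states of the machine. A branch jumps when its test fails.\<close>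

fun compile :: "com \<Rightarrow> nat \<Rightarrow> instr list" where
  "compile (Do p) a = [Act p]"
| "compile (c ;; d) a = compile c a @ compile d (a + com_size c)"
| "compile (If b c) a = Branch b (a + com_size c + 1) # compile c (a + 1)"
| "compile (While b c) a = Branch b (a + com_size c + 2) # compile c (a + 1) @ [Jump a]"

lemma length_compile [simp]: "length (compile c a) = com_size c"
  by (induction c arbitrary: a) auto

fun op_regs :: "op \<Rightarrow> nat set" where
  "op_regs (Inc r) = {r}" | "op_regs (Dec r) = {r}" | "op_regs _ = {}"

fun tst_regs :: "tst \<Rightarrow> nat set" where
  "tst_regs (Pos r) = {r}" | "tst_regs _ = {}"

fun instr_regs :: "instr \<Rightarrow> nat set" where
  "instr_regs (Act p) = op_regs p" | "instr_regs (Branch b a) = tst_regs b" | "instr_regs _ = {}"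

fun instr_target :: "instr \<Rightarrow> nat" where
  "instr_target (Branch b a) = a" | "instr_target (Jump a) = a" | "instr_target _ = 0"

lemma instr_target_compile: "i \<in> set (compile c a) \<Longrightarrow> instr_target i \<le> a + com_size c"
proof (induction c arbitrary: a)
  case (Seq c d)
  then show ?case by fastforce
next
  case (If b c)
  then show ?case by fastforce
next
  case (While b c)
  then show ?case by fastforce
qed auto

lemma finite_instr_regs: "finite (instr_regs i)"
proof (cases i)
  case (Act p) then show ?thesis by (cases p) auto
next
  case (Branch b a) then show ?thesis by (cases b) auto
qed auto

text \<open>
  Tape 0 is the input, tape 1 the output, and counter \<open>r\<close> is the head position on tape \<open>r + 2\<close>,
  whose cell 0 carries the mark 1.
\<close>

fun keep :: "nat list \<Rightarrow> (nat \<times> move) list" where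
  "keep ss = map (\<lambda>s. (s, Stay)) ss"

text \<open>\<open>Start\<close> puts the mark on the blank counter tapes. The mark doubles as the
  test for zero, and \<open>Dec\<close> does not move when it reads the mark, which gives truncated
  subtraction. The output head always stands on the first cell that is not yet written.\<close>

fun instr_trans :: "instr \<Rightarrow> nat \<Rightarrow> nat list \<Rightarrow> nat \<times> (nat \<times> move) list" where
  "instr_trans Start q ss = (q + 1, map (\<lambda>j. (if j < 2 then ss ! j else 1, Stay)) [0..<length ss])"
| "instr_trans (Act (Inc r)) q ss = (q + 1, (keep ss)[r + 2 := (ss ! (r + 2), Right)])"
| "instr_trans (Act (Dec r)) q ss =
    (q + 1, (keep ss)[r + 2 := (ss ! (r + 2), if ss ! (r + 2) = 1 then Stay else Left)])"
| "instr_trans (Act InRight) q ss = (q + 1, (keep ss)[0 := (ss ! 0, Right)])"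
| "instr_trans (Act InLeft) q ss = (q + 1, (keep ss)[0 := (ss ! 0, Left)])"
| "instr_trans (Act (Emit b)) q ss = (q + 1, (keep ss)[1 := (if b then 2 else 1, Right)])"
| "instr_trans (Branch b a) q ss =
    (if (case b of Pos r \<Rightarrow> ss ! (r + 2) \<noteq> 1 | NonBlank \<Rightarrow> ss ! 0 \<noteq> 0 | IsTwo \<Rightarrow> ss ! 0 = 2)
     then q + 1 else a, keep ss)"
| "instr_trans (Jump a) q ss = (a, keep ss)"

definition program_tm :: "nat \<Rightarrow> instr list \<Rightarrow> turing_machine" where
  "program_tm K P = \<lparr>num_tapes = K + 2, num_symbols = 3, num_states = length P,
    trans = \<lambda>q. instr_trans (P ! q) q\<rparr>"

definition mark :: "int \<Rightarrow> nat" where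
  "mark i = (if i = 0 then 1 else 0)"

fun tapes_of :: "nat \<Rightarrow> bool list \<Rightarrow> state \<Rightarrow> tape list" where
  "tapes_of K x (R, h, out) = (string_contents x, h) # (string_contents out, int (length out)) #
    map (\<lambda>r. (mark, int (R r))) [0..<K]"

lemma length_tapes_of [simp]: "length (tapes_of K x s) = K + 2"
  by (cases s) auto

lemma string_contents_snoc:
  "string_contents (out @ [b]) = (string_contents out)(int (length out) := if b then 2 else 1)"
proof
  fix i
  show "string_contents (out @ [b]) i = ((string_contents out)(int (length out) := if b then 2 else 1)) i"
  proof (cases "0 \<le> i \<and> i < int (length out)")
    case True
    then show ?thesis by (auto simp: string_contents_def nth_append nat_less_iff)
  next
    case False
    then show ?thesis by (auto simp: string_contents_def nth_append)
  qed
qed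

lemma tapes_of_nth:
  "j < K + 2 \<Longrightarrow> tapes_of K x (R, h, out) ! j =
    (if j = 0 then (string_contents x, h) else if j = 1 then (string_contents out, int (length out))
     else (mark, int (R (j - 2))))"
  by (cases j; cases "j - 1") (auto simp: nth_Cons')

lemma tapes_of_counter:
  "r < K \<Longrightarrow> tapes_of K x (R(r := n), h, out) = (tapes_of K x (R, h, out))[r + 2 := (mark, int n)]"
  by (intro nth_equalityI) (auto simp: tapes_of_nth nth_list_update simp del: tapes_of.simps)

lemma tapes_of_input: "tapes_of K x (R, h', out) = (tapes_of K x (R, h, out))[0 := (string_contents x, h')]"
  and tapes_of_output: "tapes_of K x (R, h, out') =
    (tapes_of K x (R, h, out))[1 := (string_contents out', int (length out'))]"
  by simp_all

lemma map2_act_keep: "map2 act (keep (map read_tape ts)) ts = ts"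
proof -
  have "act (read_tape t, Stay) t = t" for t by (cases t) auto
  then show ?thesis by (intro nth_equalityI) auto
qed

lemma map2_act_update:
  "j < length ts \<Longrightarrow>
    map2 act ((keep (map read_tape ts))[j := a]) ts = ts[j := act a (ts ! j)]"
  using map2_act_keep[of ts] by (metis list_update_id map_update prod.simps(2) zip_update)

declare keep.simps [simp del]

lemma step_Act:
  assumes "q < length P" "P ! q = Act p" "\<forall>r\<in>op_regs p. r < K"
  shows "step (program_tm K P) (q, tapes_of K x s) = (q + 1, tapes_of K x (exec p s))"
proof -
  obtain R h out where s: "s = (R, h, out)" by (cases s)
  have mark: "mark (int n) = 1 \<longleftrightarrow> n = 0" for n by (simp add: mark_def)
  show ?thesis
  proof (cases p)
    case (Inc r)
    then show ?thesis
      using assms by (simp add: s program_tm_def tapes_of_nth map2_act_update tapes_of_counter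
          add.commute[of 1] del: tapes_of.simps)
  next
    case (Dec r)
    then show ?thesis
      using assms mark[of "R r"]
      by (auto simp add: s program_tm_def tapes_of_nth map2_act_update tapes_of_counter of_nat_diff
          simp del: tapes_of.simps)
  next
    case InRight
    then show ?thesis
      using assms tapes_of_input[of K x R "h + 1" out h]
      by (simp add: s program_tm_def tapes_of_nth map2_act_update del: tapes_of.simps)
  next
    case InLeft
    then show ?thesis
      using assms tapes_of_input[of K x R "h - 1" out h]
      by (simp add: s program_tm_def tapes_of_nth map2_act_update del: tapes_of.simps)
  next
    case (Emit b)
    then show ?thesis
      using assms tapes_of_output[of K x R h "out @ [b]" out]
      by (simp add: s program_tm_def tapes_of_nth map2_act_update string_contents_snoc add.commute[of 1]
          del: tapes_of.simps)
  qed
qed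

lemma step_Branch:
  assumes "q < length P" "P ! q = Branch b a" "\<forall>r\<in>tst_regs b. r < K"
  shows "step (program_tm K P) (q, tapes_of K x s) =
    (if holds x b s then q + 1 else a, tapes_of K x s)"
proof -
  obtain R h out where s: "s = (R, h, out)" by (cases s)
  show ?thesis
    using assms
    by (cases b) (auto simp: s program_tm_def map2_act_keep tapes_of_nth mark_def simp del: tapes_of.simps)
qed

lemma step_Jump:
  assumes "q < length P" "P ! q = Jump a"
  shows "step (program_tm K P) (q, tapes_of K x s) = (a, tapes_of K x s)"
proof -
  obtain R h out where s: "s = (R, h, out)" by (cases s)
  show ?thesis
    using assms by (auto simp: s program_tm_def map2_act_keep simp del: tapes_of.simps)
qed

text \<open>The program \<open>P\<close> stays fixed and the code only has to occur in it at address
  \<open>q\<close>. In this form the hypothesis passes to subcommands, whose code lies in the same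
  \<open>P\<close> at a later address.\<close>

lemma steps_compile:
  assumes "runs x c s t s'"
    and "\<exists>u v. P = u @ compile c (length u) @ v \<and> length u = q"
    and "\<forall>i\<in>set P. \<forall>r\<in>instr_regs i. r < K"
  shows "(step (program_tm K P) ^^ t) (q, tapes_of K x s) = (q + com_size c, tapes_of K x s')"
  using assms
proof (induction arbitrary: q rule: runs.induct)
  case (runs_Do p s)
  then obtain u v where P: "P = u @ Act p # v" "length u = q" by auto
  then have "P ! q = Act p" "q < length P" by auto
  then have "step (program_tm K P) (q, tapes_of K x s) = (q + 1, tapes_of K x (exec p s))"
    using runs_Do P by (intro step_Act) auto
  then show ?case by simp
next
  case (runs_Seq c s t s' d t' s'')
  then obtain u v where P: "P = u @ compile c q @ compile d (q + com_size c) @ v" "length u = q"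
    by auto
  have "(step (program_tm K P) ^^ t) (q, tapes_of K x s) = (q + com_size c, tapes_of K x s')"
    using P by (intro runs_Seq.IH runs_Seq.prems) blast
  moreover have "(step (program_tm K P) ^^ t') (q + com_size c, tapes_of K x s') =
      (q + com_size c + com_size d, tapes_of K x s'')"
    using P by (intro runs_Seq.IH runs_Seq.prems exI[of _ "u @ compile c q"] exI[of _ v]) auto
  ultimately show ?case by (simp add: add.commute[of t] funpow_add add.assoc)
next
  case (runs_If_True b s c t s')
  then obtain u v where P: "P = u @ Branch b (q + com_size c + 1) # compile c (q + 1) @ v" "length u = q"
    by auto
  then have "P ! q = Branch b (q + com_size c + 1)" "q < length P" by auto
  then have "step (program_tm K P) (q, tapes_of K x s) = (q + 1, tapes_of K x s)"
    using runs_If_True P by (subst step_Branch) auto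
  moreover have "(step (program_tm K P) ^^ t) (q + 1, tapes_of K x s) =
      (q + 1 + com_size c, tapes_of K x s')"
    using P by (intro runs_If_True.IH runs_If_True.prems exI[of _ "u @ [Branch b (q + com_size c + 1)]"] exI[of _ v]) auto
  ultimately show ?case by (simp only: funpow_Suc_right comp_apply) simp
next
  case (runs_If_False b s c)
  then obtain u v where P: "P = u @ Branch b (q + com_size c + 1) # compile c (q + 1) @ v" "length u = q"
    by auto
  then have "P ! q = Branch b (q + com_size c + 1)" "q < length P" by auto
  then show ?case using runs_If_False P by (simp del: step.simps) (subst step_Branch, auto)
next
  case (runs_While_False b s c)
  then obtain u v where P: "P = u @ Branch b (q + com_size c + 2) # compile c (q + 1) @ [Jump q] @ v" "length u = q"
    by auto
  then have "P ! q = Branch b (q + com_size c + 2)" "q < length P" by auto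
  then show ?case using runs_While_False P by (simp del: step.simps) (subst step_Branch, auto)
next
  case (runs_While_True b s c t s' t' s'')
  then obtain u v where P: "P = u @ Branch b (q + com_size c + 2) # compile c (q + 1) @ Jump q # v" "length u = q"
    by auto
  let ?f = "step (program_tm K P)"
  have br: "P ! q = Branch b (q + com_size c + 2)" "q < length P" using P by auto
  have jp: "P ! (q + 1 + com_size c) = Jump q" "q + 1 + com_size c < length P"
    using P by (auto simp: nth_append)
  have "?f (q, tapes_of K x s) = (q + 1, tapes_of K x s)"
    using runs_While_True br P by (subst step_Branch) auto
  moreover have "(?f ^^ t) (q + 1, tapes_of K x s) = (q + 1 + com_size c, tapes_of K x s')"
    using P by (intro runs_While_True.IH(1) runs_While_True.prems exI[of _ "u @ [Branch b (q + com_size c + 2)]"]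
        exI[of _ "Jump q # v"]) auto
  moreover have "?f (q + 1 + com_size c, tapes_of K x s') = (q, tapes_of K x s')"
    using jp by (subst step_Jump) auto
  moreover have "(?f ^^ t') (q, tapes_of K x s') = (q + com_size (While b c), tapes_of K x s'')"
    using P by (intro runs_While_True.IH(2) runs_While_True.prems)
  ultimately have "(?f ^^ t') (?f ((?f ^^ t) (?f (q, tapes_of K x s)))) = (q + com_size (While b c), tapes_of K x s'')"
    by (simp only:)
  moreover have "t + t' + 2 = t' + (Suc (t + Suc 0))" by simp
  ultimately show ?case by (simp only: funpow_add comp_apply funpow.simps id_apply o_id) 
qed

lemma wf_program_tm:
  assumes "\<forall>i\<in>set P. instr_target i \<le> length P"
  shows "wf_tm (program_tm K P)"
proof -
  have "case instr_trans i q ss of (q', as) \<Rightarrow>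
      q' \<le> length P \<and> length as = K + 2 \<and> (\<forall>(s, d)\<in>set as. s < 3)"
    if "q < length P" "i \<in> set P" "length ss = K + 2" "\<forall>s\<in>set ss. s < 3" for q ss i
  proof -
    have tgt: "instr_target i \<le> length P" using assms that by blast
    have upd: "\<forall>(s, d)\<in>set ((keep ss)[j := (s', d')]). s < 3" if "s' < 3" for j s' d'
      using that \<open>\<forall>s\<in>set ss. s < 3\<close> set_update_subset_insert[of "keep ss" j "(s', d')"] by (auto simp: keep.simps)
    have nth: "ss ! j < 3 \<or> \<not> j < K + 2" for j using that by auto
    show ?thesis
    proof (cases i)
      case Start
      then show ?thesis using that nth by auto
    next
      case (Act p)
      \<comment> \<open>An update beyond the end of the list changes nothing, which covers register
        numbers of any size.\<close>
      have *: "(keep ss)[j := (ss ! j, d)] = keep ss \<or> ss ! j < 3" for j d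
        using nth[of j] that by (auto simp: list_update_beyond keep.simps)
      have "\<forall>(s, d)\<in>set ((keep ss)[j := (ss ! j, d)]). s < 3" for j d
        using *[of j d] upd[of "ss ! j" j d] that(4) by (auto simp: keep.simps)
      moreover have "\<forall>(s, d)\<in>set ((keep ss)[1 := (if b then 2 else 1, Right)]). s < 3" for b
        using upd[of 2 1 Right] upd[of 1 1 Right] by (cases b) simp_all
      moreover have "length (keep ss) = K + 2" using that by (simp add: keep.simps)
      ultimately show ?thesis using Act that by (cases p) simp_all
    next
      case (Branch b a)
      then show ?thesis using that tgt by (auto simp: keep.simps)
    next
      case (Jump a)
      then show ?thesis using that tgt by (auto simp: keep.simps)
    qed
  qed
  then show ?thesis by (auto simp: wf_tm_def program_tm_def)
qed

theorem polytime_fun_if_runs: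
  assumes "\<And>x. \<exists>t R h. t \<le> poly p (length x) \<and> runs x c ((\<lambda>_. 0), 0, []) t (R, h, f x)"
  shows "polytime_fun f"
proof -
  \<comment> \<open>\<open>Start\<close> occupies address 0, so the code begins at address 1.
    Running off its end leads to state \<open>length P\<close>, which is the halting state.\<close>
  define P where "P = Start # compile c 1"
  have "finite (\<Union>i\<in>set P. instr_regs i)" by (simp add: finite_instr_regs)
  then obtain K where K: "\<forall>i\<in>set P. \<forall>r\<in>instr_regs i. r < K"
    using finite_nat_set_iff_bounded by (metis UN_iff)
  let ?M = "program_tm K P"
  have "\<forall>i\<in>set P. instr_target i \<le> length P"
    using instr_target_compile[of _ c 1] by (auto simp: P_def)
  then have wf: "wf_tm ?M" by (rule wf_program_tm)
  have halt: "(step ?M ^^ k) (length P, ts) = (length P, ts)" for k ts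
    by (induction k) (auto simp: program_tm_def)
  have "outputs_within ?M [x] (f x) (poly (p + 1) (length x))" for x
  proof -
    from assms[of x] obtain t R h where t: "t \<le> poly p (length x)"
      and r: "runs x c ((\<lambda>_. 0), 0, []) t (R, h, f x)" by auto
    have "init_config ?M [x] = (0, (string_contents x, 0) # (string_contents [], 0) # replicate K (string_contents [], 0))"
    proof -
      have "map (\<lambda>j. (string_contents (if j < length [x] then [x] ! j else []), 0 :: int)) [0..<K + 2] =
          (string_contents x, 0) # (string_contents [], 0) # replicate K (string_contents [], 0)"
        by (intro nth_equalityI) (auto simp: nth_Cons' simp del: upt_Suc)
      then show ?thesis by (simp add: init_config_def program_tm_def del: upt_Suc)
    qed
    moreover have "(string_contents [])(0 := 1) = mark"
      by (auto simp: string_contents_def mark_def)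
    then have "map2 act (map (\<lambda>j. (if j < 2 then (string_contents x 0 # string_contents [] 0 # replicate K (string_contents [] 0)) ! j else 1, Stay)) [0..<K + 2])
       ((string_contents x, 0) # (string_contents [], 0) # replicate K (string_contents [], 0)) = tapes_of K x ((\<lambda>_. 0), 0, [])"
      by (intro nth_equalityI) (auto simp: nth_Cons' tapes_of_nth simp del: upt_Suc tapes_of.simps)
    ultimately have "step ?M (init_config ?M [x]) = (1, tapes_of K x ((\<lambda>_. 0), 0, []))"
      by (simp add: program_tm_def P_def del: upt_Suc tapes_of.simps)
    moreover have "(step ?M ^^ t) (1, tapes_of K x ((\<lambda>_. 0), 0, [])) = (1 + com_size c, tapes_of K x (R, h, f x))"
    proof (rule steps_compile[OF r])
      show "\<exists>u v. P = u @ compile c (length u) @ v \<and> length u = 1"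
        by (rule exI[of _ "[Start]"], rule exI[of _ "[]"]) (simp add: P_def)
    qed (use K in blast)
    ultimately have "(step ?M ^^ Suc t) (init_config ?M [x]) = (length P, tapes_of K x (R, h, f x))"
      by (simp add: funpow_Suc_right P_def del: funpow.simps)
    \<comment> \<open>One step for \<open>Start\<close>, \<open>t\<close> steps for the code; in the
      remaining steps the machine rests in the halting state.\<close>
    moreover have "poly (p + 1) (length x) = (poly p (length x) - t) + Suc t" using t by simp
    ultimately have "(step ?M ^^ poly (p + 1) (length x)) (init_config ?M [x]) = (length P, tapes_of K x (R, h, f x))"
      by (simp only: funpow_add comp_apply halt)
    then show ?thesis by (simp add: outputs_within_def tapes_of_nth program_tm_def)
  qed
  moreover have "num_tapes ?M \<ge> 2" by (simp add: program_tm_def)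
  ultimately show ?thesis using wf unfolding polytime_fun_def by blast
qed

section \<open>Polynomially bounded counting expressions\<close>

definition runs_in :: "bool list \<Rightarrow> com \<Rightarrow> state \<Rightarrow> nat \<Rightarrow> state \<Rightarrow> bool" where
  "runs_in x c s B s' \<longleftrightarrow> (\<exists>t\<le>B. runs x c s t s')"

lemma runs_in_mono: "runs_in x c s B s' \<Longrightarrow> B \<le> B' \<Longrightarrow> runs_in x c s B' s'"
  unfolding runs_in_def by (meson le_trans)

lemma runs_in_Do: "exec p s = s' \<Longrightarrow> runs_in x (Do p) s 1 s'"
  unfolding runs_in_def using runs_Do by blast

lemma runs_in_conv:
  "runs_in x c s B s' \<Longrightarrow> s = u \<Longrightarrow> s' = u' \<Longrightarrow> B \<le> B' \<Longrightarrow> runs_in x c u B' u'"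
  using runs_in_mono by blast

lemma runs_in_Seq:
  "runs_in x c s B s' \<Longrightarrow> runs_in x d s' B' s'' \<Longrightarrow> runs_in x (c ;; d) s (B + B') s''"
  unfolding runs_in_def by (meson add_mono runs_Seq)

lemma runs_in_Do_Seq: "runs_in x c (exec p s) B s' \<Longrightarrow> runs_in x (Do p ;; c) s (1 + B) s'"
  using runs_in_Do runs_in_Seq by blast

lemma runs_in_If:
  "(holds x b s \<Longrightarrow> runs_in x c s B s') \<Longrightarrow> (\<not> holds x b s \<Longrightarrow> s' = s) \<Longrightarrow>
    runs_in x (If b c) s (Suc B) s'"
  unfolding runs_in_def
  by (cases "holds x b s") (auto intro: runs_If_True runs_If_False[of x b s c, simplified] exI[of _ 1])

text \<open>A loop is described by the explicit family \<open>S\<close> of the states between its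
  rounds, so each use only supplies \<open>S\<close> and contains no induction of its own.\<close>

lemma runs_in_While:
  assumes "\<And>i. i < n \<Longrightarrow> holds x b (S i) \<and> runs_in x c (S i) B (S (Suc i))" "\<not> holds x b (S n)"
  shows "runs_in x (While b c) (S 0) (n * (B + 2) + 1) (S n)"
  using assms
proof (induction n arbitrary: S)
  case 0
  then show ?case unfolding runs_in_def by (auto intro: runs_While_False exI[of _ 1])
next
  case (Suc n)
  have "runs_in x (While b c) (S (Suc 0)) (n * (B + 2) + 1) (S (Suc n))"
    using Suc.IH[of "\<lambda>i. S (Suc i)"] Suc.prems by auto
  then obtain t' where "t' \<le> n * (B + 2) + 1" "runs x (While b c) (S (Suc 0)) t' (S (Suc n))"
    unfolding runs_in_def by auto
  moreover obtain t where "t \<le> B" "runs x c (S 0) t (S (Suc 0))" "holds x b (S 0)"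
    using Suc.prems(1)[of 0] unfolding runs_in_def by auto
  ultimately have "runs x (While b c) (S 0) (t + t' + 2) (S (Suc n))" "t + t' + 2 \<le> Suc n * (B + 2) + 1"
    using runs_While_True[of x b "S 0" c t "S (Suc 0)" t' "S (Suc n)"] by auto
  then show ?case unfolding runs_in_def by blast
qed

definition move_counter :: "nat \<Rightarrow> nat \<Rightarrow> com" where
  "move_counter r a = While (Pos r) (Do (Dec r) ;; Do (Inc a))"

lemma runs_in_move_counter:
  assumes "r \<noteq> a"
  shows "runs_in x (move_counter r a) (R, h, out) (R r * 4 + 1) (R(r := 0, a := R a + R r), h, out)"
proof -
  define S where "S i = (R(r := R r - i, a := R a + i), h, out)" for i
  have "runs_in x (While (Pos r) (Do (Dec r) ;; Do (Inc a))) (S 0) (R r * (1 + 1 + 2) + 1) (S (R r))"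
    by (intro runs_in_While conjI runs_in_Do_Seq runs_in_Do) (use assms in \<open>auto simp: S_def fun_eq_iff\<close>)
  then show ?thesis unfolding move_counter_def by (rule runs_in_conv) (auto simp: S_def)
qed

definition clear_counter :: "nat \<Rightarrow> com" where
  "clear_counter r = While (Pos r) (Do (Dec r))"

lemma runs_in_clear_counter:
  "runs_in x (clear_counter r) (R, h, out) (R r * 3 + 1) (R(r := 0), h, out)"
proof -
  define S where "S i = (R(r := R r - i), h, out)" for i
  have "runs_in x (While (Pos r) (Do (Dec r))) (S 0) (R r * (1 + 2) + 1) (S (R r))"
    by (intro runs_in_While conjI runs_in_Do_Seq runs_in_Do) (auto simp: S_def fun_eq_iff)
  then show ?thesis unfolding clear_counter_def by (rule runs_in_conv) (auto simp: S_def)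
qed

text \<open>Reading a counter destroys it. Hence a second copy is made in \<open>b\<close> and moved
  back.\<close>

definition add_counter :: "nat \<Rightarrow> nat \<Rightarrow> nat \<Rightarrow> com" where
  "add_counter r a b = While (Pos r) (Do (Dec r) ;; Do (Inc a) ;; Do (Inc b)) ;; move_counter b r"

lemma runs_in_add_counter:
  assumes "r \<noteq> a" "r \<noteq> b" "a \<noteq> b" "R b = 0"
  shows "runs_in x (add_counter r a b) (R, h, out) (R r * 9 + 2) (R(a := R a + R r), h, out)"
proof -
  define S where "S i = (R(r := R r - i, a := R a + i, b := i), h, out)" for i
  have "runs_in x (While (Pos r) (Do (Dec r) ;; Do (Inc a) ;; Do (Inc b))) (S 0) (R r * (1 + (1 + 1) + 2) + 1) (S (R r))"
    by (intro runs_in_While conjI runs_in_Do_Seq runs_in_Do) (use assms in \<open>auto simp: S_def fun_eq_iff\<close>)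
  moreover have "runs_in x (move_counter b r) (S (R r)) (R r * 4 + 1) (R(a := R a + R r), h, out)"
    using runs_in_move_counter[of b r x "R(r := 0, a := R a + R r, b := R r)" h out] assms
    by (simp add: S_def fun_upd_twist fun_upd_idem)
  moreover have "S 0 = (R, h, out)" using assms by (auto simp: S_def fun_eq_iff)
  ultimately have "runs_in x (add_counter r a b) (R, h, out)
      (R r * (1 + (1 + 1) + 2) + 1 + (R r * 4 + 1)) (R(a := R a + R r), h, out)"
    unfolding add_counter_def by (metis runs_in_Seq)
  then show ?thesis by (rule runs_in_mono) simp
qed

text \<open>Truncated \<open>Sub\<close> yields comparisons and negation, and \<open>Sum\<close>
  yields products, bounded quantifiers and division. Iteration is possible only over a range already
  bounded by a value, which keeps all values polynomial.\<close>

datatype nexp = Var nat | One | Len | Bit nexp | Add nexp nexp | Sub nexp nexp | Sum nexp nexp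

text \<open>De Bruijn indices: the summation variable is variable 0 of the summand.\<close>

fun eval :: "nexp \<Rightarrow> bool list \<Rightarrow> (nat \<Rightarrow> nat) \<Rightarrow> nat" where
  "eval (Var i) x v = v i"
| "eval One x v = 1"
| "eval Len x v = length x"
| "eval (Bit e) x v = of_bool (eval e x v < length x \<and> x ! eval e x v)"
| "eval (Add e f) x v = eval e x v + eval f x v"
| "eval (Sub e f) x v = eval e x v - eval f x v"
| "eval (Sum e f) x v = (\<Sum>i<eval e x v. eval f x (case_nat i v))"

text \<open>
  Adds the value of the expression to counter \<open>a\<close>. The variables are in the counters \<open>\<rho>\<close>, which
  are all below \<open>a\<close>; the counters above \<open>a\<close> are scratch space, zero before and after.
\<close>

fun code :: "nexp \<Rightarrow> nat list \<Rightarrow> nat \<Rightarrow> com" where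
  "code (Var i) \<rho> a = (if i < length \<rho> then add_counter (\<rho> ! i) a (a + 1) else clear_counter (a + 1))"
| "code One \<rho> a = Do (Inc a)"
| "code Len \<rho> a = While NonBlank (Do InRight ;; Do (Inc a)) ;; Do InLeft ;; While NonBlank (Do InLeft) ;; Do InRight"
| "code (Bit e) \<rho> a = code e \<rho> (a + 1) ;;
    While (Pos (a + 1)) (Do (Dec (a + 1)) ;; Do (Inc (a + 2)) ;; Do InRight) ;;
    If IsTwo (Do (Inc a)) ;; While (Pos (a + 2)) (Do (Dec (a + 2)) ;; Do InLeft)"
| "code (Add e f) \<rho> a = code e \<rho> a ;; code f \<rho> a"
| "code (Sub e f) \<rho> a = code e \<rho> (a + 1) ;; code f \<rho> (a + 2) ;;
    While (Pos (a + 2)) (Do (Dec (a + 2)) ;; Do (Dec (a + 1))) ;; move_counter (a + 1) a"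
| "code (Sum e f) \<rho> a = code e \<rho> (a + 1) ;;
    While (Pos (a + 1)) (Do (Dec (a + 1)) ;; code f ((a + 2) # \<rho>) (a + 3) ;;
      move_counter (a + 3) a ;; Do (Inc (a + 2))) ;;
    clear_counter (a + 2)"

definition env :: "nat list \<Rightarrow> (nat \<Rightarrow> nat) \<Rightarrow> nat \<Rightarrow> nat" where
  "env \<rho> R i = (if i < length \<rho> then R (\<rho> ! i) else 0)"

definition scratch :: "nat list \<Rightarrow> nat \<Rightarrow> (nat \<Rightarrow> nat) \<Rightarrow> bool" where
  "scratch \<rho> a R \<longleftrightarrow> (\<forall>r\<in>set \<rho>. r < a) \<and> (\<forall>r>a. R r = 0)"

definition bounded :: "bool list \<Rightarrow> (nat \<Rightarrow> nat) \<Rightarrow> nat \<Rightarrow> bool" where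
  "bounded x v N \<longleftrightarrow> length x \<le> N \<and> (\<forall>i. v i \<le> N)"

lemma env_upd: "scratch \<rho> a R \<Longrightarrow> a \<le> b \<Longrightarrow> env \<rho> (R'(b := n)) = env \<rho> R'"
  by (auto simp: env_def scratch_def fun_eq_iff) (metis nth_mem leD)

lemma env_Cons: "env (r # \<rho>) R = case_nat (R r) (env \<rho> R)"
  by (auto simp: env_def fun_eq_iff split: nat.split)

lemma scratch_lt: "scratch \<rho> a R \<Longrightarrow> i < length \<rho> \<Longrightarrow> \<rho> ! i < a"
  by (auto simp: scratch_def)

lemma poly_nat_mono: "m \<le> n \<Longrightarrow> poly p m \<le> poly p (n::nat)"
  by (induction p) (auto intro: add_mono mult_mono)

lemma runs_in_scan_right:
  assumes "r \<noteq> s"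
  shows "runs_in x (While (Pos r) (Do (Dec r) ;; Do (Inc s) ;; Do InRight)) (R, h, out)
    (R r * 5 + 1) (R(r := 0, s := R s + R r), h + int (R r), out)"
proof -
  define S where "S i = (R(r := R r - i, s := R s + i), h + int i, out)" for i
  have "runs_in x (While (Pos r) (Do (Dec r) ;; Do (Inc s) ;; Do InRight)) (S 0) (R r * (1 + (1 + 1) + 2) + 1) (S (R r))"
    by (intro runs_in_While conjI runs_in_Do_Seq runs_in_Do) (use assms in \<open>auto simp: S_def fun_eq_iff\<close>)
  then show ?thesis by (rule runs_in_conv) (auto simp: S_def)
qed

lemma runs_in_scan_left:
  "runs_in x (While (Pos r) (Do (Dec r) ;; Do InLeft)) (R, h, out)
    (R r * 4 + 1) (R(r := 0), h - int (R r), out)"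
proof -
  define S where "S i = (R(r := R r - i), h - int i, out)" for i
  have "runs_in x (While (Pos r) (Do (Dec r) ;; Do InLeft)) (S 0) (R r * (1 + 1 + 2) + 1) (S (R r))"
    by (intro runs_in_While conjI runs_in_Do_Seq runs_in_Do) (auto simp: S_def fun_eq_iff)
  then show ?thesis by (rule runs_in_conv) (auto simp: S_def)
qed

lemma runs_in_subtract:
  assumes "r \<noteq> s"
  shows "runs_in x (While (Pos r) (Do (Dec r) ;; Do (Dec s))) (R, h, out)
    (R r * 4 + 1) (R(r := 0, s := R s - R r), h, out)"
proof -
  define S where "S i = (R(r := R r - i, s := R s - i), h, out)" for i
  have "runs_in x (While (Pos r) (Do (Dec r) ;; Do (Dec s))) (S 0) (R r * (1 + 1 + 2) + 1) (S (R r))"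
    by (intro runs_in_While conjI runs_in_Do_Seq runs_in_Do) (use assms in \<open>auto simp: S_def fun_eq_iff\<close>)
  then show ?thesis by (rule runs_in_conv) (auto simp: S_def)
qed

lemma runs_in_Len:
  "runs_in x (code Len \<rho> a) (R, 0, out) (length x * 7 + 4) (R(a := R a + length x), 0, out)"
proof -
  let ?n = "length x"
  define S where "S i = (R(a := R a + i), int i, out)" for i
  have "runs_in x (While NonBlank (Do InRight ;; Do (Inc a))) (S 0) (?n * (1 + 1 + 2) + 1) (S ?n)"
    by (intro runs_in_While conjI runs_in_Do_Seq runs_in_Do) (auto simp: S_def string_contents_def fun_eq_iff)
  \<comment> \<open>One step to the left leads from the first blank to the last bit. The scan ends
    on the blank cell -1, and a final step to the right returns to cell 0. This is also correct for
    the empty input.\<close>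
  moreover define S' where "S' i = (R(a := R a + ?n), int ?n - 1 - int i, out)" for i
  have "runs_in x (While NonBlank (Do InLeft)) (S' 0) (?n * (1 + 2) + 1) (S' ?n)"
    by (intro runs_in_While conjI runs_in_Do_Seq runs_in_Do) (auto simp: S'_def string_contents_def fun_eq_iff)
  moreover have "runs_in x (Do InLeft) (S ?n) 1 (S' 0)" "runs_in x (Do InRight) (S' ?n) 1 (R(a := R a + ?n), 0, out)"
    by (rule runs_in_Do, simp add: S_def S'_def)+
  ultimately have "runs_in x (code Len \<rho> a) (S 0) ((?n * (1 + 1 + 2) + 1) + (1 + (?n * (1 + 2) + 1 + 1)))
      (R(a := R a + length x), 0, out)"
    unfolding code.simps by - (erule runs_in_Seq | assumption)+
  then show ?thesis by (rule runs_in_conv) (auto simp: S_def)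
qed

lemma scratch_mono: "scratch \<rho> a R \<Longrightarrow> a \<le> b \<Longrightarrow> scratch \<rho> b R"
  by (auto simp: scratch_def)

lemma scratch_upd: "scratch \<rho> a R \<Longrightarrow> scratch \<rho> a (R(a := n))"
  by (auto simp: scratch_def)

lemma scratch_zero: "scratch \<rho> a R \<Longrightarrow> a < b \<Longrightarrow> R b = 0"
  by (auto simp: scratch_def)

text \<open>\<open>N\<close> bounds the input length and all variables together. A polynomial in the
  input length alone could not be used under a summation, whose index may exceed that
  length.\<close>

definition code_ok :: "nat poly \<Rightarrow> nexp \<Rightarrow> bool" where
  "code_ok p e \<longleftrightarrow> (\<forall>x \<rho> a R out N. scratch \<rho> a R \<longrightarrow> bounded x (env \<rho> R) N \<longrightarrow>
    eval e x (env \<rho> R) \<le> poly p N \<and>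
    runs_in x (code e \<rho> a) (R, 0, out) (poly p N) (R(a := R a + eval e x (env \<rho> R)), 0, out))"

lemma code_okD:
  assumes "code_ok p e" "scratch \<rho> a R" "bounded x (env \<rho> R) N"
  shows "eval e x (env \<rho> R) \<le> poly p N"
    "runs_in x (code e \<rho> a) (R, 0, out) (poly p N) (R(a := R a + eval e x (env \<rho> R)), 0, out)"
  using assms unfolding code_ok_def by blast+

lemma code_ok_Bit:
  assumes "code_ok p e"
  shows "code_ok ([:10:] * p + [:5:]) (Bit e)"
  unfolding code_ok_def
proof (intro allI impI conjI)
  fix x \<rho> a R N and out :: "bool list"
  assume sc: "scratch \<rho> a R" and bd: "bounded x (env \<rho> R) N"
  define n where "n = eval e x (env \<rho> R)"
  define b where "b = eval (Bit e) x (env \<rho> R)"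
  have z: "R (Suc a) = 0" "R (Suc (Suc a)) = 0" using sc by (auto simp: scratch_zero)
  show "eval (Bit e) x (env \<rho> R) \<le> poly ([:10:] * p + [:5:]) N" by auto
  note IH = code_okD[OF assms scratch_mono[OF sc, of "a + 1"] bd]
  have "runs_in x (code e \<rho> (a + 1)) (R, 0, out) (poly p N) (R(a + 1 := n), 0, out)"
    using IH(2)[of out] z by (simp add: n_def)
  moreover have "runs_in x (While (Pos (a + 1)) (Do (Dec (a + 1)) ;; Do (Inc (a + 2)) ;; Do InRight)) (R(a + 1 := n), 0, out)
      (n * 5 + 1) (R(a + 2 := n), int n, out)"
    using z by (intro runs_in_conv[OF runs_in_scan_right[where R = "R(a + 1 := n)"]]) auto
  \<comment> \<open>The head has moved to cell \<open>n\<close>. Beyond the input it reads a blank,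
    which agrees with the value 0 of \<open>Bit\<close> there.\<close>
  moreover have "runs_in x (If IsTwo (Do (Inc a))) (R(a + 2 := n), int n, out) (Suc 1)
      (R(a + 2 := n, a := R a + b), int n, out)"
    by (rule runs_in_If) (auto simp: b_def n_def string_contents_def split: if_splits intro!: runs_in_conv[OF runs_in_Do[OF refl]])
  moreover have "runs_in x (While (Pos (a + 2)) (Do (Dec (a + 2)) ;; Do InLeft)) (R(a + 2 := n, a := R a + b), int n, out)
      (n * 4 + 1) (R(a := R a + b), 0, out)"
    using z by (intro runs_in_conv[OF runs_in_scan_left[where R = "R(a + 2 := n, a := R a + b)"]]) (auto simp: fun_eq_iff)
  ultimately have "runs_in x (code (Bit e) \<rho> a) (R, 0, out) (poly p N + (n * 5 + 1 + (Suc 1 + (n * 4 + 1))))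
      (R(a := R a + b), 0, out)"
    unfolding code.simps by - (erule runs_in_Seq | assumption)+
  then show "runs_in x (code (Bit e) \<rho> a) (R, 0, out) (poly ([:10:] * p + [:5:]) N)
      (R(a := R a + eval (Bit e) x (env \<rho> R)), 0, out)"
    using IH(1) by (elim runs_in_conv) (auto simp: b_def n_def)
qed

lemma code_ok_Add:
  assumes "code_ok p e" "code_ok q f"
  shows "code_ok (p + q) (Add e f)"
  unfolding code_ok_def
proof (intro allI impI conjI)
  fix x \<rho> a R N and out :: "bool list"
  assume sc: "scratch \<rho> a R" and bd: "bounded x (env \<rho> R) N"
  note IH1 = code_okD[OF assms(1) sc bd]
  define R' where "R' = R(a := R a + eval e x (env \<rho> R))"
  have e: "env \<rho> R' = env \<rho> R" using sc by (simp add: R'_def env_upd)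
  have "scratch \<rho> a R'" "bounded x (env \<rho> R') N" using sc bd e by (auto simp: R'_def scratch_upd)
  note IH2 = code_okD[OF assms(2) this, unfolded e]
  show "eval (Add e f) x (env \<rho> R) \<le> poly (p + q) N"
    using IH1(1) IH2(1) by simp
  show "runs_in x (code (Add e f) \<rho> a) (R, 0, out) (poly (p + q) N)
      (R(a := R a + eval (Add e f) x (env \<rho> R)), 0, out)"
    using runs_in_Seq[OF IH1(2)[folded R'_def] IH2(2)] by (simp add: R'_def add.assoc)
qed

lemma code_ok_Sub:
  assumes "code_ok p e" "code_ok q f"
  shows "code_ok ([:5:] * p + [:5:] * q + [:2:]) (Sub e f)"
  unfolding code_ok_def
proof (intro allI impI conjI)
  fix x \<rho> a R N and out :: "bool list"
  assume sc: "scratch \<rho> a R" and bd: "bounded x (env \<rho> R) N"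
  define m where "m = eval e x (env \<rho> R)"
  define n where "n = eval f x (env \<rho> R)"
  have z: "R (Suc a) = 0" "R (Suc (Suc a)) = 0" using sc by (auto simp: scratch_zero)
  note IH1 = code_okD[OF assms(1) scratch_mono[OF sc, of "a + 1"] bd]
  have e: "env \<rho> (R(a + 1 := m)) = env \<rho> R" using sc by (simp add: env_upd)
  have "scratch \<rho> (a + 2) (R(a + 1 := m))" "bounded x (env \<rho> (R(a + 1 := m))) N"
    using sc bd e by (auto simp: scratch_def)
  note IH2 = code_okD[OF assms(2) this, unfolded e]
  show "eval (Sub e f) x (env \<rho> R) \<le> poly ([:5:] * p + [:5:] * q + [:2:]) N"
    using IH1(1) by simp
  have "runs_in x (code e \<rho> (a + 1)) (R, 0, out) (poly p N) (R(a + 1 := m), 0, out)"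
    using IH1(2)[of out] z by (simp add: m_def)
  moreover have "runs_in x (code f \<rho> (a + 2)) (R(a + 1 := m), 0, out) (poly q N) (R(a + 1 := m, a + 2 := n), 0, out)"
    using IH2(2)[of out] z by (simp add: n_def)
  moreover have "runs_in x (While (Pos (a + 2)) (Do (Dec (a + 2)) ;; Do (Dec (a + 1)))) (R(a + 1 := m, a + 2 := n), 0, out)
      (n * 4 + 1) (R(a + 1 := m - n), 0, out)"
    using z by (intro runs_in_conv[OF runs_in_subtract[where R = "R(a + 1 := m, a + 2 := n)"]]) (auto simp: fun_eq_iff)
  moreover have "runs_in x (move_counter (a + 1) a) (R(a + 1 := m - n), 0, out)
      ((m - n) * 4 + 1) (R(a := R a + (m - n)), 0, out)"
    using z by (intro runs_in_conv[OF runs_in_move_counter[where R = "R(a + 1 := m - n)"]]) (auto simp: fun_eq_iff)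
  ultimately have "runs_in x (code (Sub e f) \<rho> a) (R, 0, out) (poly p N + (poly q N + (n * 4 + 1 + ((m - n) * 4 + 1))))
      (R(a := R a + (m - n)), 0, out)"
    unfolding code.simps by - (erule runs_in_Seq | assumption)+
  then show "runs_in x (code (Sub e f) \<rho> a) (R, 0, out) (poly ([:5:] * p + [:5:] * q + [:2:]) N)
      (R(a := R a + eval (Sub e f) x (env \<rho> R)), 0, out)"
    using IH1(1) IH2(1) by (elim runs_in_conv) (auto simp: m_def n_def)
qed

text \<open>Within the summand the index is below the value of \<open>e\<close>, so all variables
  are bounded by p(N) + N. This is the argument at which \<open>q'\<close> evaluates
  \<open>q\<close>.\<close>

lemma code_ok_Sum:
  assumes "code_ok p e" "code_ok q f"
  defines "q' \<equiv> q \<circ>\<^sub>p (p + [:0, 1:])"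
  shows "code_ok (p + p * ([:5:] * q' + [:8:]) + [:2:]) (Sum e f)" (is "code_ok ?P _")
  unfolding code_ok_def
proof (intro allI impI conjI)
  fix x \<rho> a R N and out :: "bool list"
  assume sc: "scratch \<rho> a R" and bd: "bounded x (env \<rho> R) N"
  define n where "n = eval e x (env \<rho> R)"
  define g where "g i = eval f x (case_nat i (env \<rho> R))" for i
  have z: "R (a + 1) = 0" "R (a + 2) = 0" "R (a + 3) = 0" using sc by (auto simp: scratch_zero)
  note IH1 = code_okD[OF assms(1) scratch_mono[OF sc, of "a + 1"] bd]
  have n: "n \<le> poly p N" using IH1(1) by (simp add: n_def)
  \<comment> \<open>Before round \<open>i\<close>, counter \<open>a\<close> holds the partial sum,
    \<open>a + 1\<close> the number of rounds left and \<open>a + 2\<close> the summation index. The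
    summand is computed in \<open>a + 3\<close> and then moved to \<open>a\<close>.\<close>
  define S where "S i = (R(a := R a + (\<Sum>j<i. g j), a + 1 := n - i, a + 2 := i), 0 :: int, out)" for i
  have g: "g i \<le> poly q' N"
    and run: "runs_in x (code f ((a + 2) # \<rho>) (a + 3)) (R(a := k, a + 1 := l, a + 2 := i), 0, out) (poly q' N)
      (R(a := k, a + 1 := l, a + 2 := i, a + 3 := g i), 0, out)" if "i < n" for i k l
  proof -
    let ?R = "R(a := k, a + 1 := l, a + 2 := i)"
    have e: "env \<rho> ?R = env \<rho> R" using sc by (simp add: env_upd)
    then have e': "env ((a + 2) # \<rho>) ?R = case_nat i (env \<rho> R)" by (simp add: env_Cons)
    have "bounded x (env ((a + 2) # \<rho>) ?R) (poly (p + [:0, 1:]) N)"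
      using bd that n unfolding e' bounded_def by (auto split: nat.split intro: trans_le_add2)
    moreover have "scratch ((a + 2) # \<rho>) (a + 3) ?R" using sc by (auto simp: scratch_def)
    ultimately have "eval f x (env ((a + 2) # \<rho>) ?R) \<le> poly q (poly (p + [:0, 1:]) N)"
      "runs_in x (code f ((a + 2) # \<rho>) (a + 3)) (?R, 0, out) (poly q (poly (p + [:0, 1:]) N))
        (?R(a + 3 := ?R (a + 3) + eval f x (env ((a + 2) # \<rho>) ?R)), 0, out)"
      using code_okD[OF assms(2)] by blast+
    then show "g i \<le> poly q' N" "runs_in x (code f ((a + 2) # \<rho>) (a + 3)) (?R, 0, out) (poly q' N)
      (?R(a + 3 := g i), 0, out)"
      unfolding e' using z by (simp_all add: g_def q'_def poly_pcompose)
  qed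
  have "runs_in x (Do (Dec (a + 1)) ;; code f ((a + 2) # \<rho>) (a + 3) ;; move_counter (a + 3) a ;; Do (Inc (a + 2)))
      (S i) (5 * poly q' N + 3) (S (Suc i))" if "i < n" for i
  proof -
    let ?k = "R a + (\<Sum>j<i. g j)"
    have e1: "exec (Dec (a + 1)) (S i) = (R(a := ?k, a + 1 := n - Suc i, a + 2 := i), 0, out)"
      by (auto simp: S_def fun_eq_iff)
    have mv: "runs_in x (move_counter (a + 3) a) (R(a := ?k, a + 1 := n - Suc i, a + 2 := i, a + 3 := g i), 0, out)
        (g i * 4 + 1) (R(a := ?k + g i, a + 1 := n - Suc i, a + 2 := i), 0, out)"
      using z by (intro runs_in_conv[OF runs_in_move_counter[where R = "R(a := ?k, a + 1 := n - Suc i, a + 2 := i, a + 3 := g i)"]]) (auto simp: fun_eq_iff)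
    have e2: "exec (Inc (a + 2)) (R(a := ?k + g i, a + 1 := n - Suc i, a + 2 := i), 0, out) = S (Suc i)"
      by (auto simp: S_def fun_eq_iff)
    have "runs_in x (Do (Dec (a + 1)) ;; code f ((a + 2) # \<rho>) (a + 3) ;; move_counter (a + 3) a ;; Do (Inc (a + 2)))
      (S i) (1 + (poly q' N + (g i * 4 + 1 + 1))) (S (Suc i))"
      by (rule runs_in_Do_Seq) (unfold e1, intro runs_in_Seq[OF run[OF that]] runs_in_Seq[OF mv] runs_in_Do[OF e2])
    then show ?thesis using g[OF that] by (elim runs_in_conv) auto
  qed
  moreover have "holds x (Pos (a + 1)) (S i) \<longleftrightarrow> i < n" for i by (simp add: S_def)
  ultimately have loop: "runs_in x (While (Pos (a + 1)) (Do (Dec (a + 1)) ;; code f ((a + 2) # \<rho>) (a + 3) ;;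
      move_counter (a + 3) a ;; Do (Inc (a + 2)))) (S 0) (n * (5 * poly q' N + 3 + 2) + 1) (S n)"
    by (intro runs_in_While) auto
  have first: "runs_in x (code e \<rho> (a + 1)) (R, 0, out) (poly p N) (S 0)"
    using z by (intro runs_in_conv[OF IH1(2)]) (auto simp: S_def n_def fun_eq_iff)
  have last: "runs_in x (clear_counter (a + 2)) (S n) (n * 3 + 1) (R(a := R a + (\<Sum>j<n. g j)), 0, out)"
    unfolding S_def using z
    by (intro runs_in_conv[OF runs_in_clear_counter[where R = "R(a := R a + (\<Sum>j<n. g j), a + 1 := n - n, a + 2 := n)"]]) (auto simp: fun_eq_iff)
  have "runs_in x (code (Sum e f) \<rho> a) (R, 0, out) (poly p N + (n * (5 * poly q' N + 3 + 2) + 1 + (n * 3 + 1)))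
      (R(a := R a + (\<Sum>j<n. g j)), 0, out)"
    unfolding code.simps by (intro runs_in_Seq[OF first] runs_in_Seq[OF loop] last)
  moreover have "n * (5 * poly q' N + 8) \<le> poly p N * (5 * poly q' N + 8)" using n by (rule mult_right_mono) simp
  then have "poly p N + (n * (5 * poly q' N + 3 + 2) + 1 + (n * 3 + 1)) \<le> poly ?P N"
    by (simp add: algebra_simps)
  ultimately show "runs_in x (code (Sum e f) \<rho> a) (R, 0, out) (poly ?P N)
      (R(a := R a + eval (Sum e f) x (env \<rho> R)), 0, out)"
    by (elim runs_in_conv) (auto simp: g_def n_def)
  have "(\<Sum>j<n. g j) \<le> n * poly q' N" using sum_bounded_above[of "{..<n}" g "poly q' N"] g by simp
  also have "\<dots> \<le> poly p N * poly q' N" using n by (rule mult_right_mono) simp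
  also have "\<dots> \<le> poly ?P N" by (simp add: algebra_simps)
  finally show "eval (Sum e f) x (env \<rho> R) \<le> poly ?P N" by (simp add: n_def g_def)
qed

lemma code_ok: "\<exists>p. code_ok p e"
proof (induction e)
  case (Var i)
  have "code_ok [:2, 9:] (Var i)"
    unfolding code_ok_def
  proof (intro allI impI conjI)
    fix x \<rho> a R N and out :: "bool list"
    assume sc: "scratch \<rho> a R" and bd: "bounded x (env \<rho> R) N"
    have le: "env \<rho> R i \<le> N" using bd by (simp add: bounded_def)
    then show "eval (Var i) x (env \<rho> R) \<le> poly [:2, 9:] N" by simp
    have z: "R (a + 1) = 0" using sc by (auto simp: scratch_zero)
    show "runs_in x (code (Var i) \<rho> a) (R, 0, out) (poly [:2, 9:] N) (R(a := R a + eval (Var i) x (env \<rho> R)), 0, out)"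
    proof (cases "i < length \<rho>")
      case True
      then have "\<rho> ! i < a" using sc by (simp add: scratch_lt)
      then have "runs_in x (add_counter (\<rho> ! i) a (a + 1)) (R, 0, out) (R (\<rho> ! i) * 9 + 2) (R(a := R a + R (\<rho> ! i)), 0, out)"
        using z by (intro runs_in_add_counter) auto
      then have "runs_in x (code (Var i) \<rho> a) (R, 0, out) (R (\<rho> ! i) * 9 + 2) (R(a := R a + R (\<rho> ! i)), 0, out)"
        using True by simp
      then show ?thesis using True le by (elim runs_in_conv) (auto simp: env_def)
    next
      case False
      \<comment> \<open>A variable outside the list has value 0, so nothing is to be added; clearing
        a counter that is already 0 serves as the empty command.\<close>
      have "runs_in x (clear_counter (a + 1)) (R, 0, out) 1 (R, 0, out)"
        using z by (intro runs_in_conv[OF runs_in_clear_counter[where R = R]]) (auto simp: fun_eq_iff)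
      then have "runs_in x (code (Var i) \<rho> a) (R, 0, out) 1 (R, 0, out)"
        using False by simp
      then show ?thesis using False by (elim runs_in_conv) (auto simp: env_def)
    qed
  qed
  then show ?case ..
next
  case One
  have "code_ok [:1:] One"
    by (auto simp: code_ok_def intro!: runs_in_Do[simplified])
  then show ?case ..
next
  case Len
  have "code_ok [:4, 7:] Len"
    unfolding code_ok_def bounded_def
    by (auto simp del: code.simps intro!: runs_in_conv[OF runs_in_Len])
  then show ?case ..
qed (blast intro: code_ok_Bit code_ok_Add code_ok_Sub code_ok_Sum)+

section \<open>Expressions that print bit strings\<close>

datatype sexp = Out bool | Cat sexp sexp | Cond nexp sexp | Loop nexp sexp

fun printed :: "sexp \<Rightarrow> bool list \<Rightarrow> (nat \<Rightarrow> nat) \<Rightarrow> bool list" where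
  "printed (Out b) x v = [b]"
| "printed (Cat s t) x v = printed s x v @ printed t x v"
| "printed (Cond e s) x v = (if eval e x v > 0 then printed s x v else [])"
| "printed (Loop e s) x v = concat (map (\<lambda>i. printed s x (case_nat i v)) [0..<eval e x v])"

fun scode :: "sexp \<Rightarrow> nat list \<Rightarrow> nat \<Rightarrow> com" where
  "scode (Out b) \<rho> a = Do (Emit b)"
| "scode (Cat s t) \<rho> a = scode s \<rho> a ;; scode t \<rho> a"
| "scode (Cond e s) \<rho> a = code e \<rho> a ;; If (Pos a) (clear_counter a ;; scode s \<rho> a)"
| "scode (Loop e s) \<rho> a = code e \<rho> a ;;
    While (Pos a) (Do (Dec a) ;; scode s ((a + 1) # \<rho>) (a + 2) ;; Do (Inc (a + 1))) ;;
    clear_counter (a + 1)"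

text \<open>In contrast to \<open>code\<close>, printing restores all counters. Counter
  \<open>a\<close> must be 0 at the start because it temporarily holds the condition or the number
  of rounds.\<close>

definition scode_ok :: "nat poly \<Rightarrow> sexp \<Rightarrow> bool" where
  "scode_ok p s \<longleftrightarrow> (\<forall>x \<rho> a R out N. scratch \<rho> a R \<longrightarrow> R a = 0 \<longrightarrow> bounded x (env \<rho> R) N \<longrightarrow>
    runs_in x (scode s \<rho> a) (R, 0, out) (poly p N) (R, 0, out @ printed s x (env \<rho> R)))"

lemma scode_okD:
  assumes "scode_ok p s" "scratch \<rho> a R" "R a = 0" "bounded x (env \<rho> R) N"
  shows "runs_in x (scode s \<rho> a) (R, 0, out) (poly p N) (R, 0, out @ printed s x (env \<rho> R))"
  using assms unfolding scode_ok_def by blast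

lemma scode_ok_Cond:
  assumes "code_ok p e" "scode_ok q s"
  shows "scode_ok ([:4:] * p + q + [:2:]) (Cond e s)"
  unfolding scode_ok_def
proof (intro allI impI conjI)
  fix x \<rho> a R N and out :: "bool list"
  assume sc: "scratch \<rho> a R" and z: "R a = 0" and bd: "bounded x (env \<rho> R) N"
  define n where "n = eval e x (env \<rho> R)"
  note e = code_okD[OF assms(1) sc bd] and s = scode_okD[OF assms(2) sc z bd]
  have "runs_in x (code e \<rho> a) (R, 0, out) (poly p N) (R(a := n), 0, out)"
    using e(2)[of out] z by (simp add: n_def)
  moreover have "runs_in x (clear_counter a) (R(a := n), 0, out) (n * 3 + 1) (R, 0, out)"
    using z by (intro runs_in_conv[OF runs_in_clear_counter[where R = "R(a := n)"]]) auto
  then have "runs_in x (clear_counter a ;; scode s \<rho> a) (R(a := n), 0, out) (n * 3 + 1 + poly q N)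
      (R, 0, out @ printed s x (env \<rho> R))"
    using s by (rule runs_in_Seq)
  then have "runs_in x (If (Pos a) (clear_counter a ;; scode s \<rho> a)) (R(a := n), 0, out) (Suc (n * 3 + 1 + poly q N))
      (R, 0, out @ printed (Cond e s) x (env \<rho> R))"
    using z by (intro runs_in_If) (auto simp: n_def)
  ultimately have "runs_in x (scode (Cond e s) \<rho> a) (R, 0, out) (poly p N + Suc (n * 3 + 1 + poly q N))
      (R, 0, out @ printed (Cond e s) x (env \<rho> R))"
    unfolding scode.simps by (rule runs_in_Seq)
  then show "runs_in x (scode (Cond e s) \<rho> a) (R, 0, out) (poly ([:4:] * p + q + [:2:]) N)
      (R, 0, out @ printed (Cond e s) x (env \<rho> R))"
    by (rule runs_in_mono) (use e(1) in \<open>simp add: n_def\<close>)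
qed

lemma scode_ok_Loop:
  assumes "code_ok p e" "scode_ok q s"
  defines "q' \<equiv> q \<circ>\<^sub>p (p + [:0, 1:])"
  shows "scode_ok (p + p * (q' + [:7:]) + [:2:]) (Loop e s)" (is "scode_ok ?P _")
  unfolding scode_ok_def
proof (intro allI impI conjI)
  fix x \<rho> a R N and out :: "bool list"
  assume sc: "scratch \<rho> a R" and z: "R a = 0" and bd: "bounded x (env \<rho> R) N"
  define n where "n = eval e x (env \<rho> R)"
  define g where "g i = printed s x (case_nat i (env \<rho> R))" for i
  have z': "R (a + 1) = 0" "R (a + 2) = 0" using sc by (auto simp: scratch_zero)
  note e = code_okD[OF assms(1) sc bd]
  have n: "n \<le> poly p N" using e(1) by (simp add: n_def)
  define S where "S i = (R(a := n - i, a + 1 := i), 0 :: int, out @ concat (map g [0..<i]))" for i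
  have run: "runs_in x (scode s ((a + 1) # \<rho>) (a + 2)) (R(a := k, a + 1 := i), 0, out') (poly q' N)
      (R(a := k, a + 1 := i), 0, out' @ g i)" if "i < n" for i k out'
  proof -
    let ?R = "R(a := k, a + 1 := i)"
    have "env \<rho> ?R = env \<rho> R" using sc by (simp add: env_upd)
    then have e': "env ((a + 1) # \<rho>) ?R = case_nat i (env \<rho> R)" by (simp add: env_Cons)
    have "bounded x (env ((a + 1) # \<rho>) ?R) (poly (p + [:0, 1:]) N)"
      using bd that n unfolding e' bounded_def by (auto split: nat.split intro: trans_le_add2)
    moreover have "scratch ((a + 1) # \<rho>) (a + 2) ?R" "?R (a + 2) = 0" using sc z' by (auto simp: scratch_def)
    ultimately have "runs_in x (scode s ((a + 1) # \<rho>) (a + 2)) (?R, 0, out') (poly q (poly (p + [:0, 1:]) N))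
        (?R, 0, out' @ printed s x (env ((a + 1) # \<rho>) ?R))"
      using scode_okD[OF assms(2)] by blast
    then show ?thesis
      unfolding e' by (simp add: g_def q'_def poly_pcompose)
  qed
  have "runs_in x (Do (Dec a) ;; scode s ((a + 1) # \<rho>) (a + 2) ;; Do (Inc (a + 1)))
      (S i) (1 + (poly q' N + 1)) (S (Suc i))" if "i < n" for i
  proof -
    let ?out = "out @ concat (map g [0..<i])"
    have e1: "exec (Dec a) (S i) = (R(a := n - Suc i, a + 1 := i), 0, ?out)"
      by (auto simp: S_def fun_eq_iff)
    have e2: "exec (Inc (a + 1)) (R(a := n - Suc i, a + 1 := i), 0, ?out @ g i) = S (Suc i)"
      by (auto simp: S_def fun_eq_iff)
    show ?thesis
      by (rule runs_in_Do_Seq) (unfold e1, intro runs_in_Seq[OF run[OF that]] runs_in_Do[OF e2])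
  qed
  moreover have "holds x (Pos a) (S i) \<longleftrightarrow> i < n" for i by (simp add: S_def)
  ultimately have loop: "runs_in x (While (Pos a) (Do (Dec a) ;; scode s ((a + 1) # \<rho>) (a + 2) ;; Do (Inc (a + 1))))
      (S 0) (n * (1 + (poly q' N + 1) + 2) + 1) (S n)"
    by (intro runs_in_While) auto
  have first: "runs_in x (code e \<rho> a) (R, 0, out) (poly p N) (S 0)"
    using z z' by (intro runs_in_conv[OF e(2)]) (auto simp: S_def n_def fun_eq_iff)
  have last: "runs_in x (clear_counter (a + 1)) (S n) (n * 3 + 1) (R, 0, out @ concat (map g [0..<n]))"
    unfolding S_def using z z'
    by (intro runs_in_conv[OF runs_in_clear_counter[where R = "R(a := n - n, a + 1 := n)"]]) (auto simp: fun_eq_iff)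
  have "runs_in x (scode (Loop e s) \<rho> a) (R, 0, out) (poly p N + (n * (1 + (poly q' N + 1) + 2) + 1 + (n * 3 + 1)))
      (R, 0, out @ concat (map g [0..<n]))"
    unfolding scode.simps by (intro runs_in_Seq[OF first] runs_in_Seq[OF loop] last)
  moreover have "n * (poly q' N + 7) \<le> poly p N * (poly q' N + 7)" using n by (rule mult_right_mono) simp
  then have "poly p N + (n * (1 + (poly q' N + 1) + 2) + 1 + (n * 3 + 1)) \<le> poly ?P N"
    by (simp add: algebra_simps)
  ultimately show "runs_in x (scode (Loop e s) \<rho> a) (R, 0, out) (poly ?P N)
      (R, 0, out @ printed (Loop e s) x (env \<rho> R))"
    by (elim runs_in_conv) (auto simp: g_def[abs_def] n_def)
qed

lemma scode_ok: "\<exists>p. scode_ok p s"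
proof (induction s)
  case (Out b)
  have "scode_ok [:1:] (Out b)"
    by (auto simp: scode_ok_def intro!: runs_in_Do[simplified])
  then show ?case ..
next
  case (Cat s t)
  then obtain p q where "scode_ok p s" "scode_ok q t" by blast
  then have "scode_ok (p + q) (Cat s t)"
    unfolding scode_ok_def scode.simps printed.simps poly_add append_assoc[symmetric]
    by (blast intro: runs_in_Seq)
  then show ?case ..
next
  case (Cond e s)
  then show ?case using code_ok scode_ok_Cond by blast
next
  case (Loop e s)
  then show ?case using code_ok scode_ok_Loop by blast
qed

theorem polytime_fun_printed: "polytime_fun (\<lambda>x. printed s x (\<lambda>_. 0))"
proof -
  obtain p where p: "scode_ok p s" using scode_ok by blast
  have e: "env [] R = (\<lambda>_. 0)" for R by (auto simp: env_def)
  have "runs_in x (scode s [] 0) (\<lambda>_. 0, 0, []) (poly p (length x)) (\<lambda>_. 0, 0, [] @ printed s x (env [] (\<lambda>_. 0)))" for x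
    by (rule scode_okD[OF p]) (auto simp: scratch_def bounded_def e)
  then show ?thesis
    unfolding runs_in_def e append_Nil
    by (intro polytime_fun_if_runs[where p = p and c = "scode s [] 0"]) blast
qed

section \<open>Closure properties\<close>

text \<open>Definability as a property of HOL functions. Polynomial time is then derived by
  introduction rules that follow the shape of the defining term, and the expression for the
  reduction is never written out.\<close>

definition nexp_fun :: "(bool list \<Rightarrow> (nat \<Rightarrow> nat) \<Rightarrow> nat) \<Rightarrow> bool" where
  "nexp_fun F \<longleftrightarrow> (\<exists>e. \<forall>x v. F x v = eval e x v)"

definition nexp_pred :: "(bool list \<Rightarrow> (nat \<Rightarrow> nat) \<Rightarrow> bool) \<Rightarrow> bool" where
  "nexp_pred P \<longleftrightarrow> nexp_fun (\<lambda>x v. of_bool (P x v))"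

definition sexp_fun :: "(bool list \<Rightarrow> (nat \<Rightarrow> nat) \<Rightarrow> bool list) \<Rightarrow> bool" where
  "sexp_fun F \<longleftrightarrow> (\<exists>s. \<forall>x v. F x v = printed s x v)"

fun lift :: "nat \<Rightarrow> nexp \<Rightarrow> nexp" where
  "lift c (Var i) = Var (if i < c then i else Suc i)"
| "lift c One = One"
| "lift c Len = Len"
| "lift c (Bit e) = Bit (lift c e)"
| "lift c (Add e f) = Add (lift c e) (lift c f)"
| "lift c (Sub e f) = Sub (lift c e) (lift c f)"
| "lift c (Sum e f) = Sum (lift c e) (lift (Suc c) f)"

lemma eval_lift: "eval (lift c e) x v = eval e x (\<lambda>i. if i < c then v i else v (Suc i))"
proof (induction e arbitrary: c v)
  case (Sum e f)
  have "(\<lambda>j. if j < Suc c then case_nat i v j else case_nat i v (Suc j)) =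
      case_nat i (\<lambda>j. if j < c then v j else v (Suc j))" for i
    by (auto simp: fun_eq_iff split: nat.split)
  then show ?case using Sum by simp
qed auto

lemma nexp_fun_weaken: "nexp_fun F \<Longrightarrow> nexp_fun (\<lambda>x v. F x (\<lambda>i. v (Suc i)))"
proof -
  assume "nexp_fun F"
  then obtain e where "\<forall>x v. F x v = eval e x v" by (auto simp: nexp_fun_def)
  then have "\<forall>x v. F x (\<lambda>i. v (Suc i)) = eval (lift 0 e) x v" by (simp add: eval_lift)
  then show ?thesis unfolding nexp_fun_def by blast
qed

lemma nexp_fun_var: "nexp_fun (\<lambda>x v. v i)"
  unfolding nexp_fun_def by (metis eval.simps(1))

lemma nexp_fun_length: "nexp_fun (\<lambda>x v. length x)"
  unfolding nexp_fun_def by (metis eval.simps(3))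

lemma nexp_fun_add: "nexp_fun F \<Longrightarrow> nexp_fun G \<Longrightarrow> nexp_fun (\<lambda>x v. F x v + G x v)"
  unfolding nexp_fun_def by (metis eval.simps(5))

lemma nexp_fun_diff: "nexp_fun F \<Longrightarrow> nexp_fun G \<Longrightarrow> nexp_fun (\<lambda>x v. F x v - G x v)"
  unfolding nexp_fun_def by (metis eval.simps(6))

lemma nexp_pred_bit: "nexp_fun F \<Longrightarrow> nexp_pred (\<lambda>x v. F x v < length x \<and> x ! F x v)"
  unfolding nexp_pred_def nexp_fun_def by (metis eval.simps(4))

lemma nexp_fun_const: "nexp_fun (\<lambda>x v. c)"
proof (induction c)
  case 0
  have "eval (Sub One One) x v = 0" for x v by simp
  then show ?case unfolding nexp_fun_def by metis
next
  case (Suc c)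
  have "eval One x v = 1" for x v by simp
  then have "nexp_fun (\<lambda>x v. 1)" unfolding nexp_fun_def by metis
  from nexp_fun_add[OF this Suc] show ?case by simp
qed

lemma nexp_fun_Suc: "nexp_fun F \<Longrightarrow> nexp_fun (\<lambda>x v. Suc (F x v))"
  using nexp_fun_add[OF _ nexp_fun_const[of 1]] by simp

text \<open>The premise splits the environment of the summand into the index \<open>v 0\<close> and
  the shifted rest, so that resolution can match any summand \<open>B x v i\<close>. Functions of
  the outer variables appear shifted in it, which is the situation that
  \<open>nexp_fun_weaken\<close> handles.\<close>

lemma nexp_fun_sum:
  assumes "nexp_fun A" "nexp_fun (\<lambda>x v. B x (\<lambda>i. v (Suc i)) (v 0))"
  shows "nexp_fun (\<lambda>x v. \<Sum>i<A x v. B x v i)"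
proof -
  obtain e f where "\<forall>x v. A x v = eval e x v" "\<forall>x v. B x (\<lambda>i. v (Suc i)) (v 0) = eval f x v"
    using assms unfolding nexp_fun_def by blast
  moreover from this(2) have "B x v i = eval f x (case_nat i v)" for x v i
    by (metis (no_types, lifting) nat.case(1,2) ext)
  ultimately have "\<forall>x v. (\<Sum>i<A x v. B x v i) = eval (Sum e f) x v" by simp
  then show ?thesis unfolding nexp_fun_def by blast
qed

lemma nexp_fun_mult: "nexp_fun F \<Longrightarrow> nexp_fun G \<Longrightarrow> nexp_fun (\<lambda>x v. F x v * G x v)"
  using nexp_fun_sum[of F "\<lambda>x v i. G x v"] nexp_fun_weaken[of G] by simp

lemma nexp_pred_not: "nexp_pred P \<Longrightarrow> nexp_pred (\<lambda>x v. \<not> P x v)"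
proof -
  assume "nexp_pred P"
  then have "nexp_fun (\<lambda>x v. 1 - of_bool (P x v))"
    unfolding nexp_pred_def by (intro nexp_fun_diff nexp_fun_const)
  moreover have "1 - of_bool b = (of_bool (\<not> b) :: nat)" for b by simp
  ultimately show ?thesis unfolding nexp_pred_def by (simp only:)
qed

lemma nexp_pred_conj: "nexp_pred P \<Longrightarrow> nexp_pred Q \<Longrightarrow> nexp_pred (\<lambda>x v. P x v \<and> Q x v)"
  unfolding nexp_pred_def of_bool_conj by (rule nexp_fun_mult)

lemma nexp_pred_disj: "nexp_pred P \<Longrightarrow> nexp_pred Q \<Longrightarrow> nexp_pred (\<lambda>x v. P x v \<or> Q x v)"
  using nexp_pred_not[OF nexp_pred_conj[OF nexp_pred_not[of P] nexp_pred_not[of Q]]] by simp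

lemma nexp_pred_imp: "nexp_pred P \<Longrightarrow> nexp_pred Q \<Longrightarrow> nexp_pred (\<lambda>x v. P x v \<longrightarrow> Q x v)"
  unfolding imp_conv_disj by (intro nexp_pred_disj nexp_pred_not)

lemma nexp_pred_le: "nexp_fun F \<Longrightarrow> nexp_fun G \<Longrightarrow> nexp_pred (\<lambda>x v. F x v \<le> G x v)"
proof -
  assume *: "nexp_fun F" "nexp_fun G"
  have "nexp_fun (\<lambda>x v. 1 - (F x v - G x v))" by (intro nexp_fun_diff nexp_fun_const *)
  moreover have "(1::nat) - (F x v - G x v) = of_bool (F x v \<le> G x v)" for x v by auto
  ultimately show ?thesis by (simp add: nexp_pred_def)
qed

lemma nexp_pred_less: "nexp_fun F \<Longrightarrow> nexp_fun G \<Longrightarrow> nexp_pred (\<lambda>x v. F x v < G x v)"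
  using nexp_pred_le[OF nexp_fun_Suc[of F], of G] by (simp add: Suc_le_eq)

lemma nexp_pred_eq: "nexp_fun F \<Longrightarrow> nexp_fun G \<Longrightarrow> nexp_pred (\<lambda>x v. F x v = G x v)"
proof -
  assume "nexp_fun F" "nexp_fun G"
  then have "nexp_pred (\<lambda>x v. F x v \<le> G x v \<and> G x v \<le> F x v)"
    by (intro nexp_pred_conj nexp_pred_le)
  then show ?thesis by (simp only: eq_iff)
qed

lemma nexp_pred_const: "nexp_pred (\<lambda>x v. b)"
  unfolding nexp_pred_def by (rule nexp_fun_const)

lemma nexp_fun_if:
  assumes "nexp_pred P" "nexp_fun F" "nexp_fun G"
  shows "nexp_fun (\<lambda>x v. if P x v then F x v else G x v)"
proof -
  have "nexp_fun (\<lambda>x v. of_bool (P x v) * F x v + of_bool (\<not> P x v) * G x v)"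
    using assms nexp_pred_not[OF assms(1)] unfolding nexp_pred_def by (intro nexp_fun_add nexp_fun_mult)
  moreover have "of_bool (P x v) * F x v + of_bool (\<not> P x v) * G x v = (if P x v then F x v else G x v)" for x v
    by simp
  ultimately show ?thesis by (simp only:)
qed

lemma nexp_fun_of_bool: "nexp_pred P \<Longrightarrow> nexp_fun (\<lambda>x v. of_bool (P x v))"
  unfolding nexp_pred_def .

lemma nexp_pred_ex:
  assumes "nexp_fun A" "nexp_pred (\<lambda>x v. B x (\<lambda>i. v (Suc i)) (v 0))"
  shows "nexp_pred (\<lambda>x v. \<exists>i<A x v. B x v i)"
proof -
  have "nexp_pred (\<lambda>x v. 0 < (\<Sum>i<A x v. of_bool (B x v i) :: nat))"
    by (intro nexp_pred_less nexp_fun_const nexp_fun_sum assms(1) nexp_fun_of_bool[OF assms(2)])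
  moreover have "0 < (\<Sum>i<n. of_bool (P i) :: nat) \<longleftrightarrow> (\<exists>i<n. P i)" for n :: nat and P
    by (induction n) (auto simp: less_Suc_eq)
  ultimately show ?thesis by (simp only:)
qed

lemma nexp_pred_all:
  assumes "nexp_fun A" "nexp_pred (\<lambda>x v. B x (\<lambda>i. v (Suc i)) (v 0))"
  shows "nexp_pred (\<lambda>x v. \<forall>i<A x v. B x v i)"
  using nexp_pred_not[OF nexp_pred_ex[OF assms(1) nexp_pred_not[OF assms(2)]]] by simp

lemma nexp_fun_div:
  assumes "nexp_fun F" "nexp_fun G"
  shows "nexp_fun (\<lambda>x v. F x v div G x v)"
proof -
  \<comment> \<open>The quotient is the number of positive multiples of \<open>n\<close> up to
    \<open>m\<close>. The condition \<open>0 < n\<close> reproduces the value 0 of division by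
    zero.\<close>
  have *: "m div n = (\<Sum>q<m. of_bool (0 < n \<and> Suc q * n \<le> m))" for m n :: nat
  proof (cases "n = 0")
    case False
    then have "Suc q * n \<le> m \<longleftrightarrow> q < m div n" for q
      using less_eq_div_iff_mult_less_eq[of n "Suc q" m] by (simp only: Suc_le_eq)
    then have "{..<m} \<inter> {q. 0 < n \<and> Suc q * n \<le> m} = {..<m} \<inter> {..<m div n}"
      using False by (auto simp del: mult_Suc)
    moreover have "{..<m} \<inter> {..<m div n} = {..<m div n}" by (auto intro: less_le_trans[OF _ div_le_dividend])
    ultimately show ?thesis by (simp del: mult_Suc add: sum_of_bool_eq)
  qed auto
  have "nexp_fun (\<lambda>x v. \<Sum>q<F x v. of_bool (0 < G x v \<and> Suc q * G x v \<le> F x v))"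
    by (intro nexp_fun_sum assms nexp_fun_of_bool nexp_pred_conj nexp_pred_less nexp_pred_le nexp_fun_const nexp_fun_mult nexp_fun_Suc nexp_fun_var
        nexp_fun_weaken[OF assms(1)] nexp_fun_weaken[OF assms(2)])
  then show ?thesis by (simp only: *)
qed

lemma nexp_fun_mod: "nexp_fun F \<Longrightarrow> nexp_fun G \<Longrightarrow> nexp_fun (\<lambda>x v. F x v mod G x v)"
  unfolding modulo_nat_def by (intro nexp_fun_diff nexp_fun_mult nexp_fun_div)

lemma nexp_fun_poly: "nexp_fun F \<Longrightarrow> nexp_fun (\<lambda>x v. poly p (F x v))"
  by (induction p) (auto intro: nexp_fun_const nexp_fun_add nexp_fun_mult)

text \<open>A function that is constant from some point on is a finite nest of case distinctions.
  This is how the transition table of a fixed machine enters an expression.\<close>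

lemma nexp_fun_table:
  assumes "nexp_fun F" "\<And>n. n \<ge> K \<Longrightarrow> f n = d"
  shows "nexp_fun (\<lambda>x v. f (F x v))"
  using assms(2)
proof (induction K arbitrary: f)
  case 0
  then show ?case by (simp add: nexp_fun_const)
next
  case (Suc K)
  define g where "g = f(K := d)"
  have "nexp_fun (\<lambda>x v. if F x v = K then f K else g (F x v))"
    using Suc.prems by (intro nexp_fun_if nexp_pred_eq assms(1) nexp_fun_const Suc.IH) (auto simp: g_def)
  moreover have "(if n = K then f K else g n) = f n" for n by (simp add: g_def)
  ultimately show ?case by simp
qed

lemma nexp_fun_table2:
  assumes "nexp_fun F" "nexp_fun G" "\<And>m n. m \<ge> K \<or> n \<ge> L \<Longrightarrow> f m n = d"
  shows "nexp_fun (\<lambda>x v. f (F x v) (G x v))"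
  using assms(3)
proof (induction K arbitrary: f)
  case 0
  then show ?case by (simp add: nexp_fun_const)
next
  case (Suc K)
  define g where "g = f(K := \<lambda>_. d)"
  have "nexp_fun (\<lambda>x v. if F x v = K then f K (G x v) else g (F x v) (G x v))"
    using Suc.prems
    by (intro nexp_fun_if nexp_pred_eq assms(1) nexp_fun_const Suc.IH nexp_fun_table[OF assms(2), of L _ d]) (auto simp: g_def)
  moreover have "(if m = K then f K n else g m n) = f m n" for m n by (simp add: g_def)
  ultimately show ?case by simp
qed

lemma sexp_fun_append: "sexp_fun F \<Longrightarrow> sexp_fun G \<Longrightarrow> sexp_fun (\<lambda>x v. F x v @ G x v)"
  unfolding sexp_fun_def by (metis printed.simps(2))

lemma sexp_fun_empty: "sexp_fun (\<lambda>x v. [])"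
proof -
  have "[] = printed (Cond (Sub One One) (Out True)) x v" for x v by simp
  then show ?thesis unfolding sexp_fun_def by blast
qed

lemma sexp_fun_if:
  assumes "nexp_pred P" "sexp_fun F" "sexp_fun G"
  shows "sexp_fun (\<lambda>x v. if P x v then F x v else G x v)"
proof -
  have only: "sexp_fun (\<lambda>x v. if P x v then F x v else [])" if P: "nexp_pred P" and F: "sexp_fun F" for P F
  proof -
    obtain e where e: "\<forall>x v. of_bool (P x v) = eval e x v"
      using P unfolding nexp_pred_def nexp_fun_def by blast
    moreover obtain s where "\<forall>x v. F x v = printed s x v"
      using F unfolding sexp_fun_def by blast
    ultimately have "(if P x v then F x v else []) = printed (Cond e s) x v" for x v
      by (simp flip: e)
    then show ?thesis unfolding sexp_fun_def by blast
  qed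
  have "sexp_fun (\<lambda>x v. (if P x v then F x v else []) @ (if \<not> P x v then G x v else []))"
    using assms by (intro sexp_fun_append only nexp_pred_not)
  moreover have "(if P x v then F x v else []) @ (if \<not> P x v then G x v else []) =
      (if P x v then F x v else G x v)" for x v by simp
  ultimately show ?thesis by (simp only:)
qed

lemma sexp_fun_bit:
  assumes "nexp_pred P"
  shows "sexp_fun (\<lambda>x v. [P x v])"
proof -
  have "sexp_fun (\<lambda>x v. [b])" for b unfolding sexp_fun_def by (metis printed.simps(1))
  then have "sexp_fun (\<lambda>x v. if P x v then [True] else [False])"
    by (intro sexp_fun_if assms)
  moreover have "(if P x v then [True] else [False]) = [P x v]" for x v by simp
  ultimately show ?thesis by (simp only:)
qed

lemma sexp_fun_concat:
  assumes "nexp_fun A" "sexp_fun (\<lambda>x v. B x (\<lambda>i. v (Suc i)) (v 0))"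
  shows "sexp_fun (\<lambda>x v. concat (map (B x v) [0..<A x v]))"
proof -
  obtain e s where "\<forall>x v. A x v = eval e x v" "\<forall>x v. B x (\<lambda>i. v (Suc i)) (v 0) = printed s x v"
    using assms unfolding nexp_fun_def sexp_fun_def by blast
  moreover from this(2) have "B x v = (\<lambda>i. printed s x (case_nat i v))" for x v
    by (metis (no_types, lifting) nat.case(1,2) ext)
  ultimately have "\<forall>x v. concat (map (B x v) [0..<A x v]) = printed (Loop e s) x v"
    by simp
  then show ?thesis unfolding sexp_fun_def by blast
qed

lemma polytime_fun_if_sexp_fun: "sexp_fun (\<lambda>x v. f x) \<Longrightarrow> polytime_fun f"
  using polytime_fun_printed unfolding sexp_fun_def by (metis ext)

section \<open>Decompositions in the correlation cone\<close>

definition in_cone :: "nat \<Rightarrow> (nat \<Rightarrow> nat \<Rightarrow> real) \<Rightarrow> bool" where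
  "in_cone n G \<longleftrightarrow> mat n n (\<lambda>(i, j). G i j) \<in> correlation_cone n"

lemma in_cone_iff:
  "in_cone n G \<longleftrightarrow> (\<exists>p :: nat \<Rightarrow> real. (\<forall>k\<le>2 ^ n - 1. p k \<ge> 0) \<and>
    (\<forall>i<n. \<forall>j<n. G i j = (\<Sum>k\<le>2 ^ n - 1. p k * of_bool (bit k (n - 1 - i) \<and> bit k (n - 1 - j)))))"
proof -
  have entry: "corr_mat n k $$ (i, j) = of_bool (bit k (n - 1 - i) \<and> bit k (n - 1 - j))"
    if "i < n" "j < n" for i j k
    using that by (simp add: corr_mat_def binary_vec_def of_bool_conj)
  have "mat n n (\<lambda>(i, j). G i j) = mat n n (\<lambda>(i, j). \<Sum>k\<le>2 ^ n - 1. p k * corr_mat n k $$ (i, j)) \<longleftrightarrow>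
      (\<forall>i<n. \<forall>j<n. G i j = (\<Sum>k\<le>2 ^ n - 1. p k * of_bool (bit k (n - 1 - i) \<and> bit k (n - 1 - j))))"
    for p :: "nat \<Rightarrow> real"
    by (auto simp: mat_eq_iff entry)
  then show ?thesis unfolding in_cone_def correlation_cone_def by auto
qed

lemma in_cone_add:
  assumes "in_cone n G" "in_cone n H"
  shows "in_cone n (\<lambda>i j. G i j + H i j)"
proof -
  obtain p q :: "nat \<Rightarrow> real" where "\<forall>k\<le>2 ^ n - 1. p k \<ge> 0" "\<forall>k\<le>2 ^ n - 1. q k \<ge> 0"
    "\<forall>i<n. \<forall>j<n. G i j = (\<Sum>k\<le>2 ^ n - 1. p k * of_bool (bit k (n - 1 - i) \<and> bit k (n - 1 - j)))"
    "\<forall>i<n. \<forall>j<n. H i j = (\<Sum>k\<le>2 ^ n - 1. q k * of_bool (bit k (n - 1 - i) \<and> bit k (n - 1 - j)))"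
    using assms unfolding in_cone_iff by blast
  then show ?thesis
    unfolding in_cone_iff by (intro exI[of _ "\<lambda>k. p k + q k"]) (simp add: distrib_right sum.distrib)
qed

lemma in_cone_rank_one:
  assumes "w \<ge> 0"
  shows "in_cone n (\<lambda>i j. w * of_bool (X i \<and> X j))"
proof -
  \<comment> \<open>The number with binary digits \<open>X\<close>, most significant first. As
    \<open>horner_sum\<close> takes the least significant digit first, the order is
    reversed.\<close>
  define k where "k = take_bit n (horner_sum of_bool 2 (map (\<lambda>i. X (n - 1 - i)) [0..<n]) :: nat)"
  have "k < 2 ^ n" by (simp add: k_def)
  then have k: "k \<le> 2 ^ n - 1" by simp
  have "bit k (n - 1 - i) = X i" if "i < n" for i
    using that by (simp add: k_def bit_take_bit_iff bit_horner_sum_bit_iff)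
  then show ?thesis
    unfolding in_cone_iff using assms k
    by (intro exI[of _ "\<lambda>l. if l = k then w else 0"]) (simp add: if_distrib[of "\<lambda>c. c * _"] cong: if_cong)
qed

lemma in_cone_sum:
  assumes "finite I" "\<And>k. k \<in> I \<Longrightarrow> in_cone n (G k)"
  shows "in_cone n (\<lambda>i j. \<Sum>k\<in>I. G k i j)"
  using assms
proof (induction I rule: finite_induct)
  case empty
  then show ?case using in_cone_rank_one[of 0 n] by simp
next
  case (insert k I)
  then show ?case using in_cone_add[of n "G k" "\<lambda>i j. \<Sum>k\<in>I. G k i j"] by simp
qed

lemma in_cone_scale:
  assumes "in_cone n G" "c \<ge> 0"
  shows "in_cone n (\<lambda>i j. c * G i j)"
proof -
  obtain p :: "nat \<Rightarrow> real" where "\<forall>k\<le>2 ^ n - 1. p k \<ge> 0"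
    "\<forall>i<n. \<forall>j<n. G i j = (\<Sum>k\<le>2 ^ n - 1. p k * of_bool (bit k (n - 1 - i) \<and> bit k (n - 1 - j)))"
    using assms(1) unfolding in_cone_iff by blast
  then show ?thesis
    unfolding in_cone_iff using assms(2)
    by (intro exI[of _ "\<lambda>k. c * p k"]) (simp add: mult.assoc flip: sum_distrib_left)
qed

lemma in_cone_cong:
  "in_cone n G \<Longrightarrow> (\<And>i j. i < n \<Longrightarrow> j < n \<Longrightarrow> G i j = H i j) \<Longrightarrow> in_cone n H"
  unfolding in_cone_iff by simp

text \<open>The construction works with natural numbers. Division by the last entry makes the corner
  1, and membership in a cone is invariant under positive scaling.\<close>

definition scaled_mat :: "nat \<Rightarrow> (nat \<Rightarrow> nat \<Rightarrow> nat) \<Rightarrow> rat mat" where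
  "scaled_mat n U = mat n n (\<lambda>(i, j). of_nat (U i j) / of_nat (U (n - 1) (n - 1)))"

lemma in_correlation_cone_scaled_mat:
  assumes "U (n - 1) (n - 1) > 0"
  shows "in_correlation_cone (scaled_mat n U) \<longleftrightarrow> in_cone n (\<lambda>i j. real (U i j))"
proof -
  let ?N = "real (U (n - 1) (n - 1))"
  have "in_correlation_cone (scaled_mat n U) \<longleftrightarrow> in_cone n (\<lambda>i j. real (U i j) / ?N)"
  proof -
    have "map_mat of_rat (scaled_mat n U) = mat n n (\<lambda>(i, j). real (U i j) / ?N)"
      by (rule eq_matI) (auto simp: scaled_mat_def of_rat_divide)
    then show ?thesis by (simp add: in_correlation_cone_def in_cone_def scaled_mat_def)
  qed
  also have "\<dots> \<longleftrightarrow> in_cone n (\<lambda>i j. real (U i j))"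
    using in_cone_scale[of n "\<lambda>i j. real (U i j) / ?N" ?N] in_cone_scale[of n "\<lambda>i j. real (U i j)" "1 / ?N"] assms
    by auto
  finally show ?thesis .
qed

section \<open>Cliques with one node in each group\<close>

lemma sum_groups: "(\<Sum>v<m * g. f v) = (\<Sum>b<m. \<Sum>a<g. f (b * g + a :: nat))"
proof -
  have "sum f {b * g..<b * g + g} = (\<Sum>a<g. f (b * g + a))" for b
    using sum.shift_bounds_nat_ivl[of f 0 "b * g" g] by (simp add: add.commute lessThan_atLeast0)
  then show ?thesis by (simp flip: sum.nat_group)
qed

text \<open>
  Coordinates: the nodes \<open>b * g + a\<close> with \<open>b < m\<close>, \<open>a < g\<close>; then \<open>q\<^sub>b\<close> for \<open>b < m\<close>; then \<open>z\<close> and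
  \<open>z'\<close>; then \<open>p\<^sub>b\<close> for \<open>b < m\<close>; and the constant coordinate. The entries involving \<open>p\<^sub>b\<close> are
  derived from \<open>p\<^sub>b = 1 - q\<^sub>b - (\<Sum>a<g. v\<^sub>a)\<close>. Truncation of these differences only occurs if there
  is no full clique, and it can only increase the diagonal, which soundness tolerates.
\<close>

context
  fixes m g :: nat and C :: "nat \<Rightarrow> nat \<Rightarrow> bool"
begin

definition clq_deg :: "nat \<Rightarrow> nat" where
  "clq_deg v = (\<Sum>w<m * g. of_bool (C v w))"

text \<open>The total weight of the decomposition that belongs to a full clique: 2 for the clique,
  the sum of the degrees minus m (m - 1) for the pairs, 2 m (m - 1) + 2 m for the single nodes of
  the clique and 4 (m g - m) for the other single nodes.\<close>

definition clq_total :: nat where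
  "clq_total = 2 + (\<Sum>v<m * g. clq_deg v) + m * m + 4 * (m * g) - 3 * m"

definition clq_order :: nat where
  "clq_order = m * g + 2 * m + 3"

text \<open>Each node occurs with total weight 2 in vectors filled by q, and \<open>q_b\<close>
  collects the m g - g nodes outside its group. The diagonal entries of z and z' collect the m g - m
  nodes outside the clique, and the clique itself with weight 2.\<close>

definition clq_diag :: "nat \<Rightarrow> nat" where
  "clq_diag i =
    (if i < m * g then 2 * clq_deg i + 4
     else if i < m * g + m then 2 * (m * g - g)
     else if i < m * g + m + 2 then 2 + 2 * (m * g - m)
     else if i < m * g + m + 2 + m
       then clq_total - ((\<Sum>a<g. 2 * clq_deg ((i - (m * g + m + 2)) * g + a) + 4) + 2 * (m * g - g))
     else clq_total)"

text \<open>Meant for i < j, both before the p block. The entry (\<open>q_b\<close>,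
  \<open>q_d\<close>) counts the nodes outside both groups. The entry (\<open>q_b\<close>, z) counts
  the nodes outside both the clique and group b, of which there are (m g - m) - (g - 1). The 0 is
  the entry of \<open>q_b\<close> and z', and the last 2 that of z and z'.\<close>

definition clq_off :: "nat \<Rightarrow> nat \<Rightarrow> nat" where
  "clq_off i j =
    (if j < m * g then 2 * of_bool (C i j)
     else if j < m * g + m then if i < m * g then 2 * of_bool (i div g \<noteq> j - m * g) else 2 * (m * g - 2 * g)
     else if j = m * g + m then if i < m * g then 2 else 2 + 2 * (m * g - m) - 2 * g
     else if i < m * g then 2 else if i < m * g + m then 0 else 2)"

definition clq_core :: "nat \<Rightarrow> nat \<Rightarrow> nat" where
  "clq_core i j = (if i = j then clq_diag i else clq_off (min i j) (max i j))"

text \<open>The minuend is the entry of \<open>i\<close> with the constant coordinate; it equals the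
  diagonal entry because coordinates are 0 or 1.\<close>

definition clq_row :: "nat \<Rightarrow> nat \<Rightarrow> nat" where
  "clq_row b i = clq_diag i - ((\<Sum>a<g. clq_core i (b * g + a)) + clq_core i (m * g + b))"

definition clq_upper :: "nat \<Rightarrow> nat \<Rightarrow> nat" where
  "clq_upper i j =
    (if i = j \<or> j = m * g + m + 2 + m then clq_diag i
     else if j < m * g + m + 2 then clq_off i j
     else if i < m * g + m + 2 then clq_row (j - (m * g + m + 2)) i
     else clq_diag j - ((\<Sum>a<g. clq_row (j - (m * g + m + 2)) ((i - (m * g + m + 2)) * g + a)) +
       clq_row (j - (m * g + m + 2)) (m * g + (i - (m * g + m + 2)))))"

definition clq_entry :: "nat \<Rightarrow> nat \<Rightarrow> nat" where
  "clq_entry i j = clq_upper (min i j) (max i j)"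

text \<open>The arguments \<open>y\<close> and \<open>z\<close> are the values at the coordinates z
  and z', and \<open>q\<close> chooses the filler of the groups that contain no node of
  \<open>X\<close>.\<close>

definition clq_vec :: "bool \<Rightarrow> bool \<Rightarrow> bool \<Rightarrow> (nat \<Rightarrow> bool) \<Rightarrow> nat \<Rightarrow> bool" where
  "clq_vec y z q X i =
    (if i < m * g then X i
     else if i < m * g + m then q \<and> (\<forall>a<g. \<not> X ((i - m * g) * g + a))
     else if i = m * g + m then y
     else if i = m * g + m + 1 then z
     else if i < m * g + m + 2 + m then \<not> q \<and> (\<forall>a<g. \<not> X ((i - (m * g + m + 2)) * g + a))
     else True)"

lemma clq_vec_linear:
  assumes "b < m" "\<And>a a'. a < g \<Longrightarrow> a' < g \<Longrightarrow> X (b * g + a) \<Longrightarrow> X (b * g + a') \<Longrightarrow> a = a'"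
  shows "of_bool (clq_vec y z q X (m * g + m + 2 + b)) =
    (1 :: real) - (\<Sum>a<g. of_bool (clq_vec y z q X (b * g + a))) - of_bool (clq_vec y z q X (m * g + b))"
proof -
  have "b * g + a < m * g" if "a < g" for a
  proof -
    have "b * g + a < Suc b * g" using that by simp
    also have "\<dots> \<le> m * g" using assms(1) by (intro mult_le_mono1) simp
    finally show ?thesis .
  qed
  then have s: "(\<Sum>a<g. of_bool (clq_vec y z q X (b * g + a))) = (\<Sum>a<g. of_bool (X (b * g + a)) :: real)"
    by (intro sum.cong) (auto simp: clq_vec_def)
  show ?thesis
  proof (cases "\<exists>a<g. X (b * g + a)")
    case True
    then obtain a where a: "a < g" "X (b * g + a)" by blast
    then have "(\<Sum>a'<g. of_bool (X (b * g + a')) :: real) = (\<Sum>a'<g. if a' = a then 1 else 0)"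
      using assms(2) by (intro sum.cong) auto
    also have "\<dots> = 1" using a by simp
    finally show ?thesis using s True assms(1) by (auto simp: clq_vec_def)
  next
    case False
    then show ?thesis using s assms(1) by (auto simp: clq_vec_def)
  qed
qed

end

text \<open>The affine relation for \<open>p_b\<close>, multiplied by coordinate j. Linear
  combinations preserve it, so it only has to be checked for single vectors, and it then determines
  all entries of the p block.\<close>

definition balanced :: "nat \<Rightarrow> nat \<Rightarrow> (nat \<Rightarrow> nat \<Rightarrow> real) \<Rightarrow> bool" where
  "balanced m g H \<longleftrightarrow> (\<forall>b<m. \<forall>j. H (m * g + m + 2 + b) j =
    H (m * g + m + 2 + m) j - (\<Sum>a<g. H (b * g + a) j) - H (m * g + b) j)"

lemma balanced_add: "balanced m g G \<Longrightarrow> balanced m g H \<Longrightarrow> balanced m g (\<lambda>i j. G i j + H i j)"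
  by (simp add: balanced_def sum.distrib)

lemma balanced_scale: "balanced m g G \<Longrightarrow> balanced m g (\<lambda>i j. c * G i j)"
  by (simp add: balanced_def sum_distrib_left right_diff_distrib)

lemma balanced_zero: "balanced m g (\<lambda>i j. 0)"
  by (simp add: balanced_def)

lemma balanced_sum:
  assumes "\<And>k. k \<in> I \<Longrightarrow> balanced m g (G k)"
  shows "balanced m g (\<lambda>i j. \<Sum>k\<in>I. G k i j)"
  using assms
  by (induction I rule: infinite_finite_induct) (auto intro: balanced_add balanced_zero)

lemma balanced_clq_vec:
  assumes "\<And>b a a'. b < m \<Longrightarrow> a < g \<Longrightarrow> a' < g \<Longrightarrow> X (b * g + a) \<Longrightarrow> X (b * g + a') \<Longrightarrow> a = a'"
  shows "balanced m g (\<lambda>i j. of_bool (clq_vec m g y z q X i \<and> clq_vec m g y z q X j))"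
proof -
  have one: "clq_vec m g y z q X (m * g + m + 2 + m)" by (simp add: clq_vec_def)
  show ?thesis
    unfolding balanced_def
  proof (intro allI impI)
    fix b j assume "b < m"
    from clq_vec_linear[OF this, of g X y z q] assms this
    have "of_bool (clq_vec m g y z q X (m * g + m + 2 + b)) =
      (1 :: real) - (\<Sum>a<g. of_bool (clq_vec m g y z q X (b * g + a))) - of_bool (clq_vec m g y z q X (m * g + b))"
      by blast
    then show "of_bool (clq_vec m g y z q X (m * g + m + 2 + b) \<and> clq_vec m g y z q X j) =
      of_bool (clq_vec m g y z q X (m * g + m + 2 + m) \<and> clq_vec m g y z q X j) -
      (\<Sum>a<g. of_bool (clq_vec m g y z q X (b * g + a) \<and> clq_vec m g y z q X j)) -
      (of_bool (clq_vec m g y z q X (m * g + b) \<and> clq_vec m g y z q X j) :: real)"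
      using one by (cases "clq_vec m g y z q X j") auto
  qed
qed

section \<open>Completeness: the decomposition obtained from a full clique\<close>

locale full_clique =
  fixes m g :: nat and C :: "nat \<Rightarrow> nat \<Rightarrow> bool" and sel :: "nat \<Rightarrow> nat"
  assumes m: "m > 0"
    and C_sym: "C v w \<Longrightarrow> C w v"
    and groups: "C v w \<Longrightarrow> v div g \<noteq> w div g"
    and sel: "b < m \<Longrightarrow> sel b < g"
    and clique: "b < m \<Longrightarrow> c < m \<Longrightarrow> b \<noteq> c \<Longrightarrow> C (b * g + sel b) (c * g + sel c)"
begin

declare sum_of_bool_eq [simp del] sum_mult_of_bool_eq [simp del] sum_of_bool_mult_eq [simp del]

lemma g: "g > 0" using sel[OF m] by simp

definition s :: "nat \<Rightarrow> bool" where
  "s v \<longleftrightarrow> v < m * g \<and> v mod g = sel (v div g)"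

abbreviation \<sigma> :: "nat \<Rightarrow> real" where
  "\<sigma> v \<equiv> of_bool (s v)"

lemma node_less: "b < m \<Longrightarrow> a < g \<Longrightarrow> b * g + a < m * g"
proof -
  assume "b < m" "a < g"
  then have "b * g + a < Suc b * g" by simp
  also have "\<dots> \<le> m * g" using \<open>b < m\<close> by (intro mult_le_mono1) simp
  finally show ?thesis .
qed

lemma s_node: "b < m \<Longrightarrow> a < g \<Longrightarrow> s (b * g + a) \<longleftrightarrow> a = sel b"
  using node_less by (simp add: s_def)

lemma sum_\<sigma>: "(\<Sum>v<m * g. f v * \<sigma> v) = (\<Sum>b<m. f (b * g + sel b))"
proof -
  have "(\<Sum>a<g. f (b * g + a) * \<sigma> (b * g + a)) = f (b * g + sel b)" if "b < m" for b
  proof -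
    have "(\<Sum>a<g. f (b * g + a) * \<sigma> (b * g + a)) = (\<Sum>a<g. if a = sel b then f (b * g + sel b) else 0)"
      using that by (intro sum.cong) (auto simp: s_node)
    then show ?thesis using sel[OF that] by simp
  qed
  then show ?thesis by (simp add: sum_groups)
qed

lemma sum_group_indicator: "b < m \<Longrightarrow> (\<Sum>v<m * g. of_bool (v div g = b)) = real g"
proof -
  assume "b < m"
  have "(\<Sum>v<m * g. of_bool (v div g = b) :: real) = (\<Sum>b'<m. \<Sum>a<g. of_bool ((b' * g + a) div g = b))"
    by (rule sum_groups)
  also have "\<dots> = (\<Sum>b'<m. \<Sum>a<g. of_bool (b' = b))"
    by (intro sum.cong) auto
  also have "\<dots> = (\<Sum>b'<m. if b' = b then real g else 0)"
    by (intro sum.cong) auto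
  finally show ?thesis using \<open>b < m\<close> by simp
qed

definition c :: "nat \<Rightarrow> nat \<Rightarrow> real" where
  "c v w = of_bool (C v w) * (1 - \<sigma> v * \<sigma> w)"

abbreviation t :: "(nat \<Rightarrow> bool) \<Rightarrow> nat \<Rightarrow> nat \<Rightarrow> real" where
  "t x i j \<equiv> of_bool (x i \<and> x j)"

text \<open>The pairs inside the clique are left out because the clique vector supplies them. A
  clique node thereby loses 2 (m - 1) on the diagonal, which the first single-node term restores.
  The two terms filled by q add up to weight 2 for every node, in the clique or not. The terms with
  z = 1 and with z' = 1 supply for the other nodes the 2 that the clique vector gives to its
  own.\<close>

definition G :: "nat \<Rightarrow> nat \<Rightarrow> real" where
  "G i j = 2 * t (clq_vec m g True True False s) i j +
    (\<Sum>v<m * g. \<Sum>w<m * g. c v w * t (clq_vec m g False False False (\<lambda>u. u = v \<or> u = w)) i j) +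
    (\<Sum>v<m * g. 2 * (real m - 1) * \<sigma> v * t (clq_vec m g False False False (\<lambda>u. u = v)) i j +
      2 * \<sigma> v * t (clq_vec m g False False True (\<lambda>u. u = v)) i j +
      2 * (1 - \<sigma> v) * t (clq_vec m g True False True (\<lambda>u. u = v)) i j +
      2 * (1 - \<sigma> v) * t (clq_vec m g False True False (\<lambda>u. u = v)) i j)"

lemma c_nonneg: "c v w \<ge> 0" by (simp add: c_def)

lemma in_cone_G: "in_cone n G"
  unfolding G_def
  using m by (intro in_cone_add in_cone_sum in_cone_rank_one) (auto simp: c_nonneg)

lemma balanced_G: "balanced m g G"
proof -
  have pair: "balanced m g (\<lambda>i j. c v w * t (clq_vec m g False False False (\<lambda>u. u = v \<or> u = w)) i j)" for v w
  proof (cases "C v w")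
    case True
    have "b * g + a = v \<or> b * g + a = w \<Longrightarrow> b * g + a' = v \<or> b * g + a' = w \<Longrightarrow> a < g \<Longrightarrow> a' < g \<Longrightarrow> a = a'" for a a' b
      using groups[OF True] by (metis add_left_cancel div_mult_self3 div_less add.right_neutral less_nat_zero_code)
    then show ?thesis by (intro balanced_scale balanced_clq_vec) blast
  next
    case False
    then show ?thesis by (simp add: c_def balanced_zero)
  qed
  have full: "balanced m g (t (clq_vec m g True True False s))"
    by (intro balanced_clq_vec) (auto simp: s_node)
  have single: "balanced m g (t (clq_vec m g y z q (\<lambda>u. u = v)))" for y z q v
    by (intro balanced_clq_vec) auto
  show ?thesis
    unfolding G_def
    by (intro balanced_add balanced_sum pair full balanced_scale[OF full] balanced_scale[OF single])
qed

lemma vec_core: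
  "i < m * g \<Longrightarrow> clq_vec m g y z q X i = X i"
  "b < m \<Longrightarrow> clq_vec m g y z q X (m * g + b) \<longleftrightarrow> q \<and> (\<forall>a<g. \<not> X (b * g + a))"
  "clq_vec m g y z q X (m * g + m) = y"
  "clq_vec m g y z q X (m * g + m + 1) = z"
  "clq_vec m g y z q X (m * g + m + 2 + m)"
  by (simp_all add: clq_vec_def)

lemmas vec_simps = vec_core vec_core(4, 5)[simplified]

lemma not_in_group: "v < m * g \<Longrightarrow> (\<forall>a<g. b * g + a \<noteq> v) \<longleftrightarrow> v div g \<noteq> b"
proof -
  have "v = (v div g) * g + v mod g" "v mod g < g" using g by simp_all
  then have "\<not> (\<forall>a<g. (v div g) * g + a \<noteq> v)" by metis
  moreover have "(b * g + a) div g = b" if "a < g" for a using that by simp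
  ultimately show ?thesis by metis
qed

lemma c_sym: "c v w = c w v"
  using C_sym[of v w] C_sym[of w v] by (auto simp: c_def mult.commute)

lemma C_irrefl: "\<not> C v v"
  using groups by blast

lemma clique_nodes:
  assumes "s i" "s j" "i \<noteq> j"
  shows "C i j"
proof -
  have div: "i div g < m" "j div g < m" using assms g by (simp_all add: s_def div_less_iff_less_mult)
  have "i = (i div g) * g + sel (i div g)" "j = (j div g) * g + sel (j div g)"
    using assms by (simp_all add: s_def) (metis div_mult_mod_eq)+
  moreover from this assms(3) have "i div g \<noteq> j div g" by metis
  ultimately show ?thesis using clique[OF div] by metis
qed

lemma deg_s:
  assumes "s i"
  shows "(\<Sum>w<m * g. of_bool (C i w) * \<sigma> w) = real m - 1"
proof -
  have i: "i div g < m" using assms g by (simp add: s_def div_less_iff_less_mult)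
  have "C i (b * g + sel b) \<longleftrightarrow> b \<noteq> i div g" if "b < m" for b
  proof
    assume "C i (b * g + sel b)"
    then show "b \<noteq> i div g" using groups[of i "b * g + sel b"] sel[OF that] by auto
  next
    assume "b \<noteq> i div g"
    moreover have "s (b * g + sel b)" using that sel s_node by blast
    ultimately show "C i (b * g + sel b)"
      using assms sel[OF that] by (intro clique_nodes) auto
  qed
  then have "(\<Sum>b<m. of_bool (C i (b * g + sel b))) = (\<Sum>b<m. of_bool (b \<noteq> i div g) :: real)"
    by (intro sum.cong) auto
  also have "\<dots> = (\<Sum>b<m. 1 - (if b = i div g then 1 else 0))" by (intro sum.cong) auto
  also have "\<dots> = real m - 1" using i by (simp add: sum_subtractf)
  finally show ?thesis by (simp only: sum_\<sigma>)
qed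

lemma sum_c: "(\<Sum>w<m * g. c i w) = real (clq_deg m g C i) - \<sigma> i * (real m - 1)"
proof -
  have "(\<Sum>w<m * g. c i w) = (\<Sum>w<m * g. of_bool (C i w)) - \<sigma> i * (\<Sum>w<m * g. of_bool (C i w) * \<sigma> w)"
    unfolding c_def sum_distrib_left by (subst sum_subtractf[symmetric]) (auto intro!: sum.cong)
  moreover have "(\<Sum>w<m * g. of_bool (C i w)) = real (clq_deg m g C i)"
    by (simp add: clq_deg_def)
  ultimately show ?thesis using deg_s[of i] by (cases "s i") simp_all
qed

lemma G_node_node:
  assumes "i < m * g" "j < m * g"
  shows "G i j = (if i = j then 2 * real (clq_deg m g C i) + 4 else 2 * of_bool (C i j))"
proof -
  let ?P = "\<Sum>v<m * g. \<Sum>w<m * g. c v w * of_bool ((i = v \<or> i = w) \<and> (j = v \<or> j = w))"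
  let ?S = "\<Sum>v<m * g. (2 * (real m - 1) * \<sigma> v + 2 * \<sigma> v + 2 * (1 - \<sigma> v) + 2 * (1 - \<sigma> v)) * of_bool (i = v \<and> j = v)"
  have G: "G i j = 2 * (\<sigma> i * \<sigma> j) + ?P + ?S"
    using assms by (simp add: G_def vec_core of_bool_conj algebra_simps)
  show ?thesis
  proof (cases "i = j")
    case True
    \<comment> \<open>The ordered pairs with \<open>i\<close> in first or in second place. Both at
      once would require \<open>C i i\<close>, where \<open>c\<close> vanishes.\<close>
    have "?P = (\<Sum>v<m * g. \<Sum>w<m * g. (if v = i then c v w else 0) + (if w = i then c v w else 0))"
      using True by (intro sum.cong) (auto simp: c_def C_irrefl)
    also have "\<dots> = (\<Sum>w<m * g. c i w) + (\<Sum>v<m * g. c v i)"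
      using assms by (simp add: sum.distrib sum.swap[of "\<lambda>v w. if v = i then c v w else 0"])
    also have "\<dots> = 2 * (\<Sum>w<m * g. c i w)" using c_sym by simp
    finally have "?P = 2 * (real (clq_deg m g C i) - \<sigma> i * (real m - 1))" by (simp only: sum_c)
    moreover have "?S = (\<Sum>v<m * g. if v = i then 2 * (real m - 1) * \<sigma> i + 2 * \<sigma> i + 2 * (1 - \<sigma> i) + 2 * (1 - \<sigma> i) else 0)"
      using True by (intro sum.cong) auto
    then have "?S = 2 * (real m - 1) * \<sigma> i + 2 * \<sigma> i + 2 * (1 - \<sigma> i) + 2 * (1 - \<sigma> i)"
      using assms by simp
    ultimately show ?thesis using G True by (cases "s i") auto
  next
    case False
    have "?P = (\<Sum>v<m * g. \<Sum>w<m * g. (if w = j then if v = i then c i j else 0 else 0) + (if w = i then if v = j then c j i else 0 else 0))"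
      using False by (intro sum.cong) (auto simp: c_def C_irrefl)
    also have "\<dots> = c i j + c j i"
      using assms by (simp add: sum.distrib)
    finally have "?P = 2 * c i j" using c_sym by simp
    moreover have "?S = 0" using False by (intro sum.neutral) auto
    ultimately show ?thesis using G False clique_nodes[of i j] by (auto simp: c_def)
  qed
qed

lemma G_node_q: "i < m * g \<Longrightarrow> b < m \<Longrightarrow> G i (m * g + b) = 2 * of_bool (i div g \<noteq> b)"
proof -
  assume *: "i < m * g" "b < m"
  have "G i (m * g + b) = (\<Sum>v<m * g. if v = i then 2 * of_bool (i div g \<noteq> b) else 0)"
    using * by (simp add: G_def vec_simps not_in_group del: sum.delta sum.delta') (intro conjI impI sum.cong; auto)
  then show ?thesis using * by simp
qed

lemma G_node_z:
  assumes "i < m * g"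
  shows "G i (m * g + m) = 2" "G i (m * g + m + 1) = 2"
proof -
  have "G i (m * g + m) = 2 * \<sigma> i + (\<Sum>v<m * g. if v = i then 2 * (1 - \<sigma> i) else 0)"
    using assms by (simp add: G_def vec_simps del: sum.delta sum.delta') (intro conjI impI sum.cong; auto)
  then show "G i (m * g + m) = 2" using assms by simp
  have "G i (m * g + m + 1) = 2 * \<sigma> i + (\<Sum>v<m * g. if v = i then 2 * (1 - \<sigma> i) else 0)"
    using assms by (simp add: G_def vec_simps del: sum.delta sum.delta') (intro conjI impI sum.cong; auto)
  then show "G i (m * g + m + 1) = 2" using assms by simp
qed

lemma G_q_q:
  assumes "b < m" "d < m"
  shows "G (m * g + b) (m * g + d) = real (if b = d then 2 * (m * g - g) else 2 * (m * g - 2 * g))"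
proof -
  have "G (m * g + b) (m * g + d) = 2 * (\<Sum>v<m * g. of_bool (v div g \<noteq> b \<and> v div g \<noteq> d))"
    using assms by (simp add: G_def vec_simps not_in_group sum_distrib_left) (intro sum.cong, auto)
  also have "(\<Sum>v<m * g. of_bool (v div g \<noteq> b \<and> v div g \<noteq> d)) =
      (\<Sum>v<m * g. 1 - of_bool (v div g = b) - (if b = d then 0 else of_bool (v div g = d)) :: real)"
    by (intro sum.cong) auto
  also have "\<dots> = real (m * g) - real g - (if b = d then 0 else real g)"
    using assms by (simp add: sum_subtractf sum_group_indicator)
  finally have *: "G (m * g + b) (m * g + d) = 2 * (real (m * g) - real g - (if b = d then 0 else real g))" .
  \<comment> \<open>These bounds make the natural subtractions in the entry exact. Two different
    groups force m >= 2.\<close>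
  have "1 * g \<le> m * g" using m by (intro mult_le_mono1) simp
  moreover have "2 * g \<le> m * g" if "b \<noteq> d"
    using assms that by (intro mult_le_mono1) simp
  ultimately show ?thesis using * by (auto simp: of_nat_diff)
qed

lemma m_le: "m \<le> m * g" using g by simp

lemma sum_s: "(\<Sum>v<m * g. \<sigma> v) = real m"
  using sum_\<sigma>[of "\<lambda>_. 1"] by simp

lemma G_z:
  "G (m * g + m) (m * g + m) = real (2 + 2 * (m * g - m))"
  "G (m * g + m + 1) (m * g + m + 1) = real (2 + 2 * (m * g - m))"
  "G (m * g + m) (m * g + m + 1) = 2"
proof -
  have *: "(\<Sum>v<m * g. 2 - 2 * \<sigma> v) = 2 * (real m * real g) - 2 * real m"
    by (simp add: sum_s sum_subtractf flip: sum_distrib_left)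
  have **: "real (2 + 2 * (m * g - m)) = 2 + 2 * (real m * real g) - 2 * real m"
    using m_le by (simp add: of_nat_diff del: mult_le_cancel1 mult_le_cancel2)
  show "G (m * g + m) (m * g + m) = real (2 + 2 * (m * g - m))"
    unfolding ** by (simp add: G_def vec_simps *)
  show "G (m * g + m + 1) (m * g + m + 1) = real (2 + 2 * (m * g - m))"
    unfolding ** by (simp add: G_def vec_simps *)
  show "G (m * g + m) (m * g + m + 1) = 2"
    by (simp add: G_def vec_simps)
qed

lemma G_q_z:
  assumes "b < m"
  shows "G (m * g + b) (m * g + m) = real (2 + 2 * (m * g - m) - 2 * g)" "G (m * g + b) (m * g + m + 1) = 0"
proof -
  have "G (m * g + b) (m * g + m) = (\<Sum>v<m * g. 2 * (1 - \<sigma> v) * of_bool (v div g \<noteq> b))"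
    using assms by (simp add: G_def vec_simps not_in_group)
  also have "\<dots> = (\<Sum>v<m * g. 2 - 2 * of_bool (v div g = b) - 2 * \<sigma> v + 2 * (of_bool (v div g = b) * \<sigma> v))"
    by (intro sum.cong) (auto simp: of_bool_not_iff)
  also have "\<dots> = 2 * real (m * g) - 2 * real g - 2 * real m + 2 * (\<Sum>v<m * g. of_bool (v div g = b) * \<sigma> v)"
    using assms
    by (simp add: sum.distrib sum_subtractf sum_s sum_group_indicator flip: sum_distrib_left)
  also have "(\<Sum>v<m * g. of_bool (v div g = b) * \<sigma> v) = (\<Sum>d<m. if d = b then 1 else 0)"
  proof -
    have "(d * g + sel d) div g = d" if "d < m" for d using sel[OF that] by simp
    then show ?thesis unfolding sum_\<sigma> by (intro sum.cong) auto
  qed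
  finally have *: "G (m * g + b) (m * g + m) = 2 * real (m * g) - 2 * real g - 2 * real m + 2"
    using assms by simp
  \<comment> \<open>This is (m - 1) (g - 1) >= 0 expanded; it rules out truncation in the entry of
    \<open>q_b\<close> and z.\<close>
  have "real g + real m \<le> real m * real g + 1"
    using mult_nonneg_nonneg[of "real m - 1" "real g - 1"] m g by (simp add: algebra_simps)
  then have "g + m \<le> m * g + 1" by (simp flip: of_nat_mult of_nat_add of_nat_Suc)
  have "2 + 2 * (k - m) - 2 * g = 2 * (k + 1 - (g + m))" if "m \<le> k" for k
    using that by arith
  from this[OF m_le] have "2 + 2 * (m * g - m) - 2 * g = 2 * (m * g + 1 - (g + m))" .
  then show "G (m * g + b) (m * g + m) = real (2 + 2 * (m * g - m) - 2 * g)"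
    using * \<open>g + m \<le> m * g + 1\<close> by (simp add: of_nat_diff)
  show "G (m * g + b) (m * g + m + 1) = 0"
    using assms by (simp add: G_def vec_simps not_in_group)
qed

lemma G_one: "G (m * g + m + 2 + m) (m * g + m + 2 + m) = real (clq_total m g C)"
proof -
  have "G (m * g + m + 2 + m) (m * g + m + 2 + m) =
      2 + (\<Sum>v<m * g. \<Sum>w<m * g. c v w) + (\<Sum>v<m * g. 2 * (real m - 1) * \<sigma> v + 2 * \<sigma> v + 2 * (1 - \<sigma> v) + 2 * (1 - \<sigma> v))"
    by (simp add: G_def vec_simps)
  also have "(\<Sum>v<m * g. 2 * (real m - 1) * \<sigma> v + 2 * \<sigma> v + 2 * (1 - \<sigma> v) + 2 * (1 - \<sigma> v)) =
      (\<Sum>v<m * g. 4 + (2 * real m - 4) * \<sigma> v)"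
    by (intro sum.cong) (auto simp: algebra_simps)
  also have "\<dots> = 4 * real (m * g) + (2 * real m - 4) * real m"
    by (simp add: sum.distrib sum_s flip: sum_distrib_left)
  also have "(\<Sum>v<m * g. \<Sum>w<m * g. c v w) = (\<Sum>v<m * g. real (clq_deg m g C v)) - real m * (real m - 1)"
    by (simp add: sum_c sum_subtractf sum_s flip: sum_distrib_right)
  finally have "G (m * g + m + 2 + m) (m * g + m + 2 + m) =
      2 + (\<Sum>v<m * g. real (clq_deg m g C v)) + real m * real m + 4 * real (m * g) - 3 * real m"
    by (simp add: algebra_simps)
  moreover have "3 * m \<le> k + 4 * l" if "m \<le> l" for k l
    using that by arith
  from this[OF m_le] have "3 * m \<le> 2 + (\<Sum>v<m * g. clq_deg m g C v) + m * m + 4 * (m * g)" .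
  ultimately show ?thesis by (simp add: clq_total_def of_nat_diff)
qed

lemma G_commute: "G i j = G j i"
  unfolding G_def by (simp add: conj_commute)

lemma G_last: "G i (m * g + m + 2 + m) = G i i"
  unfolding G_def by (simp add: vec_simps)

lemma G_nonneg: "G i j \<ge> 0"
  unfolding G_def using m by (intro add_nonneg_nonneg sum_nonneg) (auto simp: c_nonneg)

text \<open>A difference equal to an entry of \<open>G\<close> is nonnegative and hence not
  truncated. So the natural subtractions that define the p block are exact as soon as a full clique
  exists.\<close>

lemma G_eq_diff: "real a - real b = G i j \<Longrightarrow> real (a - b) = G i j"
  using G_nonneg[of i j] by (simp add: of_nat_diff)

lemma core_cases:
  assumes "i < m * g + m + 2"
  obtains (node) "i < m * g" | (q) b where "b < m" "i = m * g + b" | (z1) "i = m * g + m" | (z2) "i = Suc (m * g + m)"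
proof -
  consider "i < m * g" | "m * g \<le> i \<and> i < m * g + m" | "i = m * g + m" | "i = Suc (m * g + m)"
    using assms by linarith
  then show ?thesis
  proof cases
    case 2
    then show ?thesis using q[of "i - m * g"] by linarith
  qed (use node z1 z2 in simp_all)
qed

lemma G_core:
  assumes "i < m * g + m + 2" "j < m * g + m + 2"
  shows "real (clq_core m g C i j) = G i j"
proof -
  have upper: "real (clq_core m g C i j) = G i j"
    if ij: "i \<le> j" and i: "i < m * g + m + 2" and j: "j < m * g + m + 2" for i j
  proof -
    have z: "G (m * g + m) (m * g + m) = real (2 + 2 * (m * g - m))"
      "G (Suc (m * g + m)) (Suc (m * g + m)) = real (2 + 2 * (m * g - m))"
      "G (m * g + m) (Suc (m * g + m)) = 2"
      using G_z by simp_all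
    have mm: "clq_core m g C i j = (if i = j then clq_diag m g C i else clq_off m g C i j)"
      using ij by (simp add: clq_core_def)
    show ?thesis
      using j
    proof (cases rule: core_cases)
      case node
      then show ?thesis using ij G_node_node[of i j] unfolding mm by (simp add: clq_diag_def clq_off_def)
    next
      case jq: (q d)
      show ?thesis
        using i
      proof (cases rule: core_cases)
        case node
        then show ?thesis using jq G_node_q[of i d] unfolding mm by (simp add: clq_off_def)
      next
        case (q b)
        then show ?thesis using jq G_q_q[of b d] unfolding mm by (simp add: clq_off_def clq_diag_def)
      next
        case z1
        then show ?thesis using ij jq by linarith
      next
        case z2
        then show ?thesis using ij jq by linarith
      qed
    next
      case jz: z1
      show ?thesis
        using i
      proof (cases rule: core_cases)
        case node
        then show ?thesis using jz G_node_z[of i] unfolding mm by (simp add: clq_off_def)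
      next
        case (q b)
        then show ?thesis using jz G_q_z[of b] unfolding mm by (simp add: clq_off_def)
      next
        case z1
        then show ?thesis using jz z unfolding mm by (simp add: clq_diag_def)
      next
        case z2
        then show ?thesis using ij jz by linarith
      qed
    next
      case jz: z2
      show ?thesis
        using i
      proof (cases rule: core_cases)
        case node
        then show ?thesis using jz G_node_z[of i] unfolding mm by (simp add: clq_off_def)
      next
        case (q b)
        then show ?thesis using jz G_q_z[of b] unfolding mm by (simp add: clq_off_def)
      next
        case z1
        then show ?thesis using jz z unfolding mm by (simp add: clq_off_def)
      next
        case z2
        then show ?thesis using jz z unfolding mm by (simp add: clq_diag_def)
      qed
    qed
  qed
  show ?thesis
    using upper[of i j] upper[of j i] assms G_commute[of i j]
    by (cases "i \<le> j") (auto simp: clq_core_def min.commute max.commute)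
qed

lemma core_index: "b < m \<Longrightarrow> a < g \<Longrightarrow> b * g + a < m * g + m + 2" "b < m \<Longrightarrow> m * g + b < m * g + m + 2"
  using node_less[of b a] by simp_all

lemma G_diag_core: "i < m * g + m + 2 \<Longrightarrow> real (clq_diag m g C i) = G i i"
  using G_core[of i i] by (simp add: clq_core_def)

lemma G_last': "G (m * g + m + 2 + m) j = G j j"
  using G_commute G_last by metis

lemma G_balanced: "b < m \<Longrightarrow> G (m * g + m + 2 + b) j =
    G j j - (\<Sum>a<g. G (b * g + a) j) - G (m * g + b) j"
  using balanced_G unfolding balanced_def G_last' by blast

lemma G_row:
  assumes "b < m" "i < m * g + m + 2"
  shows "real (clq_row m g C b i) = G (m * g + m + 2 + b) i"
  unfolding clq_row_def
proof (rule G_eq_diff)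
  show "real (clq_diag m g C i) - real ((\<Sum>a<g. clq_core m g C i (b * g + a)) + clq_core m g C i (m * g + b)) =
      G (m * g + m + 2 + b) i"
  proof -
    have "real (clq_core m g C i (b * g + a)) = G (b * g + a) i" if "a < g" for a
      using G_core[OF assms(2) core_index(1)[OF assms(1) that]] G_commute by metis
    moreover have "real (clq_core m g C i (m * g + b)) = G (m * g + b) i"
      using G_core[OF assms(2) core_index(2)[OF assms(1)]] G_commute by metis
    ultimately show ?thesis
      unfolding G_balanced[OF assms(1)] of_nat_add of_nat_sum using assms(2) by (simp add: G_diag_core)
  qed
qed

lemma index_cases:
  assumes "i < clq_order m g"
  obtains (core) "i < m * g + m + 2" | (p) b where "b < m" "i = m * g + m + 2 + b" | (last) "i = m * g + m + 2 + m"
proof -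
  consider "i < m * g + m + 2" | "m * g + m + 2 \<le> i \<and> i < m * g + m + 2 + m" | "i = m * g + m + 2 + m"
    using assms unfolding clq_order_def by linarith
  then show ?thesis
  proof cases
    case 2
    then show ?thesis using p[of "i - (m * g + m + 2)"] by linarith
  qed (use core last in simp_all)
qed

lemma G_diag:
  assumes "i < clq_order m g"
  shows "real (clq_diag m g C i) = G i i"
  using assms
proof (cases rule: index_cases)
  case core
  then show ?thesis by (rule G_diag_core)
next
  case (p b)
  have "real (clq_total m g C - ((\<Sum>a<g. 2 * clq_deg m g C (b * g + a) + 4) + 2 * (m * g - g))) = G i i"
  proof (rule G_eq_diff)
    have "real (2 * clq_deg m g C (b * g + a) + 4) = G (b * g + a) (b * g + a)" if "a < g" for a
      using G_diag_core[OF core_index(1)[OF p(1) that]] node_less[OF p(1) that] by (simp add: clq_diag_def)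
    then have deg: "real (\<Sum>a<g. 2 * clq_deg m g C (b * g + a) + 4) = (\<Sum>a<g. G (b * g + a) (b * g + a))"
      unfolding of_nat_sum by (intro sum.cong) auto
    have q: "real (2 * (m * g - g)) = G (m * g + b) (m * g + b)"
      using G_q_q[OF p(1) p(1)] by simp
    have "G i i = real (clq_total m g C) - (\<Sum>a<g. G (b * g + a) (b * g + a)) - G (m * g + b) (m * g + b)"
      using G_last[of i] G_balanced[OF p(1), of "m * g + m + 2 + m"]
      unfolding p(2) G_one G_last[of "b * g + _"] G_last[of "m * g + b"] by simp
    then show "real (clq_total m g C) -
        real ((\<Sum>a<g. 2 * clq_deg m g C (b * g + a) + 4) + 2 * (m * g - g)) = G i i"
      unfolding of_nat_add deg q by simp
  qed
  moreover have "clq_diag m g C (m * g + m + 2 + b) =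
      clq_total m g C - ((\<Sum>a<g. 2 * clq_deg m g C (b * g + a) + 4) + 2 * (m * g - g))"
    using p(1) by (simp add: clq_diag_def)
  ultimately show ?thesis using p(2) by simp
next
  case last
  have "clq_diag m g C (m * g + m + 2 + m) = clq_total m g C" by (simp add: clq_diag_def)
  then show ?thesis using G_one last by simp
qed

theorem in_cone_entry: "in_cone (clq_order m g) (\<lambda>i j. real (clq_entry m g C i j))"
proof (rule in_cone_cong[OF in_cone_G])
  have upper: "G i j = real (clq_upper m g C i j)"
    if ij: "i < j" and i: "i < clq_order m g" and j: "j < clq_order m g" for i j
    using j
  proof (cases rule: index_cases)
    case core
    then show ?thesis using ij G_core[of i j] by (simp add: clq_upper_def clq_core_def)
  next
    case last
    then show ?thesis using ij G_diag[OF i] G_last[of i] by (simp add: clq_upper_def)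
  next
    case jp: (p b)
    show ?thesis
      using i
    proof (cases rule: index_cases)
      case core
      then show ?thesis using jp G_row[of b i] G_commute[of i j] by (simp add: clq_upper_def)
    next
      case (p d)
      have "real (clq_diag m g C j - ((\<Sum>a<g. clq_row m g C b (d * g + a)) + clq_row m g C b (m * g + d))) = G i j"
      proof (rule G_eq_diff)
        have "real (clq_row m g C b (d * g + a)) = G (d * g + a) j" if "a < g" for a
          using G_row[OF jp(1) core_index(1)[OF p(1) that]] G_commute unfolding jp(2) by metis
        moreover have "real (clq_row m g C b (m * g + d)) = G (m * g + d) j"
          using G_row[OF jp(1) core_index(2)[OF p(1)]] G_commute unfolding jp(2) by metis
        ultimately show "real (clq_diag m g C j) -
            real ((\<Sum>a<g. clq_row m g C b (d * g + a)) + clq_row m g C b (m * g + d)) = G i j"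
          unfolding p(2) G_balanced[OF p(1)] of_nat_add of_nat_sum by (simp add: G_diag[OF j])
      qed
      moreover have "clq_upper m g C i j =
          clq_diag m g C j - ((\<Sum>a<g. clq_row m g C b (d * g + a)) + clq_row m g C b (m * g + d))"
        using jp p ij by (simp add: clq_upper_def)
      ultimately show ?thesis by simp
    next
      case last
      then show ?thesis using ij jp by linarith
    qed
  qed
  fix i j assume "i < clq_order m g" "j < clq_order m g"
  moreover have "G i i = real (clq_upper m g C i i)" if "i < clq_order m g" for i
    using G_diag[OF that] by (simp add: clq_upper_def)
  ultimately show "G i j = real (clq_entry m g C i j)"
    using upper[of i j] upper[of j i] G_commute[of i j]
    by (cases i j rule: linorder_cases) (auto simp: clq_entry_def)
qed

end

section \<open>Soundness: a full clique extracted from any decomposition\<close>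

theorem full_clique_if_in_cone:
  assumes m: "m > 0" and groups: "\<And>v w. C v w \<Longrightarrow> v div g \<noteq> w div g"
    and cone: "in_cone (clq_order m g) (\<lambda>i j. real (clq_entry m g C i j))"
  shows "\<exists>sel. (\<forall>b<m. sel b < g) \<and> (\<forall>b<m. \<forall>c<m. b < c \<longrightarrow> C (b * g + sel b) (c * g + sel c))"
proof -
  let ?n = "clq_order m g" and ?U = "clq_entry m g C"
  let ?z1 = "m * g + m" and ?z2 = "m * g + m + 1" and ?one = "m * g + m + 2 + m"
  have one: "?one < ?n" "?z1 < ?n" "?z2 < ?n" by (simp_all add: clq_order_def)
  have node: "b * g + a < m * g" "b * g + a < ?n" if "b < m" "a < g" for a b
  proof -
    have "b * g + a < Suc b * g" using that by simp
    also have "\<dots> \<le> m * g" using \<open>b < m\<close> by (intro mult_le_mono1) simp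
    finally show "b * g + a < m * g" "b * g + a < ?n" by (simp_all add: clq_order_def)
  qed
  have qp: "m * g + b < ?n" "m * g + m + 2 + b < ?n" if "b < m" for b
    using that by (simp_all add: clq_order_def)
  obtain p :: "nat \<Rightarrow> real" where p: "\<And>k. k \<le> 2 ^ ?n - 1 \<Longrightarrow> p k \<ge> 0"
    and U: "\<And>i j. i < ?n \<Longrightarrow> j < ?n \<Longrightarrow>
      real (?U i j) = (\<Sum>k\<le>2 ^ ?n - 1. p k * of_bool (bit k (?n - 1 - i) \<and> bit k (?n - 1 - j)))"
    using cone unfolding in_cone_iff by blast
  define K where "K = {..2 ^ ?n - 1 :: nat}"
  define X where "X k i \<longleftrightarrow> bit k (?n - 1 - i)" for k i :: nat
  have U: "real (?U i j) = (\<Sum>k\<in>K. p k * of_bool (X k i \<and> X k j))" if "i < ?n" "j < ?n" for i j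
    using U[OF that] by (simp add: K_def X_def)
  have K: "finite K" "\<And>k. k \<in> K \<Longrightarrow> p k \<ge> 0" using p by (auto simp: K_def)
  have zero: "\<not> (X k i \<and> X k j)" if "?U i j = 0" "i < ?n" "j < ?n" "k \<in> K" "p k > 0" for i j k
  proof -
    have "(\<Sum>k\<in>K. p k * of_bool (X k i \<and> X k j)) = 0" using U[OF that(2,3)] that(1) by simp
    then have "p k * of_bool (X k i \<and> X k j) = 0"
      using K that(4) by (subst (asm) sum_nonneg_eq_0_iff) auto
    then show ?thesis using that(5) by auto
  qed
  \<comment> \<open>The entries (i, i) and (i, one) agree, while each term of the second sum is at
    most the corresponding term of the first. Hence the sums agree term by term.\<close>
  have last: "X k ?one" if "X k i" "i < ?n" "k \<in> K" "p k > 0" for i k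
  proof -
    have "?U i ?one = ?U i i"
      using that(2) by (simp add: clq_entry_def clq_upper_def clq_order_def max_absorb2 min_absorb1)
    then have "(\<Sum>k\<in>K. p k * of_bool (X k i \<and> X k i) - p k * of_bool (X k i \<and> X k ?one)) = 0"
      using U[OF that(2) one(1)] U[OF that(2,2)] by (simp only: sum_subtractf)
    then have "p k * of_bool (X k i \<and> X k i) - p k * of_bool (X k i \<and> X k ?one) = 0"
      using K that(3) by (subst (asm) sum_nonneg_eq_0_iff) auto
    then show ?thesis using that(1,4) by (auto split: if_splits)
  qed
  have "?U ?z1 ?z2 = 2" by (simp add: clq_entry_def clq_upper_def clq_off_def)
  then have "(\<Sum>k\<in>K. p k * of_bool (X k ?z1 \<and> X k ?z2)) \<noteq> 0" using U[OF one(2,3)] by simp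
  then obtain k where k: "k \<in> K" "p k * of_bool (X k ?z1 \<and> X k ?z2) \<noteq> 0"
    by (rule sum.not_neutral_contains_not_neutral)
  then have pk: "p k > 0" and z: "X k ?z1" "X k ?z2" using K(2)[of k] by (auto simp: less_le)
  have "\<exists>a<g. X k (b * g + a)" if b: "b < m" for b
  proof (rule ccontr)
    assume none: "\<not> (\<exists>a<g. X k (b * g + a))"
    let ?q = "m * g + b" and ?p = "m * g + m + 2 + b"
    have "b * g + g \<le> m * g" using b by (metis Suc_leI add.commute mult_Suc mult_le_mono1)
    have z_q: "?U ?z2 ?q = 0" using b by (simp add: clq_entry_def clq_upper_def clq_off_def min_def max_def)
    have core_sum: "(\<Sum>a<g. clq_core m g C ?z1 (b * g + a)) = 2 * g"
    proof -
      have "clq_core m g C ?z1 (b * g + a) = 2" if "a < g" for a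
        using node(1)[OF b that] by (simp add: clq_core_def clq_off_def)
      then show ?thesis by simp
    qed
    \<comment> \<open>The nodes of the group contribute 2 g and \<open>q_b\<close> at least the rest
      of the diagonal entry of z, whether or not its own difference is truncated. So nothing is left
      for \<open>p_b\<close>.\<close>
    have z_p: "?U ?z1 ?p = 0"
      using b by (simp add: clq_entry_def clq_upper_def clq_row_def core_sum) (simp add: clq_core_def clq_off_def clq_diag_def)
    have node_node: "?U (b * g + a) (b * g + a') = 0" if "a < g" "a' < g" "a \<noteq> a'" for a a'
    proof -
      have "\<not> C (b * g + c) (b * g + c')" if "c < g" "c' < g" for c c' using groups[of "b * g + c" "b * g + c'"] that by auto
      then show ?thesis using node(1)[OF b that(1)] node(1)[OF b that(2)] that
        by (auto simp: clq_entry_def clq_upper_def clq_off_def min_def max_def)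
    qed
    have node_q: "?U (b * g + a) ?q = 0" if "a < g" for a
      using node(1)[OF b that] that b by (simp add: clq_entry_def clq_upper_def clq_off_def)
    \<comment> \<open>The diagonal entry of the node occurs among the subtracted terms, so the
      truncated difference is 0.\<close>
    have node_p: "?U (b * g + a) ?p = 0" if "a < g" for a
    proof -
      have "clq_core m g C (b * g + a) (b * g + a) \<le> (\<Sum>a'<g. clq_core m g C (b * g + a) (b * g + a'))"
        using that by (intro member_le_sum) auto
      then show ?thesis using node(1)[OF b that] b
        by (simp add: clq_entry_def clq_upper_def clq_row_def) (simp add: clq_core_def)
    qed
    have q_p: "?U ?q ?p = 0"
      using b by (simp add: clq_entry_def clq_upper_def clq_row_def) (simp add: clq_core_def)
    \<comment> \<open>\<open>T l\<close> counts the ones of vector \<open>l\<close> among the nodes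
      of group b, \<open>q_b\<close> and \<open>p_b\<close>. Pairwise zero entries make it at most
      the constant coordinate. The diagonals sum to at least that of the constant coordinate, which
      forces equality in every vector of positive weight, and \<open>k\<close> with z = z' = 1
      violates it.\<close>
    define T where "T l = (\<Sum>a<g. of_bool (X l (b * g + a))) + of_bool (X l ?q) + (of_bool (X l ?p) :: real)" for l
    have le: "p l * T l \<le> p l * of_bool (X l ?one)" if l: "l \<in> K" for l
    proof (cases "p l > 0")
      case True
      have "T l \<le> of_bool (X l ?one)"
      proof (cases "\<exists>a<g. X l (b * g + a)")
        case True
        then obtain a where a: "a < g" "X l (b * g + a)" by blast
        then have "\<not> X l ?q" "\<not> X l ?p"
          using zero[OF node_q[OF a(1)] _ _ l \<open>p l > 0\<close>] zero[OF node_p[OF a(1)] _ _ l \<open>p l > 0\<close>] node[OF b a(1)] qp[OF b]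
          by blast+
        moreover have "(\<Sum>a'<g. of_bool (X l (b * g + a')) :: real) = (\<Sum>a'<g. if a' = a then 1 else 0)"
          using a zero[OF node_node _ _ l \<open>p l > 0\<close>] node[OF b] by (intro sum.cong) auto
        moreover have "X l ?one" using last[OF a(2) _ l \<open>p l > 0\<close>] node[OF b a(1)] by blast
        ultimately show ?thesis using a(1) by (simp add: T_def)
      next
        case False
        then have "(\<Sum>a'<g. of_bool (X l (b * g + a')) :: real) = 0" by (intro sum.neutral) auto
        moreover have "X l ?q \<Longrightarrow> X l ?one" "X l ?p \<Longrightarrow> X l ?one" "\<not> (X l ?q \<and> X l ?p)"
          using last[OF _ _ l \<open>p l > 0\<close>] zero[OF q_p _ _ l \<open>p l > 0\<close>] qp[OF b] by blast+
        ultimately show ?thesis unfolding T_def by auto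
      qed
      then show ?thesis using True by simp
    next
      case False
      then show ?thesis using K(2)[OF l] by simp
    qed
    \<comment> \<open>Truncation in the diagonal entry of \<open>p_b\<close> can only enlarge the
      right-hand side, so the inequality holds whether or not there is a clique.\<close>
    have "real (?U ?one ?one) \<le> (\<Sum>a<g. real (?U (b * g + a) (b * g + a))) + real (?U ?q ?q) + real (?U ?p ?p)"
    proof -
      have "?U (b * g + a) (b * g + a) = 2 * clq_deg m g C (b * g + a) + 4" if "a < g" for a
        using node(1)[OF b that] by (simp add: clq_entry_def clq_upper_def clq_diag_def)
      then have "(\<Sum>a<g. ?U (b * g + a) (b * g + a)) = (\<Sum>a<g. 2 * clq_deg m g C (b * g + a) + 4)"
        by (intro sum.cong) auto
      moreover have "?U ?q ?q = 2 * (m * g - g)" "?U ?one ?one = clq_total m g C"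
        "?U ?p ?p = clq_total m g C - ((\<Sum>a<g. 2 * clq_deg m g C (b * g + a) + 4) + 2 * (m * g - g))"
        using b by (simp_all add: clq_entry_def clq_upper_def clq_diag_def)
      ultimately have "?U ?one ?one \<le> (\<Sum>a<g. ?U (b * g + a) (b * g + a)) + ?U ?q ?q + ?U ?p ?p" by linarith
      then show ?thesis unfolding of_nat_sum[symmetric] of_nat_add[symmetric] by (simp only: of_nat_le_iff)
    qed
    also have "\<dots> = (\<Sum>l\<in>K. p l * T l)"
    proof -
      have "(\<Sum>a<g. real (?U (b * g + a) (b * g + a))) = (\<Sum>a<g. \<Sum>l\<in>K. p l * of_bool (X l (b * g + a)))"
        using U node(2)[OF b] by (intro sum.cong) auto
      also have "\<dots> = (\<Sum>l\<in>K. p l * (\<Sum>a<g. of_bool (X l (b * g + a))))"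
        unfolding sum_distrib_left by (rule sum.swap)
      finally show ?thesis
        using U[OF qp(1)[OF b] qp(1)[OF b]] U[OF qp(2)[OF b] qp(2)[OF b]]
        unfolding T_def distrib_left sum.distrib by (simp only: conj_absorb)
    qed
    finally have "(\<Sum>l\<in>K. p l * of_bool (X l ?one) - p l * T l) \<le> 0"
      using U[OF one(1) one(1)] unfolding sum_subtractf by (simp only: conj_absorb)
    then have "(\<Sum>l\<in>K. p l * of_bool (X l ?one) - p l * T l) = 0"
      using le by (intro antisym sum_nonneg) auto
    then have "p k * of_bool (X k ?one) - p k * T k = 0"
      using K(1) k(1) le by (subst (asm) sum_nonneg_eq_0_iff) auto
    moreover have "X k ?one" using last[OF z(1) one(2) k(1) pk] .
    moreover have "\<not> X k ?q" "\<not> X k ?p"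
      using zero[OF z_q one(3) qp(1)[OF b] k(1) pk] zero[OF z_p one(2) qp(2)[OF b] k(1) pk] z by blast+
    moreover have "(\<Sum>a<g. of_bool (X k (b * g + a)) :: real) = 0" using none by (intro sum.neutral) auto
    ultimately show False using pk by (simp add: T_def)
  qed
  then obtain sel where sel: "\<And>b. b < m \<Longrightarrow> sel b < g \<and> X k (b * g + sel b)" by metis
  have "C (b * g + sel b) (c * g + sel c)" if "b < m" "c < m" "b < c" for b c
  proof (rule ccontr)
    assume "\<not> C (b * g + sel b) (c * g + sel c)"
    have "b * g + sel b < Suc b * g" using sel[OF that(1)] by simp
    also have "\<dots> \<le> c * g" using that by (intro mult_le_mono1) simp
    finally have "?U (b * g + sel b) (c * g + sel c) = 0"
      using \<open>\<not> C _ _\<close> node(1)[OF that(2), of "sel c"] sel[OF that(2)]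
      by (simp add: clq_entry_def clq_upper_def clq_off_def)
    then show False using zero[OF _ _ _ k(1) pk] sel node(2) that by blast
  qed
  then show ?thesis using sel by blast
qed

theorem in_cone_entry_iff:
  assumes "m > 0" "\<And>v w. C v w \<Longrightarrow> C w v" "\<And>v w. C v w \<Longrightarrow> v div g \<noteq> w div g"
  shows "in_cone (clq_order m g) (\<lambda>i j. real (clq_entry m g C i j)) \<longleftrightarrow>
    (\<exists>sel. (\<forall>b<m. sel b < g) \<and> (\<forall>b<m. \<forall>c<m. b < c \<longrightarrow> C (b * g + sel b) (c * g + sel c)))"
    (is "_ \<longleftrightarrow> ?R")
proof
  assume ?R
  then obtain sel where sel: "\<forall>b<m. sel b < g" "\<forall>b<m. \<forall>c<m. b < c \<longrightarrow> C (b * g + sel b) (c * g + sel c)"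
    by blast
  interpret full_clique m g C sel
  proof
    show "C (b * g + sel b) (c * g + sel c)" if "b < m" "c < m" "b \<noteq> c" for b c
      using that sel(2) assms(2) by (metis linorder_neqE_nat)
  qed (use assms sel(1) in blast)+
  show "in_cone (clq_order m g) (\<lambda>i j. real (clq_entry m g C i j))" by (rule in_cone_entry)
qed (rule full_clique_if_in_cone[OF assms(1,3)])

section \<open>Computation tableaux as binary constraint problems\<close>

definition tm_rules :: "turing_machine \<Rightarrow> (nat \<times> nat list) list" where
  "tm_rules M = List.product [0..<Suc (num_states M)] (List.n_lists (num_tapes M) [0..<num_symbols M])"

text \<open>Extends the table to the halting state by rules that change nothing, so that every
  computation fills all \<open>T\<close> steps of the tableau.\<close>

definition tm_next :: "turing_machine \<Rightarrow> nat \<times> nat list \<Rightarrow> nat \<times> (nat \<times> move) list" where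
  "tm_next M = (\<lambda>(q, ss). if q < num_states M then trans M q ss else (q, map (\<lambda>s. (s, Stay)) ss))"

definition rule_state :: "turing_machine \<Rightarrow> nat \<Rightarrow> nat" where
  "rule_state M r = fst (tm_rules M ! r)"

definition rule_state' :: "turing_machine \<Rightarrow> nat \<Rightarrow> nat" where
  "rule_state' M r = fst (tm_next M (tm_rules M ! r))"

definition rule_read :: "turing_machine \<Rightarrow> nat \<Rightarrow> nat \<Rightarrow> nat" where
  "rule_read M j r = snd (tm_rules M ! r) ! j"

definition rule_write :: "turing_machine \<Rightarrow> nat \<Rightarrow> nat \<Rightarrow> nat" where
  "rule_write M j r = fst (snd (tm_next M (tm_rules M ! r)) ! j)"

text \<open>The displacement plus 1, that is 0, 1 or 2, to remain within the natural
  numbers.\<close>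

definition rule_shift :: "turing_machine \<Rightarrow> nat \<Rightarrow> nat \<Rightarrow> nat" where
  "rule_shift M j r = nat (1 + displacement (snd (snd (tm_next M (tm_rules M ! r)) ! j)))"

abbreviation num_rules :: "turing_machine \<Rightarrow> nat" where
  "num_rules M \<equiv> length (tm_rules M)"

text \<open>
  Variable \<open>(t, j, i)\<close> with \<open>i \<le> 2 T\<close> describes cell \<open>i - T\<close> of tape \<open>j\<close> at time \<open>t\<close>: its value is
  twice the symbol plus 1 if the head is there. Variable \<open>(t, j, 2 T + 1)\<close> has the value
  \<open>p * num_rules M + r\<close>, where \<open>p - T\<close> is the head position and \<open>r\<close> is the applicable rule, which
  must be the same for all tapes.
\<close>

definition tab_con :: "turing_machine \<Rightarrow> nat \<Rightarrow> nat \<Rightarrow> bool list \<Rightarrow>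
    nat \<Rightarrow> nat \<Rightarrow> nat \<Rightarrow> nat \<Rightarrow> nat \<Rightarrow> nat \<Rightarrow> nat \<Rightarrow> nat \<Rightarrow> bool" where
  "tab_con M T P x t j i a t' j' i' a' \<longleftrightarrow>
    (i = 2 * T + 1 \<longrightarrow> a < (2 * T + 1) * num_rules M \<and>
      (t = 0 \<longrightarrow> a div num_rules M = T \<and> rule_state M (a mod num_rules M) = 0) \<and>
      (i' = 2 * T + 1 \<and> t' = t \<longrightarrow> a' mod num_rules M = a mod num_rules M) \<and>
      (i' = 2 * T + 1 \<and> t' = t + 1 \<longrightarrow> rule_state M (a' mod num_rules M) = rule_state' M (a mod num_rules M)) \<and>
      (i' = 2 * T + 1 \<and> t' = t + 1 \<and> j' = j \<longrightarrow>
        a' div num_rules M + 1 = a div num_rules M + rule_shift M j (a mod num_rules M)) \<and>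
      (i' < 2 * T + 1 \<and> t' = t \<and> j' = j \<longrightarrow> (a' mod 2 = 1 \<longleftrightarrow> i' = a div num_rules M) \<and>
        (i' = a div num_rules M \<longrightarrow> a' div 2 = rule_read M j (a mod num_rules M))) \<and>
      (i' < 2 * T + 1 \<and> t' = t + 1 \<and> j' = j \<and> i' = a div num_rules M \<longrightarrow>
        a' div 2 = rule_write M j (a mod num_rules M))) \<and>
    (i < 2 * T + 1 \<longrightarrow>
      (t = 0 \<and> j = 0 \<longrightarrow> a div 2 =
        (if T \<le> i \<and> i - T < length x then if i - T < length x \<and> x ! (i - T) then 2 else 1 else 0)) \<and>
      (t = 0 \<and> j = 1 \<longrightarrow> a div 2 \<le> 2 \<and> (\<not> (T \<le> i \<and> i < T + P) \<longrightarrow> a div 2 = 0)) \<and>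
      (t = 0 \<and> 2 \<le> j \<longrightarrow> a div 2 = 0) \<and>
      (t = T \<and> j = 2 \<and> i = T \<longrightarrow> a div 2 = 2) \<and>
      (t' = t + 1 \<and> j' = j \<and> i' = i \<and> a mod 2 = 0 \<longrightarrow> a' div 2 = a div 2) \<and>
      (t = 0 \<and> t' = 0 \<and> j = 1 \<and> j' = 1 \<and> i' = i + 1 \<and> i' < 2 * T + 1 \<and> T \<le> i \<and> a div 2 = 0 \<longrightarrow> a' div 2 = 0))"

text \<open>\<open>T\<close> bounds the running time and the lengths of input and witness. Therefore
  heads and strings stay within the cells from -T to T.\<close>

locale tableau =
  fixes M :: turing_machine and T P :: nat and x :: "bool list" and R :: "bool list \<Rightarrow> bool"
  assumes wf: "wf_tm M" and tapes: "num_tapes M \<ge> 3"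
    and T: "length x \<le> T" "P \<le> T"
    and out: "length w \<le> P \<Longrightarrow> outputs_within M [x, w] [R w] T"
begin

definition solution :: "(nat \<Rightarrow> nat \<Rightarrow> nat \<Rightarrow> nat) \<Rightarrow> bool" where
  "solution f \<longleftrightarrow>
    (\<forall>t\<le>T. \<forall>j<num_tapes M. \<forall>i\<le>2 * T + 1. f t j i < (2 * T + 1) * num_rules M + 2 * num_symbols M) \<and>
    (\<forall>t\<le>T. \<forall>j<num_tapes M. \<forall>i\<le>2 * T + 1. \<forall>t'\<le>T. \<forall>j'<num_tapes M. \<forall>i'\<le>2 * T + 1.
      (t, j, i) \<noteq> (t', j', i') \<longrightarrow> tab_con M T P x t j i (f t j i) t' j' i' (f t' j' i'))"

abbreviation cfg :: "bool list \<Rightarrow> nat \<Rightarrow> config" where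
  "cfg w t \<equiv> (step M ^^ t) (init_config M [x, w])"

abbreviation tape_at :: "bool list \<Rightarrow> nat \<Rightarrow> nat \<Rightarrow> tape" where
  "tape_at w t j \<equiv> snd (cfg w t) ! j"

abbreviation rule_at :: "bool list \<Rightarrow> nat \<Rightarrow> nat \<times> nat list" where
  "rule_at w t \<equiv> (fst (cfg w t), map read_tape (snd (cfg w t)))"

lemma step_next:
  "length ts = num_tapes M \<Longrightarrow> q \<le> num_states M \<Longrightarrow>
    step M (q, ts) = (fst (tm_next M (q, map read_tape ts)), map2 act (snd (tm_next M (q, map read_tape ts))) ts)"
proof -
  have "act (read_tape c, Stay) c = c" for c by (cases c) auto
  then have "map2 act (map (\<lambda>s. (s, Stay)) (map read_tape ts)) ts = ts"
    by (intro nth_equalityI) auto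
  then show ?thesis by (simp add: tm_next_def split: prod.split)
qed

lemma next_wf:
  assumes "q \<le> num_states M" "length ss = num_tapes M" "\<forall>s\<in>set ss. s < num_symbols M"
  shows "fst (tm_next M (q, ss)) \<le> num_states M" "length (snd (tm_next M (q, ss))) = num_tapes M"
    "\<forall>(s, d)\<in>set (snd (tm_next M (q, ss))). s < num_symbols M"
proof -
  have "fst (tm_next M (q, ss)) \<le> num_states M \<and> length (snd (tm_next M (q, ss))) = num_tapes M \<and>
      (\<forall>(s, d)\<in>set (snd (tm_next M (q, ss))). s < num_symbols M)"
  proof (cases "q < num_states M")
    case True
    then have "case trans M q ss of (q', as) \<Rightarrow>
        q' \<le> num_states M \<and> length as = num_tapes M \<and> (\<forall>(s, d)\<in>set as. s < num_symbols M)"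
      using wf[unfolded wf_tm_def, THEN conjunct2, THEN spec, THEN mp, OF True, THEN spec[of _ ss]] assms(2,3) by simp
    then show ?thesis using True by (simp add: tm_next_def case_prod_unfold)
  next
    case False
    then show ?thesis using assms by (simp add: tm_next_def)
  qed
  then show "fst (tm_next M (q, ss)) \<le> num_states M" "length (snd (tm_next M (q, ss))) = num_tapes M"
    "\<forall>(s, d)\<in>set (snd (tm_next M (q, ss))). s < num_symbols M"
    by simp_all
qed

lemma read_bound:
  assumes "\<And>j. j < length ts \<Longrightarrow> \<forall>i. fst (ts ! j) i < n"
  shows "\<forall>s\<in>set (map read_tape ts). s < n"
proof
  fix s assume "s \<in> set (map read_tape ts)"
  then obtain j where "j < length ts" "s = read_tape (ts ! j)" by (auto simp: in_set_conv_nth)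
  moreover have "read_tape u = fst u (snd u)" for u by (cases u) simp
  ultimately show "s < n" using assms by metis
qed

lemma cfg_wf:
  "fst (cfg w t) \<le> num_states M \<and> length (snd (cfg w t)) = num_tapes M \<and>
    (\<forall>j<num_tapes M. \<forall>i. fst (tape_at w t j) i < num_symbols M) \<and>
    (\<forall>j<num_tapes M. \<bar>snd (tape_at w t j)\<bar> \<le> int t)"
proof (induction t)
  case 0
  have "string_contents y i < 3" for y i by (simp add: string_contents_def)
  moreover have "3 \<le> num_symbols M" using wf by (simp add: wf_tm_def)
  ultimately have "string_contents y i < num_symbols M" for y i using less_le_trans by blast
  then show ?case by (simp add: init_config_def)
next
  case (Suc t)
  obtain q ts where c: "cfg w t = (q, ts)" by (cases "cfg w t")
  let ?n = "tm_next M (q, map read_tape ts)"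
  have len: "length ts = num_tapes M" and q: "q \<le> num_states M"
    and sym: "\<And>j i. j < num_tapes M \<Longrightarrow> fst (ts ! j) i < num_symbols M"
    and pos: "\<And>j. j < num_tapes M \<Longrightarrow> \<bar>snd (ts ! j)\<bar> \<le> int t"
    using Suc.IH c by auto
  have "\<forall>s\<in>set (map read_tape ts). s < num_symbols M"
    using sym len by (intro read_bound) simp
  note nw = next_wf[OF q _ this]
  have c': "cfg w (Suc t) = (fst ?n, map2 act (snd ?n) ts)"
    using c step_next[OF len q] by simp
  have act: "fst (act y u) i < num_symbols M" "\<bar>snd (act y u)\<bar> \<le> int (Suc t)"
    if "fst y < num_symbols M" "\<And>i. fst u i < num_symbols M" "\<bar>snd u\<bar> \<le> int t" for y u i
    using that by (cases u; cases y; cases "snd y"; simp)+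
  have y: "fst (snd ?n ! j) < num_symbols M" if "j < num_tapes M" for j
  proof -
    have "snd ?n ! j \<in> set (snd ?n)" using nw(2) len that by simp
    then show ?thesis using nw(3) len by (simp add: case_prod_unfold)
  qed
  have "snd (cfg w (Suc t)) ! j = act (snd ?n ! j) (ts ! j)" if "j < num_tapes M" for j
    using nw(2) len c' that by simp
  then show ?case
    using nw(1,2) len c' act[OF y sym pos] by simp
qed

lemma tape_step:
  assumes "j < num_tapes M"
  shows "tape_at w (Suc t) j = act (snd (tm_next M (rule_at w t)) ! j) (tape_at w t j)"
proof -
  obtain q ts where c: "cfg w t = (q, ts)" by (cases "cfg w t")
  have "length (snd (tm_next M (q, map read_tape ts))) = num_tapes M"
    using cfg_wf[of t w] c by (intro next_wf(2) read_bound) simp_all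
  then show ?thesis using step_next[of ts q] cfg_wf[of t w] c assms by simp
qed

lemma state_step: "fst (cfg w (Suc t)) = fst (tm_next M (rule_at w t))"
  using step_next[of "snd (cfg w t)" "fst (cfg w t)"] cfg_wf[of t w] by simp

lemma rule_at_mem: "rule_at w t \<in> set (tm_rules M)"
proof -
  have "\<forall>s\<in>set (map read_tape (snd (cfg w t))). s < num_symbols M"
    using cfg_wf[of t w] by (intro read_bound) simp
  then show ?thesis using cfg_wf[of t w] unfolding tm_rules_def by (auto simp: set_n_lists)
qed

lemma tm_rules_nth: "r < num_rules M \<Longrightarrow> length (snd (tm_rules M ! r)) = num_tapes M"
  using nth_mem[of r "tm_rules M"] unfolding tm_rules_def by (auto dest!: length_n_lists_elem)

lemma shift: "int (nat (1 + displacement d)) = 1 + displacement d"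
  by (cases d) auto

lemma solution_if_witness:
  assumes "length w \<le> P" "R w"
  shows "\<exists>f. solution f"
proof -
  define S where "S = num_symbols M"
  have "\<forall>t. \<exists>r<num_rules M. tm_rules M ! r = rule_at w t"
    using rule_at_mem unfolding in_set_conv_nth by blast
  then obtain r where r: "\<And>t. r t < num_rules M" "\<And>t. tm_rules M ! r t = rule_at w t"
    by metis
  define pos where "pos t j = nat (snd (tape_at w t j) + int T)" for t j
  define sym where "sym t j i = fst (tape_at w t j) (int i - int T)" for t j i
  define f where "f t j i = (if i = 2 * T + 1 then pos t j * num_rules M + r t
    else 2 * sym t j i + (if i = pos t j then 1 else 0))" for t j i
  have pos: "int (pos t j) = snd (tape_at w t j) + int T" "pos t j < 2 * T + 1"
    if "t \<le> T" "j < num_tapes M" for t j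
  proof -
    have "\<bar>snd (tape_at w t j)\<bar> \<le> int T" using cfg_wf[of t w] that by force
    then show "int (pos t j) = snd (tape_at w t j) + int T" "pos t j < 2 * T + 1"
      by (auto simp: pos_def)
  qed
  have f: "f t j (2 * T + 1) div num_rules M = pos t j" "f t j (2 * T + 1) mod num_rules M = r t" for t j
    using r(1)[of t] by (auto simp: f_def div_add1_eq)
  have f_cell: "f t j i div 2 = sym t j i" "f t j i mod 2 = 1 \<longleftrightarrow> i = pos t j" "f t j i mod 2 = 0 \<longleftrightarrow> i \<noteq> pos t j"
    if "i < 2 * T + 1" for t j i
    using that by (auto simp: f_def)
  have bound: "f t j (2 * T + 1) < (2 * T + 1) * num_rules M" if "t \<le> T" "j < num_tapes M" for t j
  proof -
    have "f t j (2 * T + 1) < Suc (pos t j) * num_rules M" using r(1)[of t] by (simp add: f_def)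
    also have "\<dots> \<le> (2 * T + 1) * num_rules M" using pos(2)[OF that] by (intro mult_le_mono1) simp
    finally show ?thesis .
  qed
  have bound': "f t j i < (2 * T + 1) * num_rules M + 2 * num_symbols M"
    if "t \<le> T" "j < num_tapes M" "i \<le> 2 * T + 1" for t j i
  proof (cases "i = 2 * T + 1")
    case True
    then show ?thesis using bound[OF that(1,2)] by simp
  next
    case False
    have "sym t j i < num_symbols M" using cfg_wf[of t w] that by (simp add: sym_def)
    moreover have "f t j i \<le> 2 * sym t j i + 1" using False by (simp add: f_def)
    ultimately show ?thesis by linarith
  qed
  have read: "rule_read M j (r t) = sym t j (pos t j)" if "t \<le> T" "j < num_tapes M" for t j
  proof -
    have "read_tape u = fst u (snd u)" for u by (cases u) simp
    then show ?thesis using cfg_wf[of t w] that pos(1)[OF that] by (simp add: rule_read_def r sym_def)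
  qed
  have state: "rule_state M (r t) = fst (cfg w t)" "rule_state' M (r t) = rule_state M (r (Suc t))" for t
    by (simp_all only: rule_state_def rule_state'_def r state_step fst_conv)
  have move: "pos (Suc t) j + 1 = pos t j + rule_shift M j (r t)" if "Suc t \<le> T" "j < num_tapes M" for t j
  proof -
    let ?a = "snd (tm_next M (rule_at w t)) ! j"
    have "snd (act ?a u) = snd u + displacement (snd ?a)" for u by (cases u; cases ?a) simp
    then have "snd (tape_at w (Suc t) j) = snd (tape_at w t j) + displacement (snd ?a)"
      using tape_step[OF that(2), of t w] by simp
    moreover have "int (rule_shift M j (r t)) = 1 + displacement (snd ?a)"
      by (simp only: rule_shift_def r shift)
    ultimately have "int (pos (Suc t) j + 1) = int (pos t j + rule_shift M j (r t))"
      using pos(1)[OF that] pos(1)[of t j] that by simp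
    then show ?thesis by (simp only: of_nat_eq_iff)
  qed
  have cell: "sym (Suc t) j i = (if i = pos t j then rule_write M j (r t) else sym t j i)"
    if "Suc t \<le> T" "j < num_tapes M" for t j i
  proof -
    let ?a = "snd (tm_next M (rule_at w t)) ! j"
    have "fst (act ?a u) z = (if z = snd u then fst ?a else fst u z)" for u z by (cases u; cases ?a) simp
    then have "sym (Suc t) j i = (if int i - int T = snd (tape_at w t j) then fst ?a else sym t j i)"
      using tape_step[OF that(2), of t w] by (simp add: sym_def)
    moreover have "int i - int T = snd (tape_at w t j) \<longleftrightarrow> i = pos t j"
      using pos(1)[of t j] that by auto
    ultimately show ?thesis by (simp only: rule_write_def r)
  qed
  have init: "tape_at w 0 j = (string_contents (if j < 2 then [x, w] ! j else []), 0)" if "j < num_tapes M" for j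
    using that by (simp add: init_config_def)
  have init_state: "rule_state M (r 0) = 0" by (simp add: state(1) init_config_def)
  have sym0: "sym 0 0 i = string_contents x (int i - int T)" "sym 0 1 i = string_contents w (int i - int T)"
    "2 \<le> j \<Longrightarrow> j < num_tapes M \<Longrightarrow> sym 0 j i = 0" for i j
    using init[of 0] init[of 1] init[of j] tapes by (auto simp: sym_def string_contents_def)
  have pos0: "pos 0 j = T" if "j < num_tapes M" for j
    using init[OF that] by (simp add: pos_def)
  have final: "sym T 2 T = 2"
  proof -
    have "fst (tape_at w T 2) = string_contents [R w]"
      using out[OF assms(1)] by (simp add: outputs_within_def case_prod_unfold numeral_2_eq_2)
    then show ?thesis using assms(2) by (simp add: sym_def string_contents_def)
  qed
  have "tab_con M T P x t j i (f t j i) t' j' i' (f t' j' i')"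
    if t: "t \<le> T" "t' \<le> T" and j: "j < num_tapes M" "j' < num_tapes M" and i: "i \<le> 2 * T + 1" "i' \<le> 2 * T + 1"
    for t t' j j' i i'
    unfolding tab_con_def
  proof (intro conjI impI; (elim conjE)?)
    assume "i = 2 * T + 1"
    then show "f t j i < (2 * T + 1) * num_rules M" using bound[OF t(1) j(1)] by simp
  next
    assume "i = 2 * T + 1" "t = 0"
    then show "f t j i div num_rules M = T" using f pos0[OF j(1)] by simp
  next
    assume "i = 2 * T + 1" "t = 0"
    then show "rule_state M (f t j i mod num_rules M) = 0" using f(2) init_state by simp
  next
    assume "i = 2 * T + 1" "i' = 2 * T + 1" "t' = t"
    then show "f t' j' i' mod num_rules M = f t j i mod num_rules M" using f(2) by simp
  next
    assume "i = 2 * T + 1" "i' = 2 * T + 1" "t' = t + 1"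
    then show "rule_state M (f t' j' i' mod num_rules M) = rule_state' M (f t j i mod num_rules M)"
      using f(2) state(2) by simp
  next
    assume "i = 2 * T + 1" "i' = 2 * T + 1" "t' = t + 1" "j' = j"
    then show "f t' j' i' div num_rules M + 1 = f t j i div num_rules M + rule_shift M j (f t j i mod num_rules M)"
      using f move[of t j] t j by simp
  next
    assume "i = 2 * T + 1" "i' < 2 * T + 1" "t' = t" "j' = j"
    then show "(f t' j' i' mod 2 = 1) = (i' = f t j i div num_rules M)" using f f_cell by simp
  next
    assume "i = 2 * T + 1" "i' < 2 * T + 1" "t' = t" "j' = j" "i' = f t j i div num_rules M"
    then show "f t' j' i' div 2 = rule_read M j (f t j i mod num_rules M)"
      using f f_cell read[OF t(1) j(1)] by simp
  next
    assume "i = 2 * T + 1" "i' < 2 * T + 1" "t' = t + 1" "j' = j" "i' = f t j i div num_rules M"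
    then show "f t' j' i' div 2 = rule_write M j (f t j i mod num_rules M)"
      using f f_cell cell[of t j i'] t j by simp
  next
    assume "i < 2 * T + 1" "t = 0" "j = 0"
    then show "f t j i div 2 = (if T \<le> i \<and> i - T < length x then if i - T < length x \<and> x ! (i - T) then 2 else 1 else 0)"
      using sym0(1) by (auto simp: f_cell string_contents_def nat_diff_distrib)
  next
    assume *: "i < 2 * T + 1" "t = 0" "j = 1"
    then show "f t j i div 2 \<le> 2" using sym0(2) by (simp add: f_cell string_contents_def)
    assume "\<not> (T \<le> i \<and> i < T + P)"
    then show "f t j i div 2 = 0" using sym0(2) assms(1) * by (auto simp: f_cell string_contents_def)
  next
    assume "i < 2 * T + 1" "t = 0" "2 \<le> j"
    then show "f t j i div 2 = 0" using sym0(3) j by (simp add: f_cell)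
  next
    assume "i < 2 * T + 1" "t = T" "j = 2" "i = T"
    then show "f t j i div 2 = 2" using final f_cell(1) by simp
  next
    assume "i < 2 * T + 1" "t' = t + 1" "j' = j" "i' = i" "f t j i mod 2 = 0"
    then show "f t' j' i' div 2 = f t j i div 2" using f_cell cell[of t j i] t j by simp
  next
    assume "i < 2 * T + 1" "t = 0" "t' = 0" "j = 1" "j' = 1" "i' = i + 1" "i' < 2 * T + 1" "T \<le> i" "f t j i div 2 = 0"
    then show "f t' j' i' div 2 = 0"
      using i f_cell(1)[of i 0 1] f_cell(1)[of "i + 1" 0 1] sym0(2)
      by (auto simp: string_contents_def split: if_splits)
  qed
  then have "solution f" unfolding solution_def using bound' by blast
  then show ?thesis by blast
qed

text \<open>The witness is read off tape 1 at time 0. Induction on the time then identifies the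
  tableau with the run of \<open>M\<close> on input and witness, and the final constraint says that
  the run outputs \<open>True\<close>.\<close>

lemma witness_if_solution:
  assumes "solution f"
  shows "\<exists>w. length w \<le> P \<and> R w"
proof -
  have con: "tab_con M T P x t j i (f t j i) t' j' i' (f t' j' i')"
    if "t \<le> T" "j < num_tapes M" "i \<le> 2 * T + 1" "t' \<le> T" "j' < num_tapes M" "i' \<le> 2 * T + 1" "(t, j, i) \<noteq> (t', j', i')"
    for t j i t' j' i'
    using assms that unfolding solution_def by blast
  define pos where "pos t j = f t j (2 * T + 1) div num_rules M" for t j
  define rl where "rl t j = f t j (2 * T + 1) mod num_rules M" for t j
  define sym where "sym t j i = f t j i div 2" for t j i
  have head: "pos t j < 2 * T + 1 \<and> rl t j < num_rules M \<and> (t = 0 \<longrightarrow> pos t j = T \<and> rule_state M (rl t j) = 0)"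
    if "t \<le> T" "j < num_tapes M" for t j
  proof -
    \<comment> \<open>Conditions on a single variable are part of the binary constraint, so any
      second variable exposes them; cell index 0 serves here.\<close>
    have *: "f t j (2 * T + 1) < (2 * T + 1) * num_rules M"
      "t = 0 \<longrightarrow> pos t j = T \<and> rule_state M (rl t j) = 0"
      using con[OF that _ that, of "2 * T + 1" 0] by (auto simp: tab_con_def pos_def rl_def)
    moreover from *(1) have "num_rules M > 0" by (auto intro: gr0I)
    ultimately show ?thesis by (simp add: pos_def rl_def less_mult_imp_div_less)
  qed
  have same_rule: "rl t j = rl t j'" if "t \<le> T" "j < num_tapes M" "j' < num_tapes M" for t j j'
    using con[OF that(1,2) _ that(1,3), of "2 * T + 1" "2 * T + 1"] by (cases "j = j'") (auto simp: tab_con_def rl_def)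
  have next_state: "rule_state M (rl (Suc t) j) = rule_state' M (rl t j)"
    and next_pos: "pos (Suc t) j + 1 = pos t j + rule_shift M j (rl t j)"
    if "Suc t \<le> T" "j < num_tapes M" for t j
    using con[of t j "2 * T + 1" "Suc t" j "2 * T + 1"] that by (auto simp: tab_con_def rl_def pos_def)
  have flag: "f t j i mod 2 = 1 \<longleftrightarrow> i = pos t j" and read: "i = pos t j \<Longrightarrow> sym t j i = rule_read M j (rl t j)"
    if "t \<le> T" "j < num_tapes M" "i < 2 * T + 1" for t j i
    using con[of t j "2 * T + 1" t j i] that by (auto simp: tab_con_def rl_def pos_def sym_def)
  have write_cell: "i = pos t j \<Longrightarrow> sym (Suc t) j i = rule_write M j (rl t j)"
    if "Suc t \<le> T" "j < num_tapes M" "i < 2 * T + 1" for t j i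
    using con[of t j "2 * T + 1" "Suc t" j i] that by (auto simp: tab_con_def rl_def pos_def sym_def)
  have keep: "sym (Suc t) j i = sym t j i" if "Suc t \<le> T" "j < num_tapes M" "i < 2 * T + 1" "i \<noteq> pos t j" for t j i
  proof -
    have "f t j i mod 2 = 0" using flag[of t j i] that by (simp add: mod2_eq_if split: if_splits)
    then show ?thesis using con[of t j i "Suc t" j i] that by (auto simp: tab_con_def sym_def)
  qed
  have cell: "tab_con M T P x t j i (f t j i) t j (2 * T + 1) (f t j (2 * T + 1))"
    if "t \<le> T" "j < num_tapes M" "i < 2 * T + 1" for t j i
    using con[of t j i t j "2 * T + 1"] that by simp
  have sym0: "sym 0 0 i = string_contents x (int i - int T)" if "i < 2 * T + 1" for i
    using cell[of 0 0 i] tapes that by (auto simp: tab_con_def sym_def string_contents_def nat_diff_distrib)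
  have sym1: "sym 0 1 i \<le> 2" "\<not> (T \<le> i \<and> i < T + P) \<Longrightarrow> sym 0 1 i = 0" if "i < 2 * T + 1" for i
    using cell[of 0 1 i] tapes that by (auto simp: tab_con_def sym_def)
  have sym2: "sym 0 j i = 0" if "2 \<le> j" "j < num_tapes M" "i < 2 * T + 1" for j i
    using cell[of 0 j i] that by (auto simp: tab_con_def sym_def)
  have final: "sym T 2 T = 2"
    using cell[of T 2 T] tapes by (auto simp: tab_con_def sym_def)
  have blank: "sym 0 1 (i + 1) = 0" if "i + 1 < 2 * T + 1" "T \<le> i" "sym 0 1 i = 0" for i
    using con[of 0 1 i 0 1 "i + 1"] tapes that by (auto simp: tab_con_def sym_def)
  \<comment> \<open>The length of the guessed witness: the first blank cell from the origin on, but
    at most \<open>P\<close>. The constraint that blanks propagate to the right makes all later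
    cells blank too.\<close>
  define n where "n = (LEAST n. n = P \<or> sym 0 1 (T + n) = 0)"
  have n: "n = P \<or> sym 0 1 (T + n) = 0" unfolding n_def by (rule LeastI[of _ P]) simp
  have n_le: "n \<le> P" unfolding n_def by (rule Least_le) simp
  have before: "sym 0 1 (T + l) \<noteq> 0" if "l < n" for l
    using not_less_Least[of l "\<lambda>n. n = P \<or> sym 0 1 (T + n) = 0"] that unfolding n_def by blast
  have after: "sym 0 1 (T + l) = 0" if "n \<le> l" "l \<le> T" for l
    using that
  proof (induction l rule: dec_induct)
    case base
    then show ?case using n sym1(2)[of "T + n"] by auto
  next
    case (step l)
    then show ?case using blank[of "T + l"] by simp
  qed
  define w where "w = map (\<lambda>l. sym 0 1 (T + l) = 2) [0..<n]"
  have sym_w: "sym 0 1 i = string_contents w (int i - int T)" if "i < 2 * T + 1" for i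
  proof (cases "T \<le> i")
    case True
    define l where "l = i - T"
    have l: "i = T + l" "l \<le> T" using True that by (auto simp: l_def)
    show ?thesis
    proof (cases "l < n")
      case True
      then have "sym 0 1 (T + l) = 1 \<or> sym 0 1 (T + l) = 2"
        using before[OF True] sym1(1)[of "T + l"] l that by linarith
      then show ?thesis using True by (auto simp: l(1) w_def string_contents_def)
    next
      case False
      then show ?thesis using after[of l] l by (simp add: w_def string_contents_def)
    qed
  next
    case False
    then show ?thesis using sym1(2)[OF that] by (simp add: string_contents_def)
  qed
  have "(\<forall>j<num_tapes M. int (pos t j) = snd (tape_at w t j) + int T \<and> rule_state M (rl t j) = fst (cfg w t) \<and>
      (\<forall>i<2 * T + 1. sym t j i = fst (tape_at w t j) (int i - int T)))" if "t \<le> T" for t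
    using that
  proof (induction t)
    case 0
    have init: "tape_at w 0 j = (string_contents (if j < 2 then [x, w] ! j else []), 0)" if "j < num_tapes M" for j
      using that by (simp add: init_config_def)
    have "sym 0 j i = fst (tape_at w 0 j) (int i - int T)" if "j < num_tapes M" "i < 2 * T + 1" for j i
    proof -
      consider "j = 0" | "j = 1" | "2 \<le> j" by linarith
      then show ?thesis
        using sym0[OF that(2)] sym_w[OF that(2)] sym2[OF _ that] init[OF that(1)]
        by cases (simp_all add: string_contents_def del: One_nat_def funpow.simps)
    qed
    then show ?case using head[of 0] init by (simp add: init_config_def)
  next
    case (Suc t)
    then have IH: "int (pos t j) = snd (tape_at w t j) + int T" "rule_state M (rl t j) = fst (cfg w t)"
      "\<And>i. i < 2 * T + 1 \<Longrightarrow> sym t j i = fst (tape_at w t j) (int i - int T)" if "j < num_tapes M" for j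
      using that by auto
    \<comment> \<open>The head variable of a tape certifies only the symbol read on that tape. As
      all head variables of one time carry the same rule, together they certify the whole
      tuple.\<close>
    have rule: "tm_rules M ! rl t j = rule_at w t" if "j < num_tapes M" for j
    proof (rule prod_eqI)
      show "fst (tm_rules M ! rl t j) = fst (rule_at w t)" using IH(2)[OF that] by (simp add: rule_state_def)
      show "snd (tm_rules M ! rl t j) = snd (rule_at w t)"
      proof (rule nth_equalityI)
        have len: "length (snd (tm_rules M ! rl t j)) = num_tapes M"
          using head[of t j] Suc.prems that by (intro tm_rules_nth) simp
        then show "length (snd (tm_rules M ! rl t j)) = length (snd (rule_at w t))"
          using cfg_wf[of t w] by simp
        fix j' assume "j' < length (snd (tm_rules M ! rl t j))"
        then have j': "j' < num_tapes M" using len by simp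
        have "snd (tm_rules M ! rl t j) ! j' = rule_read M j' (rl t j')"
          using same_rule[of t j j'] Suc.prems that j' by (simp add: rule_read_def)
        also have "\<dots> = sym t j' (pos t j')"
          using read[of t j' "pos t j'"] head[of t j'] Suc.prems j' by simp
        also have "\<dots> = fst (tape_at w t j') (snd (tape_at w t j'))"
          using IH(1,3)[OF j'] head[of t j'] Suc.prems j' by simp
        also have "\<dots> = read_tape (tape_at w t j')" by (cases "tape_at w t j'") simp
        finally show "snd (tm_rules M ! rl t j) ! j' = snd (rule_at w t) ! j'"
          using cfg_wf[of t w] j' by simp
      qed
    qed
    show ?case
    proof (intro allI impI conjI)
      fix j assume j: "j < num_tapes M"
      let ?a = "snd (tm_next M (rule_at w t)) ! j"
      have act: "snd (act ?a u) = snd u + displacement (snd ?a)"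
        "fst (act ?a u) z = (if z = snd u then fst ?a else fst u z)" for u z
        by (cases u; cases ?a; simp)+
      have "int (rule_shift M j (rl t j)) = 1 + displacement (snd ?a)"
        by (simp only: rule_shift_def rule[OF j] shift)
      moreover have "int (pos (Suc t) j + 1) = int (pos t j + rule_shift M j (rl t j))"
        using next_pos[OF Suc.prems j] by (simp only:)
      ultimately show "int (pos (Suc t) j) = snd (tape_at w (Suc t) j) + int T"
        using IH(1)[OF j] unfolding tape_step[OF j] act by simp
      show "rule_state M (rl (Suc t) j) = fst (cfg w (Suc t))"
        unfolding next_state[OF Suc.prems j] state_step by (simp only: rule_state'_def rule[OF j])
      fix i assume i: "i < 2 * T + 1"
      have *: "int i - int T = snd (tape_at w t j) \<longleftrightarrow> i = pos t j"
        using IH(1)[OF j] by auto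
      show "sym (Suc t) j i = fst (tape_at w (Suc t) j) (int i - int T)"
        unfolding tape_step[OF j] act * using write_cell[OF Suc.prems j i] keep[OF Suc.prems j i] IH(3)[OF j i]
        by (simp only: rule_write_def rule[OF j] if_split) simp
    qed
  qed
  from this[of T] have "fst (tape_at w T 2) 0 = 2" using final tapes by auto
  moreover have "length w \<le> P" using n_le by (simp add: w_def)
  moreover from this have "fst (tape_at w T 2) = string_contents [R w]"
    using out[of w] by (simp add: outputs_within_def case_prod_unfold numeral_2_eq_2)
  ultimately show ?thesis by (intro exI[of _ w]) (simp add: string_contents_def split: if_splits)
qed

theorem solution_iff: "(\<exists>f. solution f) \<longleftrightarrow> (\<exists>w. length w \<le> P \<and> R w)"
  using solution_if_witness witness_if_solution by blast

end

section \<open>Printing matrices\<close>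

text \<open>The powers of two are the positive numbers whose only odd divisor is 1. The condition
  has only bounded quantifiers and no exponentiation, so it is definable by an expression.\<close>

lemma power_of_two_iff:
  "(\<exists>k. d = 2 ^ k) \<longleftrightarrow> 0 < d \<and> (\<forall>q<Suc d. d mod q = 0 \<and> q mod 2 = 1 \<longrightarrow> q = (1 :: nat))"
proof
  assume "\<exists>k. d = 2 ^ k"
  then obtain k where k: "d = 2 ^ k" by blast
  have "q = 1" if "d mod q = 0" "q mod 2 = 1" for q
  proof -
    have "q dvd 2 ^ k" using that(1) k by (simp add: dvd_eq_mod_eq_0)
    then obtain i where "q = 2 ^ i" using divides_primepow_nat[of 2 q k] two_is_prime_nat by blast
    then show ?thesis using that(2) by (cases i) auto
  qed
  then show "0 < d \<and> (\<forall>q<Suc d. d mod q = 0 \<and> q mod 2 = 1 \<longrightarrow> q = 1)" using k by simp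
next
  assume "0 < d \<and> (\<forall>q<Suc d. d mod q = 0 \<and> q mod 2 = 1 \<longrightarrow> q = 1)"
  then show "\<exists>k. d = 2 ^ k"
  proof (induction d rule: less_induct)
    case (less d)
    show ?case
    proof (cases "even d")
      case True
      then obtain e where e: "d = 2 * e" by blast
      have "q = 1" if "q < Suc e" "e mod q = 0" "q mod 2 = 1" for q
        using less.prems that e by (metis dvd_eq_mod_eq_0 dvd_mult less_Suc_eq_le mult_2 trans_le_add1)
      then have "\<exists>k. e = 2 ^ k" using less.IH[of e] less.prems e by auto
      then show ?thesis using e by (metis power_Suc)
    next
      case False
      then have "d = 1" using less.prems by (auto simp: odd_iff_mod_2_eq_one)
      then show ?thesis by (metis power_0)
    qed
  qed
qed

lemma nat_bits_conv:
  "nat_bits n = map (\<lambda>k. odd (n div 2 ^ k)) [0..<length (nat_bits n)] \<and> (\<forall>k. k < length (nat_bits n) \<longleftrightarrow> 2 ^ k \<le> n)"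
proof (induction n rule: less_induct)
  case (less n)
  show ?case
  proof (cases "n = 0")
    case True
    then show ?thesis by (simp add: nat_bits.simps)
  next
    case False
    let ?l = "length (nat_bits (n div 2))"
    have bits: "nat_bits n = odd n # nat_bits (n div 2)" using False by (simp add: nat_bits.simps[of n])
    have IH: "nat_bits (n div 2) = map (\<lambda>k. odd (n div 2 div 2 ^ k)) [0..<?l]" "k < ?l \<longleftrightarrow> 2 ^ k \<le> n div 2" for k
      using less.IH[of "n div 2"] False by auto
    have "map (\<lambda>k. odd (n div 2 ^ k)) [0..<Suc ?l] = odd n # map (\<lambda>k. odd (n div 2 ^ Suc k)) [0..<?l]"
      by (simp add: upt_conv_Cons map_Suc_upt[symmetric] comp_def del: upt_Suc)
    also have "\<dots> = nat_bits n" by (subst bits, subst IH(1)) (simp add: div_mult2_eq)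
    finally have "nat_bits n = map (\<lambda>k. odd (n div 2 ^ k)) [0..<length (nat_bits n)]" by (simp add: bits)
    moreover have "k < length (nat_bits n) \<longleftrightarrow> 2 ^ k \<le> n" for k
      using False IH(2)[of "k - 1"] by (cases k) (auto simp: bits)
    ultimately show ?thesis by blast
  qed
qed

text \<open>The increasing powers of two d up to n give the bits \<open>n div d mod 2\<close>, least
  significant first. Searching for them among all numbers up to n takes time polynomial in n, which
  suffices for polynomially bounded entries.\<close>

lemma enc_nat_conv:
  "enc_nat n = concat (map (\<lambda>d. if \<exists>k. d = 2 ^ k then [True] @ [n div d mod 2 = 1] else []) [0..<Suc n]) @ [False]"
proof -
  let ?P = "\<lambda>d :: nat. \<exists>k. d = 2 ^ k"
  have "filter ?P [0..<Suc n] = map (\<lambda>k. 2 ^ k) [0..<length (nat_bits n)]"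
  proof (rule sorted_distinct_set_unique)
    show "sorted (filter ?P [0..<Suc n])" by (rule sorted_wrt_filter) (simp del: upt_Suc)
    show "distinct (filter ?P [0..<Suc n])" by (simp del: upt_Suc)
    show "sorted (map (\<lambda>k. 2 ^ k :: nat) [0..<length (nat_bits n)])"
      by (auto simp: sorted_iff_nth_mono)
    show "distinct (map (\<lambda>k. 2 ^ k :: nat) [0..<length (nat_bits n)])"
      by (auto simp: distinct_map inj_on_def)
    have "set (filter ?P [0..<Suc n]) = {d. ?P d \<and> d \<le> n}"
      by (auto simp: less_Suc_eq_le simp del: upt_Suc)
    also have "\<dots> = (\<lambda>k. 2 ^ k) ` {k. (2 :: nat) ^ k \<le> n}" by auto
    also have "{k. (2 :: nat) ^ k \<le> n} = {0..<length (nat_bits n)}"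
      by (intro Set.set_eqI) (simp only: mem_Collect_eq atLeastLessThan_iff le0 simp_thms conjunct2[OF nat_bits_conv, rule_format])
    finally show "set (filter ?P [0..<Suc n]) = set (map (\<lambda>k. 2 ^ k :: nat) [0..<length (nat_bits n)])"
      by (simp del: upt_Suc)
  qed
  moreover have "concat (map (\<lambda>d. if Q d then h d else []) ds) = concat (map h (filter Q ds))" for Q ds and h :: "nat \<Rightarrow> bool list"
    by (induction ds) auto
  ultimately have "concat (map (\<lambda>d. if ?P d then [True] @ [n div d mod 2 = 1] else []) [0..<Suc n]) =
      concat (map (\<lambda>k. [True, n div 2 ^ k mod 2 = 1]) [0..<length (nat_bits n)])"
    by (simp only: map_map comp_def append.simps)
  also have "\<dots> = concat (map (\<lambda>b. [True, b]) (map (\<lambda>k. odd (n div 2 ^ k)) [0..<length (nat_bits n)]))"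
    by (simp add: comp_def odd_iff_mod_2_eq_one)
  also have "map (\<lambda>k. odd (n div 2 ^ k)) [0..<length (nat_bits n)] = nat_bits n"
    by (rule conjunct1[OF nat_bits_conv, symmetric])
  finally show ?thesis by (simp only: enc_nat_def)
qed

lemma sexp_fun_enc_nat:
  assumes "nexp_fun F"
  shows "sexp_fun (\<lambda>x v. enc_nat (F x v))"
  unfolding enc_nat_conv power_of_two_iff
  by (intro sexp_fun_append sexp_fun_concat sexp_fun_if sexp_fun_bit sexp_fun_empty nexp_fun_Suc assms nexp_pred_conj nexp_pred_all nexp_pred_imp
      nexp_pred_less nexp_pred_eq nexp_fun_mod nexp_fun_div nexp_fun_var nexp_fun_const nexp_fun_weaken[OF assms] nexp_pred_const)

text \<open>The gcd is picked out by a sum with one nonzero term, the common divisor that is at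
  least every other one. Positivity of the second argument bounds the search.\<close>

lemma nexp_fun_gcd:
  assumes F: "nexp_fun F" and G: "nexp_fun G" and pos: "\<And>x v. G x v > 0"
  shows "nexp_fun (\<lambda>x v. gcd (F x v) (G x v))"
proof -
  have *: "gcd a b = (\<Sum>d<Suc b. d * of_bool (a mod d = 0 \<and> b mod d = 0 \<and> (\<forall>e<Suc b. a mod e = 0 \<and> b mod e = 0 \<longrightarrow> e \<le> d)))"
    if "b > 0" for a b :: nat
  proof -
    have "(a mod d = 0 \<and> b mod d = 0 \<and> (\<forall>e<Suc b. a mod e = 0 \<and> b mod e = 0 \<longrightarrow> e \<le> d)) \<longleftrightarrow> d = gcd a b" for d
    proof
      assume d: "a mod d = 0 \<and> b mod d = 0 \<and> (\<forall>e<Suc b. a mod e = 0 \<and> b mod e = 0 \<longrightarrow> e \<le> d)"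
      then have "d dvd gcd a b" by (auto simp: dvd_eq_mod_eq_0[symmetric])
      moreover have "gcd a b \<le> d" using d that gcd_le2_nat[of b a] by (auto simp: less_Suc_eq_le)
      moreover have "gcd a b > 0" using that by simp
      ultimately show "d = gcd a b" using dvd_imp_le le_antisym by blast
    next
      assume d: "d = gcd a b"
      have "e \<le> d" if "a mod e = 0" "b mod e = 0" for e
        using that d \<open>b > 0\<close> by (intro dvd_imp_le) (auto simp: dvd_eq_mod_eq_0[symmetric])
      then show "a mod d = 0 \<and> b mod d = 0 \<and> (\<forall>e<Suc b. a mod e = 0 \<and> b mod e = 0 \<longrightarrow> e \<le> d)"
        using d by auto
    qed
    then have "(\<Sum>d<Suc b. d * of_bool (a mod d = 0 \<and> b mod d = 0 \<and> (\<forall>e<Suc b. a mod e = 0 \<and> b mod e = 0 \<longrightarrow> e \<le> d))) =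
        (\<Sum>d<Suc b. if d = gcd a b then gcd a b else 0)"
      by (intro sum.cong) auto
    moreover have "gcd a b < Suc b" using that gcd_le2_nat[of b a] by linarith
    ultimately show ?thesis by simp
  qed
  note F' = nexp_fun_weaken[OF F] and G' = nexp_fun_weaken[OF G]
  note F'' = nexp_fun_weaken[OF F'] and G'' = nexp_fun_weaken[OF G']
  have "nexp_fun (\<lambda>x v. \<Sum>d<Suc (G x v). d * of_bool (F x v mod d = 0 \<and> G x v mod d = 0 \<and>
      (\<forall>e<Suc (G x v). F x v mod e = 0 \<and> G x v mod e = 0 \<longrightarrow> e \<le> d)))"
    by (intro nexp_fun_sum nexp_fun_Suc nexp_fun_mult nexp_fun_of_bool nexp_pred_conj nexp_pred_all nexp_pred_imp nexp_pred_eq nexp_pred_le nexp_fun_mod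
        nexp_fun_const nexp_fun_var F G F' G' F'' G'')
  then show ?thesis using *[OF pos] by simp
qed

text \<open>The encoding requires lowest terms, hence the gcd; the leading \<open>False\<close> is
  the sign bit.\<close>

lemma enc_rat_of_nat_div:
  assumes "N > 0"
  shows "enc_rat (of_nat u / of_nat N) = [False] @ enc_nat (u div gcd u N) @ enc_nat (N div gcd u N)"
proof -
  have "of_nat u / of_nat N = Fract (int u) (int N)" by (simp add: Fract_of_int_quotient)
  then have "quotient_of (of_nat u / of_nat N) = (int (u div gcd u N), int (N div gcd u N))"
    using assms by (simp add: quotient_of_Fract normalize_def Let_def zdiv_int)
  then show ?thesis by (simp add: enc_rat_def enc_int_def)
qed

lemma polytime_fun_enc_scaled_mat:
  assumes n: "nexp_fun (\<lambda>x v. n x)" and pos: "\<And>x. U x (n x - 1) (n x - 1) > 0"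
    and U: "\<And>A B. nexp_fun A \<Longrightarrow> nexp_fun B \<Longrightarrow> nexp_fun (\<lambda>x v. U x (A x v) (B x v))"
  shows "polytime_fun (\<lambda>x. enc_mat (scaled_mat (n x) (U x)))"
proof -
  have "enc_mat (scaled_mat k V) = enc_nat k @ concat (map (\<lambda>i. concat (map (\<lambda>j.
      [False] @ enc_nat (V i j div gcd (V i j) (V (k - 1) (k - 1))) @
        enc_nat (V (k - 1) (k - 1) div gcd (V i j) (V (k - 1) (k - 1)))) [0..<k])) [0..<k])"
    if "V (k - 1) (k - 1) > 0" for k V
  proof -
    have "map enc_rat (concat (mat_to_list (scaled_mat k V))) = concat (map (\<lambda>i. map (\<lambda>j.
        enc_rat (of_nat (V i j) / of_nat (V (k - 1) (k - 1)))) [0..<k]) [0..<k])"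
      by (auto simp: mat_to_list_def scaled_mat_def map_concat intro!: arg_cong[where f = concat] map_cong)
    moreover have "concat (concat (map (\<lambda>i. map (h i) ks) is)) = concat (map (\<lambda>i. concat (map (h i) ks)) is)"
      for h :: "nat \<Rightarrow> nat \<Rightarrow> bool list" and "is" ks
      by (induction "is") auto
    ultimately show ?thesis using that by (simp add: enc_mat_def enc_rat_of_nat_div scaled_mat_def)
  qed
  moreover have "sexp_fun (\<lambda>x v. enc_nat (n x) @ concat (map (\<lambda>i. concat (map (\<lambda>j.
      [False] @ enc_nat (U x i j div gcd (U x i j) (U x (n x - 1) (n x - 1))) @
        enc_nat (U x (n x - 1) (n x - 1) div gcd (U x i j) (U x (n x - 1) (n x - 1)))) [0..<n x])) [0..<n x]))"
    by (intro sexp_fun_append sexp_fun_enc_nat sexp_fun_concat sexp_fun_bit nexp_pred_const nexp_fun_div nexp_fun_gcd U n nexp_fun_diff nexp_fun_const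
        nexp_fun_var pos)
  ultimately show ?thesis using pos by (intro polytime_fun_if_sexp_fun) simp
qed

section \<open>The reduction\<close>

lemma nexp_fun_clq_entry:
  assumes m: "nexp_fun (\<lambda>x v. m x)" and g: "nexp_fun (\<lambda>x v. g x)"
    and C: "\<And>A B. nexp_fun A \<Longrightarrow> nexp_fun B \<Longrightarrow> nexp_pred (\<lambda>x v. C x (A x v) (B x v))"
    and A: "nexp_fun A" and B: "nexp_fun B"
  shows "nexp_fun (\<lambda>x v. clq_entry (m x) (g x) (C x) (A x v) (B x v))"
proof -
  note basic = nexp_fun_add nexp_fun_diff nexp_fun_mult nexp_fun_div nexp_fun_if nexp_fun_of_bool nexp_fun_const nexp_fun_var nexp_pred_less nexp_pred_eq
    nexp_pred_not nexp_pred_disj m g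
  have deg: "nexp_fun (\<lambda>x v. clq_deg (m x) (g x) (C x) (F x v))" if "nexp_fun F" for F
    unfolding clq_deg_def by (intro nexp_fun_sum basic C nexp_fun_weaken[OF that])
  have total: "nexp_fun (\<lambda>x v. clq_total (m x) (g x) (C x))"
    unfolding clq_total_def by (intro nexp_fun_sum basic deg)
  have diag: "nexp_fun (\<lambda>x v. clq_diag (m x) (g x) (C x) (F x v))" if "nexp_fun F" for F
    unfolding clq_diag_def by (intro nexp_fun_sum basic total deg that nexp_fun_weaken[OF that])
  have off: "nexp_fun (\<lambda>x v. clq_off (m x) (g x) (C x) (F x v) (G x v))" if "nexp_fun F" "nexp_fun G" for F G
    unfolding clq_off_def by (intro basic C that)
  have min: "nexp_fun (\<lambda>x v. min (F x v) (G x v))" "nexp_fun (\<lambda>x v. max (F x v) (G x v))" if "nexp_fun F" "nexp_fun G" for F G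
    unfolding min_def max_def by (intro basic nexp_pred_le that)+
  have core: "nexp_fun (\<lambda>x v. clq_core (m x) (g x) (C x) (F x v) (G x v))" if "nexp_fun F" "nexp_fun G" for F G
    unfolding clq_core_def by (intro basic diag off min that)
  have row: "nexp_fun (\<lambda>x v. clq_row (m x) (g x) (C x) (F x v) (G x v))" if "nexp_fun F" "nexp_fun G" for F G
    unfolding clq_row_def by (intro basic nexp_fun_sum diag core that nexp_fun_weaken[OF that(1)] nexp_fun_weaken[OF that(2)])
  have upper: "nexp_fun (\<lambda>x v. clq_upper (m x) (g x) (C x) (F x v) (G x v))" if "nexp_fun F" "nexp_fun G" for F G
    unfolding clq_upper_def
    by (intro basic nexp_fun_sum diag off row that nexp_fun_weaken[OF that(1)] nexp_fun_weaken[OF that(2)])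
  show ?thesis
    unfolding clq_entry_def by (intro upper min A B)
qed

text \<open>The machine is fixed, so a function of its rules is a constant table, and the remainder
  keeps the argument inside that table.\<close>

lemma nexp_fun_rule_table:
  assumes "n > 0" "nexp_fun F"
  shows "nexp_fun (\<lambda>x v. f (F x v mod n))"
proof -
  have "nexp_fun (\<lambda>x v. (if F x v mod n < n then f (F x v mod n) else 0))"
    by (rule nexp_fun_table[of _ n "\<lambda>k. if k < n then f k else 0" 0]) (auto intro: nexp_fun_mod assms nexp_fun_const)
  then show ?thesis using assms(1) by simp
qed

lemma nexp_fun_rule_table2:
  assumes "n > 0" "nexp_fun F" "nexp_fun J" "\<And>x v. J x v < k"
  shows "nexp_fun (\<lambda>x v. f (J x v) (F x v mod n))"
proof -
  have "nexp_fun (\<lambda>x v. (if J x v < k \<and> F x v mod n < n then f (J x v) (F x v mod n) else 0))"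
    by (rule nexp_fun_table2[of _ _ k n "\<lambda>j i. if j < k \<and> i < n then f j i else 0" 0]) (auto intro: nexp_fun_mod assms nexp_fun_const)
  then show ?thesis using assms(1,4) by simp
qed

lemma nexp_pred_iff: "nexp_pred P \<Longrightarrow> nexp_pred Q \<Longrightarrow> nexp_pred (\<lambda>x v. P x v \<longleftrightarrow> Q x v)"
  unfolding iff_conv_conj_imp by (intro nexp_pred_conj nexp_pred_imp)

lemma nexp_pred_tab_con:
  assumes rules: "num_rules M > 0" and j_less: "\<And>x v. j x v < num_tapes M"
    and [intro]: "nexp_fun T" "nexp_fun P" "nexp_fun t" "nexp_fun j" "nexp_fun i" "nexp_fun a" "nexp_fun t'" "nexp_fun j'" "nexp_fun i'" "nexp_fun a'"
  shows "nexp_pred (\<lambda>x v. tab_con M (T x v) (P x v) x (t x v) (j x v) (i x v) (a x v) (t' x v) (j' x v) (i' x v) (a' x v))"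
proof -
  note table = nexp_fun_rule_table[OF rules] and table2 = nexp_fun_rule_table2[OF rules _ _ j_less]
  show ?thesis
    unfolding tab_con_def
    by (intro nexp_pred_conj nexp_pred_imp nexp_pred_not nexp_pred_iff nexp_pred_less nexp_pred_eq nexp_pred_le nexp_pred_bit nexp_fun_if nexp_fun_add
        nexp_fun_mult nexp_fun_diff nexp_fun_div table[where f = "rule_state M"] table[where f = "rule_state' M"]
        table2[where f = "rule_read M"] table2[where f = "rule_write M"] table2[where f = "rule_shift M"]
        nexp_fun_mod nexp_fun_const nexp_fun_length assms(3-))
qed

text \<open>The clique problem has groups of one common size. The sum bounds both the values of head
  variables and those of cell variables.\<close>

definition tab_width :: "turing_machine \<Rightarrow> nat \<Rightarrow> nat" where
  "tab_width M T = (2 * T + 1) * num_rules M + 2 * num_symbols M"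

text \<open>Decodes the nodes: quotient by the width is the variable, numbered
  \<open>(t * num_tapes M + j) * (2 * T + 2) + i\<close>, and the remainder is its value.\<close>

definition tab_dir :: "turing_machine \<Rightarrow> nat \<Rightarrow> nat \<Rightarrow> bool list \<Rightarrow> nat \<Rightarrow> nat \<Rightarrow> bool" where
  "tab_dir M T P x v w \<longleftrightarrow> tab_con M T P x
    (v div tab_width M T div (2 * T + 2) div num_tapes M) (v div tab_width M T div (2 * T + 2) mod num_tapes M)
    (v div tab_width M T mod (2 * T + 2)) (v mod tab_width M T)
    (w div tab_width M T div (2 * T + 2) div num_tapes M) (w div tab_width M T div (2 * T + 2) mod num_tapes M)
    (w div tab_width M T mod (2 * T + 2)) (w mod tab_width M T)"

text \<open>\<open>tab_con\<close> is directed. Imposing both directions and distinct groups gives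
  the two properties that \<open>in_cone_entry_iff\<close> assumes of \<open>C\<close>.\<close>

definition tab_edge :: "turing_machine \<Rightarrow> nat \<Rightarrow> nat \<Rightarrow> bool list \<Rightarrow> nat \<Rightarrow> nat \<Rightarrow> bool" where
  "tab_edge M T P x v w \<longleftrightarrow> v div tab_width M T \<noteq> w div tab_width M T \<and> tab_dir M T P x v w \<and> tab_dir M T P x w v"

lemma nexp_pred_tab_edge:
  assumes "num_rules M > 0" "num_tapes M > 0"
    and T: "nexp_fun T" and P: "nexp_fun P" and A: "nexp_fun A" and B: "nexp_fun B"
  shows "nexp_pred (\<lambda>x v. tab_edge M (T x v) (P x v) x (A x v) (B x v))"
proof -
  note arith = nexp_fun_add nexp_fun_mult nexp_fun_div nexp_fun_mod nexp_fun_const T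
  have dir: "nexp_pred (\<lambda>x v. tab_dir M (T x v) (P x v) x (F x v) (G x v))" if "nexp_fun F" "nexp_fun G" for F G
    unfolding tab_dir_def tab_width_def
    by (intro nexp_pred_tab_con assms(1) P that arith) (use assms(2) in simp)
  show ?thesis
    unfolding tab_edge_def
    by (intro nexp_pred_conj nexp_pred_not nexp_pred_eq dir A B) (unfold tab_width_def, (intro arith A B)+)
qed

context tableau
begin

abbreviation num_vars :: nat where
  "num_vars \<equiv> (T + 1) * num_tapes M * (2 * T + 2)"

lemma index_div_mod:
  assumes "j < num_tapes M" "i \<le> 2 * T + 1"
  shows "((t * num_tapes M + j) * (2 * T + 2) + i) div (2 * T + 2) div num_tapes M = t"
    "((t * num_tapes M + j) * (2 * T + 2) + i) div (2 * T + 2) mod num_tapes M = j"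
    "((t * num_tapes M + j) * (2 * T + 2) + i) mod (2 * T + 2) = i"
proof -
  have "((t * num_tapes M + j) * (2 * T + 2) + i) div (2 * T + 2) = t * num_tapes M + j"
    using assms(2) by (simp only: div_mult_self3 div_less)
  then show "((t * num_tapes M + j) * (2 * T + 2) + i) div (2 * T + 2) div num_tapes M = t"
    "((t * num_tapes M + j) * (2 * T + 2) + i) div (2 * T + 2) mod num_tapes M = j"
    using assms(1) by simp_all
  show "((t * num_tapes M + j) * (2 * T + 2) + i) mod (2 * T + 2) = i"
    using assms(2) by (simp only: mod_mult_self3) simp
qed

lemma solution_iff_clique:
  "(\<exists>f. solution f) \<longleftrightarrow> (\<exists>sel. (\<forall>b<num_vars. sel b < tab_width M T) \<and>
    (\<forall>b<num_vars. \<forall>c<num_vars. b < c \<longrightarrow>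
      tab_edge M T P x (b * tab_width M T + sel b) (c * tab_width M T + sel c)))"
proof
  assume "\<exists>f. solution f"
  then obtain f where f: "solution f" by blast
  define sel where "sel b = f (b div (2 * T + 2) div num_tapes M) (b div (2 * T + 2) mod num_tapes M) (b mod (2 * T + 2))" for b
  have range: "b div (2 * T + 2) div num_tapes M \<le> T" "b div (2 * T + 2) mod num_tapes M < num_tapes M"
    "b mod (2 * T + 2) \<le> 2 * T + 1" if "b < num_vars" for b
  proof -
    have "b < (T + 1) * num_tapes M * (2 * T + 2)" using that .
    then have "b div (2 * T + 2) < (T + 1) * num_tapes M" by (rule less_mult_imp_div_less)
    then have "b div (2 * T + 2) div num_tapes M < T + 1" by (rule less_mult_imp_div_less)
    then show "b div (2 * T + 2) div num_tapes M \<le> T" by simp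
    show "b div (2 * T + 2) mod num_tapes M < num_tapes M" using tapes by simp
    show "b mod (2 * T + 2) \<le> 2 * T + 1" using mod_less_divisor[of "2 * T + 2" b] by linarith
  qed
  have sel: "sel b < tab_width M T" if "b < num_vars" for b
    using f range[OF that] unfolding solution_def sel_def tab_width_def by blast
  have "tab_dir M T P x (b * tab_width M T + sel b) (c * tab_width M T + sel c)"
    if "b < num_vars" "c < num_vars" "b \<noteq> c" for b c
  proof -
    have "(b div (2 * T + 2) div num_tapes M, b div (2 * T + 2) mod num_tapes M, b mod (2 * T + 2)) \<noteq>
        (c div (2 * T + 2) div num_tapes M, c div (2 * T + 2) mod num_tapes M, c mod (2 * T + 2))"
      using that(3) by (metis div_mult_mod_eq prod.inject)
    then show ?thesis
      using f range[OF that(1)] range[OF that(2)] sel[OF that(1)] sel[OF that(2)]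
      unfolding solution_def tab_dir_def by (simp add: sel_def)
  qed
  moreover have "(b * tab_width M T + sel b) div tab_width M T = b" if "b < num_vars" for b
    using sel[OF that] by simp
  ultimately have "tab_edge M T P x (b * tab_width M T + sel b) (c * tab_width M T + sel c)"
    if "b < num_vars" "c < num_vars" "b < c" for b c
    unfolding tab_edge_def using that by (metis less_irrefl)
  then show "\<exists>sel. (\<forall>b<num_vars. sel b < tab_width M T) \<and>
    (\<forall>b<num_vars. \<forall>c<num_vars. b < c \<longrightarrow>
      tab_edge M T P x (b * tab_width M T + sel b) (c * tab_width M T + sel c))"
    using sel by blast
next
  assume "\<exists>sel. (\<forall>b<num_vars. sel b < tab_width M T) \<and>
    (\<forall>b<num_vars. \<forall>c<num_vars. b < c \<longrightarrow>
      tab_edge M T P x (b * tab_width M T + sel b) (c * tab_width M T + sel c))"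
  then obtain sel where sel: "\<And>b. b < num_vars \<Longrightarrow> sel b < tab_width M T"
    and edge: "\<And>b c. b < num_vars \<Longrightarrow> c < num_vars \<Longrightarrow> b < c \<Longrightarrow>
      tab_edge M T P x (b * tab_width M T + sel b) (c * tab_width M T + sel c)"
    by blast
  define ix where "ix t j i = (t * num_tapes M + j) * (2 * T + 2) + i" for t j i
  have ix: "ix t j i < num_vars" if "t \<le> T" "j < num_tapes M" "i \<le> 2 * T + 1" for t j i
  proof -
    have "t * num_tapes M + j < Suc t * num_tapes M" using that(2) by simp
    also have "\<dots> \<le> (T + 1) * num_tapes M" using that(1) by (intro mult_le_mono1) simp
    finally have *: "Suc (t * num_tapes M + j) \<le> (T + 1) * num_tapes M" by simp
    have "ix t j i < Suc (t * num_tapes M + j) * (2 * T + 2)" using that(3) by (simp add: ix_def)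
    also have "\<dots> \<le> num_vars" using * by (rule mult_le_mono1)
    finally show ?thesis .
  qed
  have ix_inj: "(t, j, i) = (t', j', i')"
    if "ix t j i = ix t' j' i'" "j < num_tapes M" "i \<le> 2 * T + 1" "j' < num_tapes M" "i' \<le> 2 * T + 1" for t j i t' j' i'
    using that index_div_mod[of j i t] index_div_mod[of j' i' t'] unfolding ix_def by metis
  have "tab_con M T P x t j i (sel (ix t j i)) t' j' i' (sel (ix t' j' i'))"
    if "t \<le> T" "j < num_tapes M" "i \<le> 2 * T + 1" "t' \<le> T" "j' < num_tapes M" "i' \<le> 2 * T + 1" "(t, j, i) \<noteq> (t', j', i')"
    for t j i t' j' i'
  proof -
    have "ix t j i \<noteq> ix t' j' i'" using ix_inj that by blast
    then have "tab_dir M T P x (ix t j i * tab_width M T + sel (ix t j i)) (ix t' j' i' * tab_width M T + sel (ix t' j' i'))"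
      using edge ix that unfolding tab_edge_def by (metis linorder_neqE_nat)
    then show ?thesis
      using sel[OF ix[OF that(1-3)]] sel[OF ix[OF that(4-6)]] index_div_mod[OF that(2,3), of t] index_div_mod[OF that(5,6), of t']
      unfolding tab_dir_def by (simp add: ix_def)
  qed
  moreover have "sel (ix t j i) < (2 * T + 1) * num_rules M + 2 * num_symbols M"
    if "t \<le> T" "j < num_tapes M" "i \<le> 2 * T + 1" for t j i
    using sel[OF ix[OF that]] by (simp add: tab_width_def)
  ultimately have "solution (\<lambda>t j i. sel (ix t j i))" unfolding solution_def by blast
  then show "\<exists>f. solution f" by blast
qed

end

lemma scaled_mat_normalized:
  assumes n: "n \<ge> 1" and pos: "U (n - 1) (n - 1) > 0"
    and sym: "\<And>i j. i < n \<Longrightarrow> j < n \<Longrightarrow> U i j = U j i" and last: "\<And>i. i < n \<Longrightarrow> U i (n - 1) = U i i"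
  shows "scaled_mat n U \<in> normalized_sym_rat_mats"
proof -
  have "transpose_mat (scaled_mat n U) = scaled_mat n U"
    using sym by (intro eq_matI) (auto simp: scaled_mat_def)
  moreover have "scaled_mat n U \<in> carrier_mat n n" by (simp add: scaled_mat_def)
  moreover have "scaled_mat n U $$ (i, n - 1) = scaled_mat n U $$ (i, i)"
    "scaled_mat n U $$ (n - 1, i) = scaled_mat n U $$ (i, i)" if "i < n" for i
    using that n last[OF that] sym[of "n - 1" i] by (simp_all add: scaled_mat_def)
  moreover have "scaled_mat n U $$ (n - 1, n - 1) = 1" using n pos by (simp add: scaled_mat_def)
  ultimately show ?thesis unfolding normalized_sym_rat_mats_def using n by blast
qed

lemma outputs_within_mono:
  assumes "outputs_within M xs y s" "s \<le> t"
  shows "outputs_within M xs y t"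
proof -
  have halted: "(step M ^^ k) (num_states M, ts) = (num_states M, ts)" for k ts
    by (induction k) auto
  obtain ts where "(step M ^^ s) (init_config M xs) = (num_states M, ts)"
    using assms(1) unfolding outputs_within_def by (auto split: prod.splits)
  moreover have "t = (t - s) + s" using assms(2) by simp
  ultimately have "(step M ^^ t) (init_config M xs) = (step M ^^ s) (init_config M xs)"
    using halted by (metis comp_apply funpow_add)
  then show ?thesis using assms(1) by (simp add: outputs_within_def)
qed

lemma clq_entry_last:
  "clq_entry m g C (clq_order m g - 1) (clq_order m g - 1) = clq_total m g C"
  by (simp add: clq_entry_def clq_upper_def clq_diag_def clq_order_def)

lemma NP_hard_normalized: "NP_hard enc_mat normalized_sym_rat_mats in_correlation_cone"
  unfolding NP_hard_def
proof
  fix L assume "L \<in> class_NP"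
  then obtain R and p :: "nat poly" where R: "polytime_rel R" and L: "L = {x. \<exists>w. length w \<le> poly p (length x) \<and> R x w}"
    unfolding class_NP_def by blast
  from R obtain M and q :: "nat poly" where wf: "wf_tm M" and tapes: "num_tapes M \<ge> 3"
    and out: "\<And>x w. outputs_within M [x, w] [R x w] (poly q (length x + length w))"
    unfolding polytime_rel_def by blast
  define P where "P x = poly p (length x)" for x :: "bool list"
  \<comment> \<open>The two lengths are added to the running time so that the window assumptions of
    \<open>tableau\<close> hold.\<close>
  define T where "T x = poly q (length x + P x) + length x + P x" for x
  define m where "m x = (T x + 1) * num_tapes M * (2 * T x + 2)" for x
  define g where "g x = tab_width M (T x)" for x
  define C where "C x = tab_edge M (T x) (P x) x" for x
  define U where "U x = clq_entry (m x) (g x) (C x)" for x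
  define n where "n x = clq_order (m x) (g x)" for x
  have "num_symbols M > 0" using wf by (simp add: wf_tm_def)
  \<comment> \<open>The tuple of blanks shows that there is a rule, so that quotients and remainders
    by the number of rules are meaningful.\<close>
  then have "replicate (num_tapes M) 0 \<in> set (List.n_lists (num_tapes M) [0..<num_symbols M])"
    by (auto simp: set_n_lists)
  then have rules: "num_rules M > 0"
    by (auto simp: tm_rules_def simp del: upt_Suc intro!: Nat.gr0I)
  have m: "m x > 0" for x using tapes by (simp add: m_def)
  have g: "g x > 0" for x using \<open>num_symbols M > 0\<close> by (simp add: g_def tab_width_def)
  have pos: "U x (n x - 1) (n x - 1) > 0" for x
  proof -
    \<comment> \<open>The corner must be positive for every \<open>x\<close>, in \<open>L\<close> or
      not, because the image of a reduction has to be an instance. The bound m <= m g keeps the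
      truncated subtraction of 3 m harmless.\<close>
    have *: "0 < 2 + k + 4 * l - 3 * m'" if "m' * 1 \<le> l" for k l m' :: nat
      using that by linarith
    have "m x * 1 \<le> m x * g x" using g[of x] by (intro mult_le_mono2) simp
    from *[OF this] show ?thesis unfolding U_def n_def clq_entry_last clq_total_def add.assoc[of 2] .
  qed
  have tab: "tableau M (T x) (P x) x (R x)" for x
  proof
    fix w :: "bool list" assume "length w \<le> P x"
    then have "poly q (length x + length w) \<le> T x"
      using poly_nat_mono[of "length x + length w" "length x + P x" q] by (simp add: T_def)
    then show "outputs_within M [x, w] [R x w] (T x)" using out outputs_within_mono by blast
  qed (use wf tapes in \<open>simp_all add: T_def\<close>)
  have correct: "x \<in> L \<longleftrightarrow> in_correlation_cone (scaled_mat (n x) (U x))" for x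
  proof -
    interpret tableau M "T x" "P x" x "R x" by (rule tab)
    have "x \<in> L \<longleftrightarrow> (\<exists>f. solution f)" unfolding solution_iff by (simp add: L P_def)
    also have "\<dots> \<longleftrightarrow> (\<exists>sel. (\<forall>b<m x. sel b < g x) \<and> (\<forall>b<m x. \<forall>c<m x. b < c \<longrightarrow> C x (b * g x + sel b) (c * g x + sel c)))"
      unfolding solution_iff_clique m_def g_def C_def ..
    also have "\<dots> \<longleftrightarrow> in_cone (n x) (\<lambda>i j. real (U x i j))"
      unfolding n_def U_def by (rule in_cone_entry_iff[symmetric]) (use m in \<open>auto simp: C_def g_def tab_edge_def\<close>)
    also have "\<dots> \<longleftrightarrow> in_correlation_cone (scaled_mat (n x) (U x))"
      using pos by (rule in_correlation_cone_scaled_mat[symmetric])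
    finally show ?thesis .
  qed
  have inst: "scaled_mat (n x) (U x) \<in> normalized_sym_rat_mats" for x
  proof (rule scaled_mat_normalized)
    show "U x (n x - 1) (n x - 1) > 0" by (rule pos)
    show "U x i j = U x j i" for i j by (simp add: U_def clq_entry_def min.commute max.commute)
    show "U x i (n x - 1) = U x i i" if "i < n x" for i
      using that by (simp add: U_def n_def clq_order_def clq_entry_def clq_upper_def max_def min_def)
  qed (simp add: n_def clq_order_def)
  have cP: "nexp_fun (\<lambda>x v. P x)" unfolding P_def by (intro nexp_fun_poly nexp_fun_length)
  have cT: "nexp_fun (\<lambda>x v. T x)" unfolding T_def by (intro nexp_fun_add nexp_fun_poly nexp_fun_length cP)
  have cm: "nexp_fun (\<lambda>x v. m x)" and cg: "nexp_fun (\<lambda>x v. g x)"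
    unfolding m_def g_def tab_width_def by (intro nexp_fun_add nexp_fun_mult nexp_fun_const cT)+
  have cn: "nexp_fun (\<lambda>x v. n x)"
    unfolding n_def clq_order_def by (intro nexp_fun_add nexp_fun_mult nexp_fun_const cm cg)
  have "polytime_fun (\<lambda>x. enc_mat (scaled_mat (n x) (U x)))"
  proof (rule polytime_fun_enc_scaled_mat)
    show "nexp_fun (\<lambda>x v. n x)" "U x (n x - 1) (n x - 1) > 0" for x by (fact cn pos)+
    have "nexp_pred (\<lambda>x v. C x (A x v) (B x v))" if "nexp_fun A" "nexp_fun B" for A B
      unfolding C_def using rules tapes that by (intro nexp_pred_tab_edge cT cP) simp_all
    then show "nexp_fun (\<lambda>x v. U x (A x v) (B x v))" if "nexp_fun A" "nexp_fun B" for A B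
      unfolding U_def using that by (intro nexp_fun_clq_entry cm cg)
  qed
  moreover have "\<forall>x. \<exists>a\<in>normalized_sym_rat_mats. enc_mat (scaled_mat (n x) (U x)) = enc_mat a \<and>
      (x \<in> L \<longleftrightarrow> in_correlation_cone a)"
    by (rule allI, rule bexI[OF _ inst]) (simp only: correct)
  ultimately show "\<exists>f. polytime_fun f \<and>
      (\<forall>x. \<exists>a\<in>normalized_sym_rat_mats. f x = enc_mat a \<and> (x \<in> L) = in_correlation_cone a)"
    by (intro exI conjI)
qed

lemma NP_hard_mono:
  assumes "NP_hard enc I Q" "I \<subseteq> J"
  shows "NP_hard enc J Q"
  unfolding NP_hard_def
proof
  fix L assume "L \<in> class_NP"
  then have "\<exists>f. polytime_fun f \<and> (\<forall>x. \<exists>a\<in>I. f x = enc a \<and> (x \<in> L \<longleftrightarrow> Q a))"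
    using assms(1) unfolding NP_hard_def by (rule bspec[rotated])
  then obtain f where "polytime_fun f" and f: "\<And>x. \<exists>a\<in>I. f x = enc a \<and> (x \<in> L \<longleftrightarrow> Q a)"
    by auto
  moreover have "\<forall>x. \<exists>a\<in>J. f x = enc a \<and> (x \<in> L \<longleftrightarrow> Q a)"
    using f assms(2) by (meson subsetD)
  ultimately show "\<exists>f. polytime_fun f \<and> (\<forall>x. \<exists>a\<in>J. f x = enc a \<and> (x \<in> L \<longleftrightarrow> Q a))"
    by (intro exI conjI)
qed

theorem theorem4p1:
  shows "NP_hard enc_mat sym_rat_mats in_correlation_cone \<and>
    NP_hard enc_mat normalized_sym_rat_mats in_correlation_cone"
proof -
  have "normalized_sym_rat_mats \<subseteq> sym_rat_mats"
    unfolding normalized_sym_rat_mats_def sym_rat_mats_def by blast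
  then show ?thesis using NP_hard_mono[OF NP_hard_normalized] NP_hard_normalized by simp
qed

end
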